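(* Let $\mathcal X$ be a complete separable metric space and let $\xi$ be a point process on $\mathcal X$ with intensity measure $\mu$, where $\mu(A) = \mathbb{E}\,\xi(A)$ for Borel sets $A \subseteq \mathcal X$, and $\mu(A) < \infty$ for every bounded Borel set $A$. Let $\xi_1, \xi_2, \dots$ be IID copies of $\xi$. Then the thinned superposition \[ \frac{1}{n}\circ (\xi_1 + \xi_2 + \cdots + \xi_n) \] converges weakly, as $n \to \infty$, to a Poisson process on $\mathcal X$ with intensity measure $\mu$.
   Context: Let $\mathcal X$ be a complete separable metric space with its Borel $\sigma$-algebra. A measure on $\mathcal X$ is boundedly finite if it is finite on every bounded Borel set (bounded with respect to the given metric). Let $\mathcal N$ be the set of boundedly finite, non-negative-integer-valued Borel measures (counting measures) on $\mathcal X$; each such measure is a finite or countable sum of unit point masses $\sum_i \delta_{x_i}$, where points may be repeated. Equip $\mathcal N$ with the topology in which $\nu_n \to \nu$ if and only if $\int f\,\mathrm d\nu_n \to \int f\,\mathrm d\nu$ for every bounded continuous $f\colon \mathcal X \to \mathbb R$ vanishing outside a bounded set, and with the corresponding Borel $\sigma$-algebra, which is the one generated by the maps $\nu \mapsto \nu(A)$, $A$ Borel. A point process on $\mathcal X$ is a random element $\xi$ of $\mathcal N$. It is regarded as a random counting measure, with $\xi(A)$ the number of points (with multiplicity) in $A$. Its intensity measure is $\mu(A) = \mathbb E\,\xi(A)$. The superposition of point processes $\xi_1, \dots, \xi_n$ is the sum $\xi_1 + \cdots + \xi_n$ of the random measures. For $p \in [0,1]$, the thinning $p \circ \xi$ of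 a point process $\xi$ is the point process obtained by keeping each point of $\xi$ with probability $p$ and deleting it with probability $1-p$, independently over all points (repeated points being treated separately): if $\xi = \sum_i \delta_{x_i}$, then, conditionally on $\xi$, $p \circ \xi = \sum_i B_i \delta_{x_i}$ with $B_i$ IID Bernoulli$(p)$. A Poisson process with (boundedly finite) intensity measure $\mu$ is a point process $\eta$ such that, for all disjoint bounded Borel sets $A_1, \dots, A_k$, the variables $\eta(A_1), \dots, \eta(A_k)$ are independent and $\eta(A_i)$ has the Poisson distribution with mean $\mu(A_i)$. The measure $\mu$ may have atoms. Point processes $\eta_n$ converge weakly to a point process $\eta$ if their distributions converge weakly as probability measures on $\mathcal N$ with the topology in which $\nu_n \to \nu$ if and only if $\int f\,\mathrm d\nu_n \to \int f\,\mathrm d\nu$ for every bounded continuous $f\colon \mathcal X \to \mathbb R$ vanishing outside a bounded set, i.e. $\mathbb E\,F(\eta_n) \to \mathbb E\,F(\eta)$ for every bounded continuous $F\colon \mathcal N \to \mathbb R$. *)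

theory Defs
  imports "HOL-Probability.Probability"
begin

definition boundedly_finite :: "'a::metric_space measure \<Rightarrow> bool" where
  "boundedly_finite \<nu> \<longleftrightarrow> sets \<nu> = sets borel \<and>
     (\<forall>A \<in> sets borel. bounded A \<longrightarrow> emeasure \<nu> A < \<infinity>)"

text \<open>A boundedly finite counting measure may have infinite total mass, hence the value
  \<open>\<infinity>\<close> is admitted; bounded finiteness excludes it on bounded sets.\<close>

definition counting_measures :: "'a::metric_space measure set" where
  "counting_measures =
     {\<nu>. boundedly_finite \<nu> \<and> (\<forall>A \<in> sets borel. emeasure \<nu> A \<in> insert \<infinity> (range of_nat))}"

definition test_functions :: "('a::metric_space \<Rightarrow> real) set" where
  "test_functions =
     {f. continuous_on UNIV f \<and> bounded (range f) \<and> (\<exists>B. bounded B \<and> (\<forall>x. x \<notin> B \<longrightarrow> f x = 0))}"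

text \<open>The initial topology with respect to the maps \<open>\<nu> \<mapsto> \<integral>f d\<nu>\<close>. On a complete
  separable metric space it is metrizable, so it is determined by its convergent sequences.\<close>

definition vague_topology :: "'a::metric_space measure topology" where
  "vague_topology = topology_generated_by
     {{\<nu> \<in> counting_measures. (\<integral>x. f x \<partial>\<nu>) \<in> U} | f U. f \<in> test_functions \<and> open U}"

text \<open>The \<open>\<sigma>\<close>-algebra generated by the evaluations \<open>\<nu> \<mapsto> \<nu>(A)\<close>. On a complete separable
  metric space it is the Borel \<open>\<sigma>\<close>-algebra of \<open>vague_topology\<close>.\<close>

definition counting_algebra :: "'a::metric_space measure measure" where
  "counting_algebra = sigma counting_measures
     {{\<nu> \<in> counting_measures. emeasure \<nu> A \<in> B} | A B. A \<in> sets borel \<and> B \<in> sets borel}"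

definition point_process :: "'w measure \<Rightarrow> ('w \<Rightarrow> 'a::metric_space measure) \<Rightarrow> bool" where
  "point_process M \<xi> \<longleftrightarrow> prob_space M \<and> \<xi> \<in> M \<rightarrow>\<^sub>M counting_algebra"

definition intensity_measure :: "'w measure \<Rightarrow> ('w \<Rightarrow> 'a::metric_space measure) \<Rightarrow> 'a measure" where
  "intensity_measure M \<xi> = measure_of UNIV (sets borel) (\<lambda>A. \<integral>\<^sup>+ \<omega>. emeasure (\<xi> \<omega>) A \<partial>M)"

definition superposition :: "nat \<Rightarrow> (nat \<Rightarrow> 'w \<Rightarrow> 'a::metric_space measure) \<Rightarrow> 'w \<Rightarrow> 'a measure" where
  "superposition n \<xi> \<omega> = measure_of UNIV (sets borel) (\<lambda>A. \<Sum>i<n. emeasure (\<xi> i \<omega>) A)"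

text \<open>The image of the counting measure on \<open>I\<close> under \<open>x\<close> is the sum of the unit point masses
  \<open>\<delta>(x i)\<close> over \<open>i \<in> I\<close>, with repeated points counted repeatedly.\<close>

definition dirac_sum :: "nat set \<Rightarrow> (nat \<Rightarrow> 'a::metric_space) \<Rightarrow> 'a measure" where
  "dirac_sum I x = distr (count_space I) borel x"

text \<open>The law of the thinning of a fixed counting measure \<open>\<nu>\<close>: enumerate the points of \<open>\<nu>\<close> and
  keep each of them according to independent Bernoulli variables. The law does not depend on the
  enumeration chosen.\<close>

definition thinning_kernel :: "real \<Rightarrow> 'a::metric_space measure \<Rightarrow> 'a measure measure" where
  "thinning_kernel p \<nu> =
     (case (SOME (I, x). \<nu> = dirac_sum I x) of (I, x) \<Rightarrow>
        distr (Pi\<^sub>M UNIV (\<lambda>_. measure_pmf (bernoulli_pmf p))) counting_algebra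
          (\<lambda>b. dirac_sum {i \<in> I. b i} x))"

text \<open>The distribution of the thinned process: conditionally on \<open>\<xi>\<close>, it is the thinning
  of the counting measure \<open>\<xi>\<close>.\<close>

definition thinning_law ::
    "real \<Rightarrow> 'w measure \<Rightarrow> ('w \<Rightarrow> 'a::metric_space measure) \<Rightarrow> 'a measure measure" where
  "thinning_law p M \<xi> = M \<bind> (\<lambda>\<omega>. thinning_kernel p (\<xi> \<omega>))"

text \<open>The Poisson probabilities are written out because \<open>poisson_pmf\<close> requires a positive
  rate, whereas \<open>\<mu>(A) = 0\<close> is allowed here (then the count is almost surely zero).\<close>

definition poisson_process ::
    "'w measure \<Rightarrow> ('w \<Rightarrow> 'a::metric_space measure) \<Rightarrow> 'a measure \<Rightarrow> bool" where
  "poisson_process M \<eta> \<mu> \<longleftrightarrow> point_process M \<eta> \<and>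
     (\<forall>k (A :: nat \<Rightarrow> 'a set).
        (\<forall>i<k. A i \<in> sets borel \<and> bounded (A i)) \<and> disjoint_family_on A {..<k} \<longrightarrow>
          prob_space.indep_vars M (\<lambda>_. borel) (\<lambda>i \<omega>. emeasure (\<eta> \<omega>) (A i)) {..<k} \<and>
          (\<forall>i<k. \<forall>j::nat. measure M {\<omega> \<in> space M. emeasure (\<eta> \<omega>) (A i) = of_nat j} =
             measure \<mu> (A i) ^ j / fact j * exp (- measure \<mu> (A i))))"

definition weakly_converges ::
    "(nat \<Rightarrow> 'a::metric_space measure measure) \<Rightarrow> 'a measure measure \<Rightarrow> bool" where
  "weakly_converges P Q \<longleftrightarrow>
     (\<forall>F :: 'a measure \<Rightarrow> real.
        continuous_map vague_topology euclideanreal F \<and> bounded (F ` counting_measures) \<longrightarrow>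
          (\<lambda>n. \<integral>\<nu>. F \<nu> \<partial>P n) \<longlonglongrightarrow> (\<integral>\<nu>. F \<nu> \<partial>Q))"

end

theory Submission
  imports Defs
begin

text \<open>Thinning with retention probability \<open>p\<close> turns the Laplace functional at \<open>g\<close> into the one at
  \<open>h = - ln (1 - p (1 - exp (- g)))\<close>. Hence the thinned superposition has the Laplace functional
  \<open>(E exp (- \<integral> h d\<xi>))\<^sup>n\<close> with \<open>p = 1 / n\<close>, where \<open>n h\<close> tends to \<open>1 - exp (- g)\<close>; by dominated convergence
  it tends to \<open>exp (- \<integral> (1 - exp (- g)) d\<mu>)\<close>, the Laplace functional of the Poisson process.

  For weak convergence, let \<open>\<A>\<close> be a countable family of bounded Borel sets built from a base of the space.
  Since a counting measure has only finitely many points in a ball, each vague neighbourhood of it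
  contains one of the sets \<open>{\<nu>. \<nu>(A\<^sub>i) = j\<^sub>i, i \<le> m}\<close>, \<open>A\<^sub>i \<in> \<A>\<close>, that contain it. So a nonnegative continuous \<open>F\<close> is the
  increasing limit of maxima of multiples of indicators of such cylinders. By the Weierstrass theorem these maxima
  are uniform limits of linear combinations of \<open>\<nu> \<mapsto> exp (- \<integral> g d\<nu>)\<close>, so their expectations
  converge, which gives \<open>liminf E F(\<eta>\<^sub>n) \<ge> E F(\<eta>)\<close>; apply this to \<open>K + F\<close> and \<open>K - F\<close>. No tightness is needed.\<close>

section \<open>Bounded test functions and integrals of random measures\<close>

text \<open>The tests are Borel rather than continuous. The Laplace functionals of the thinned
  superpositions converge for all of them, so counts of arbitrary bounded Borel sets are accessible
  and no boundary condition on the cylinders arises. What turns Laplace functionals into events is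
  integrality: \<open>\<nu>(A)\<close> is a natural number, so the event \<open>\<nu>(A) = j\<close>
  is a continuous function of \<open>exp (- \<nu>(A))\<close>.

  An obstacle is the thinning kernel, which picks an enumeration of the points by
  \<open>SOME\<close>, with no regularity in \<open>\<nu>\<close>. Its Laplace functional
  nevertheless depends on \<open>\<nu>\<close> alone, and the events whose indicators are uniform
  limits of combinations of Laplace functionals generate the sigma-algebra; hence the kernel is
  measurable. The same approximation yields uniqueness and independence for the Poisson process,
  which has to be constructed because the theorem asserts that it exists.\<close>

definition bounded_test :: "('a::metric_space \<Rightarrow> real) set" where
  "bounded_test = {g \<in> borel_measurable borel. (\<forall>x. 0 \<le> g x) \<and> bounded (range g) \<and>
     (\<exists>B. bounded B \<and> (\<forall>x. x \<notin> B \<longrightarrow> g x = 0))}"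

abbreviation laplace :: "('a::metric_space \<Rightarrow> real) \<Rightarrow> 'a measure \<Rightarrow> real" where
  "laplace g \<nu> \<equiv> exp (- (\<integral>x. g x \<partial>\<nu>))"

lemma bounded_test_measurable: "g \<in> bounded_test \<Longrightarrow> g \<in> borel_measurable borel"
  and bounded_test_nonneg: "g \<in> bounded_test \<Longrightarrow> 0 \<le> g x"
  by (auto simp: bounded_test_def)

lemma bounded_testE:
  assumes "g \<in> bounded_test"
  obtains C B where "0 \<le> C" "B \<in> sets borel" "bounded B" "\<And>x. g x \<le> C * indicator B x"
    "\<And>x. x \<notin> B \<Longrightarrow> g x = 0"
proof -
  from assms obtain B where B: "bounded B" "\<And>x. x \<notin> B \<Longrightarrow> g x = 0"
    by (auto simp: bounded_test_def)
  from assms have "bounded (range g)" by (simp add: bounded_test_def)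
  then obtain C where C: "\<And>x. \<bar>g x\<bar> \<le> C" by (force simp: bounded_iff)
  have "0 \<le> C" using C order_trans[OF abs_ge_zero] by blast
  \<comment> \<open>The given bounded set need not be Borel; its closure is, and it remains
    bounded.\<close>
  moreover have z: "x \<notin> closure B \<Longrightarrow> g x = 0" for x using B(2) closure_subset by blast
  moreover have "g x \<le> C * indicator (closure B) x" for x
    using C[of x] z[of x] by (auto simp: indicator_def)
  ultimately show ?thesis
    using that[of C "closure B"] B by auto
qed

lemma bounded_testI:
  assumes "g \<in> borel_measurable borel" "\<And>x. 0 \<le> g x" "bounded B" "\<And>x. g x \<le> C * indicator B x"
  shows "g \<in> bounded_test"
proof -
  have "\<bar>g x\<bar> \<le> \<bar>C\<bar>" for x using assms(2,4)[of x] by (cases "x \<in> B") auto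
  then have "bounded (range g)" by (auto simp: bounded_iff)
  moreover have "x \<notin> B \<Longrightarrow> g x = 0" for x using assms(2,4)[of x] by simp
  ultimately show ?thesis using assms by (auto simp: bounded_test_def)
qed

lemma bounded_test_le:
  assumes "g \<in> bounded_test" "h \<in> borel_measurable borel" "\<And>x. 0 \<le> h x" "\<And>x. h x \<le> c * g x" "0 \<le> c"
  shows "h \<in> bounded_test"
proof -
  from bounded_testE[OF assms(1)] obtain C B where *: "bounded B" "\<And>x. g x \<le> C * indicator B x" by metis
  have "h x \<le> (c * C) * indicator B x" for x
    using order_trans[OF assms(4)[of x] mult_left_mono[OF *(2) \<open>0 \<le> c\<close>]] by (simp add: mult.assoc)
  with assms(2,3) *(1) show ?thesis by (intro bounded_testI)
qed

lemma bounded_test_add: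
  assumes "f \<in> bounded_test" "g \<in> bounded_test"
  shows "(\<lambda>x. f x + g x) \<in> bounded_test"
proof -
  from bounded_testE[OF assms(1)] obtain C B where 1: "0 \<le> C" "bounded B" "\<And>x. f x \<le> C * indicator B x" by metis
  from bounded_testE[OF assms(2)] obtain C' B' where 2: "0 \<le> C'" "bounded B'" "\<And>x. g x \<le> C' * indicator B' x" by metis
  have "f x + g x \<le> (C + C') * indicator (B \<union> B') x" for x
    using 1(1) 2(1) 1(3)[of x] 2(3)[of x] by (cases "x \<in> B"; cases "x \<in> B'") auto
  moreover have "(\<lambda>x. f x + g x) \<in> borel_measurable borel"
    using assms by (intro borel_measurable_add bounded_test_measurable)
  ultimately show ?thesis
    using assms 1 2 by (intro bounded_testI[where B="B \<union> B'" and C="C + C'"])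
      (auto simp: bounded_test_nonneg)
qed

lemma indicator_bounded_test: "A \<in> sets borel \<Longrightarrow> bounded A \<Longrightarrow> indicator A \<in> bounded_test"
  by (rule bounded_testI[where C=1 and B=A]) auto

lemma zero_bounded_test: "(\<lambda>_. 0) \<in> bounded_test"
  by (rule bounded_testI[where C=1 and B="{}"]) auto

section \<open>Boundedly finite measures and the sigma-algebra of evaluations\<close>

lemma counting_measures_boundedly_finite: "\<nu> \<in> counting_measures \<Longrightarrow> boundedly_finite \<nu>"
  by (simp add: counting_measures_def)

lemma sets_boundedly_finite [measurable_cong]: "boundedly_finite \<nu> \<Longrightarrow> sets \<nu> = sets borel"
  by (simp add: boundedly_finite_def)

lemma space_boundedly_finite: "boundedly_finite \<nu> \<Longrightarrow> space \<nu> = UNIV"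
  using sets_eq_imp_space_eq[OF sets_boundedly_finite] by simp

lemma sets_counting_measures: "\<nu> \<in> counting_measures \<Longrightarrow> sets \<nu> = sets borel"
  by (rule sets_boundedly_finite[OF counting_measures_boundedly_finite])

lemma space_counting_measures: "\<nu> \<in> counting_measures \<Longrightarrow> space \<nu> = UNIV"
  by (rule space_boundedly_finite[OF counting_measures_boundedly_finite])

lemma integrable_bounded_test:
  assumes "boundedly_finite \<nu>" "g \<in> bounded_test"
  shows "integrable \<nu> g"
proof -
  from bounded_testE[OF assms(2)] obtain C B where *: "0 \<le> C" "B \<in> sets borel" "bounded B"
    "\<And>x. g x \<le> C * indicator B x" by metis
  have g: "g \<in> borel_measurable \<nu>"
    using bounded_test_measurable[OF assms(2)] by (simp add: sets_boundedly_finite[OF assms(1)] cong: measurable_cong_sets)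
  have "integrable \<nu> (indicator B :: _ \<Rightarrow> real)"
    using assms(1) * sets_boundedly_finite[OF assms(1)]
    by (auto simp: boundedly_finite_def)
  then have "integrable \<nu> (\<lambda>x. C * indicator B x)" by simp
  then show ?thesis
    by (rule Bochner_Integration.integrable_bound)
       (use *(1,4) g bounded_test_nonneg[OF assms(2)] in \<open>auto simp: abs_mult\<close>)
qed

lemma space_counting_algebra [simp]: "space counting_algebra = counting_measures"
  unfolding counting_algebra_def by (rule space_measure_of) auto

lemma measurable_emeasure_counting_algebra:
  assumes "A \<in> sets borel"
  shows "(\<lambda>\<nu>. emeasure \<nu> A) \<in> borel_measurable counting_algebra"
proof (rule measurableI)
  fix B :: "ennreal set" assume "B \<in> sets borel"
  then have "{\<nu> \<in> counting_measures. emeasure \<nu> A \<in> B} \<in> sets counting_algebra"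
    unfolding counting_algebra_def using assms by (subst sets_measure_of) (auto intro: sigma_sets.Basic)
  then show "(\<lambda>\<nu>. emeasure \<nu> A) -` B \<inter> space counting_algebra \<in> sets counting_algebra"
    by (simp add: vimage_def Int_def conj_commute)
qed simp

lemma measurable_counting_algebraI:
  fixes X :: "'w \<Rightarrow> 'a::metric_space measure"
  assumes "\<And>\<omega>. \<omega> \<in> space M \<Longrightarrow> X \<omega> \<in> counting_measures"
    and "\<And>A. A \<in> sets borel \<Longrightarrow> (\<lambda>\<omega>. emeasure (X \<omega>) A) \<in> borel_measurable M"
  shows "X \<in> M \<rightarrow>\<^sub>M counting_algebra"
  unfolding counting_algebra_def
proof (rule measurable_measure_of)
  fix y :: "'a measure set" assume "y \<in> {{\<nu> \<in> counting_measures. emeasure \<nu> A \<in> B} | A B. A \<in> sets borel \<and> B \<in> sets borel}"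
  then obtain A B where y: "y = {\<nu> \<in> counting_measures. emeasure \<nu> A \<in> B}"
    and AB: "A \<in> sets borel" "B \<in> sets borel" by auto
  have "X -` y \<inter> space M = (\<lambda>\<omega>. emeasure (X \<omega>) A) -` B \<inter> space M"
    using assms(1) by (auto simp: y)
  then show "X -` y \<inter> space M \<in> sets M" using measurable_sets[OF assms(2)[OF AB(1)] AB(2)] by simp
qed (use assms(1) in auto)

text \<open>Induction over measurable functions. The measures \<open>K \<omega>\<close> may be
  infinite, so they are not points of \<open>subprob_algebra\<close>; measurability of each
  evaluation takes the place of a kernel assumption.\<close>

lemma nn_integral_family_measurable:
  assumes sets: "\<And>\<omega>. \<omega> \<in> space M \<Longrightarrow> sets (K \<omega>) = sets L"
    and em: "\<And>A. A \<in> sets L \<Longrightarrow> (\<lambda>\<omega>. emeasure (K \<omega>) A) \<in> borel_measurable M"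
    and f: "f \<in> borel_measurable L"
  shows "(\<lambda>\<omega>. \<integral>\<^sup>+x. f x \<partial>K \<omega>) \<in> borel_measurable M"
  using f
proof induct
  case (cong f g)
  then have "(\<lambda>\<omega>. \<integral>\<^sup>+x. f x \<partial>K \<omega>) \<in> borel_measurable M \<longleftrightarrow> (\<lambda>\<omega>. \<integral>\<^sup>+x. g x \<partial>K \<omega>) \<in> borel_measurable M"
    by (intro measurable_cong nn_integral_cong) (auto dest!: sets[THEN sets_eq_imp_space_eq])
  with cong show ?case by simp
next
  case (set B)
  then have "(\<lambda>\<omega>. \<integral>\<^sup>+x. indicator B x \<partial>K \<omega>) \<in> borel_measurable M \<longleftrightarrow> (\<lambda>\<omega>. emeasure (K \<omega>) B) \<in> borel_measurable M"
    by (intro measurable_cong nn_integral_indicator) (simp add: sets)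
  with em[OF set] show ?case by simp
next
  case (mult f c)
  then have "(\<lambda>\<omega>. \<integral>\<^sup>+x. c * f x \<partial>K \<omega>) \<in> borel_measurable M \<longleftrightarrow> (\<lambda>\<omega>. c * \<integral>\<^sup>+x. f x \<partial>K \<omega>) \<in> borel_measurable M"
    by (intro measurable_cong nn_integral_cmult) (simp add: sets cong: measurable_cong_sets)
  with mult show ?case by simp
next
  case (add f g)
  then have "(\<lambda>\<omega>. \<integral>\<^sup>+x. g x + f x \<partial>K \<omega>) \<in> borel_measurable M
      \<longleftrightarrow> (\<lambda>\<omega>. (\<integral>\<^sup>+x. g x \<partial>K \<omega>) + (\<integral>\<^sup>+x. f x \<partial>K \<omega>)) \<in> borel_measurable M"
    by (intro measurable_cong nn_integral_add) (simp_all add: sets cong: measurable_cong_sets)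
  with add show ?case by (simp add: ac_simps)
next
  case (seq F)
  then have "(\<lambda>\<omega>. \<integral>\<^sup>+x. (SUP i. F i) x \<partial>K \<omega>) \<in> borel_measurable M
      \<longleftrightarrow> (\<lambda>\<omega>. SUP i. (\<integral>\<^sup>+x. F i x \<partial>K \<omega>)) \<in> borel_measurable M"
    unfolding SUP_apply
    by (intro measurable_cong nn_integral_monotone_convergence_SUP)
       (simp_all add: sets cong: measurable_cong_sets)
  with seq show ?case by (simp add: ac_simps)
qed

text \<open>For a nonnegative function the Bochner integral is \<open>enn2real\<close> of the
  nonnegative one, also when the latter is infinite: then both give 0.\<close>

lemma integral_family_measurable:
  fixes f :: "'a \<Rightarrow> real"
  assumes sets: "\<And>\<omega>. \<omega> \<in> space M \<Longrightarrow> sets (K \<omega>) = sets L"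
    and em: "\<And>A. A \<in> sets L \<Longrightarrow> (\<lambda>\<omega>. emeasure (K \<omega>) A) \<in> borel_measurable M"
    and f: "f \<in> borel_measurable L" "\<And>x. 0 \<le> f x"
  shows "(\<lambda>\<omega>. \<integral>x. f x \<partial>K \<omega>) \<in> borel_measurable M"
proof -
  have "(\<lambda>\<omega>. enn2real (\<integral>\<^sup>+x. ennreal (f x) \<partial>K \<omega>)) \<in> borel_measurable M"
    using nn_integral_family_measurable[OF sets em, of "\<lambda>x. ennreal (f x)"] f by simp
  then show ?thesis
    by (rule measurable_cong[THEN iffD1, rotated])
       (use f in \<open>auto intro!: integral_eq_nn_integral[symmetric] simp: sets cong: measurable_cong_sets\<close>)
qed

lemma measurable_integral_counting_algebra:
  assumes "g \<in> bounded_test"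
  shows "(\<lambda>\<nu>. \<integral>x. g x \<partial>\<nu>) \<in> borel_measurable counting_algebra"
  using assms
  by (intro integral_family_measurable[where L=borel] measurable_emeasure_counting_algebra)
     (auto simp: bounded_test_measurable bounded_test_nonneg sets_counting_measures)

section \<open>Intensity measures, Campbell's formula and superpositions\<close>

text \<open>\<open>measure_of\<close> reproduces the given set function only once that is countably
  additive, which here is the exchange of sum and integral. \<open>M\<close> is an arbitrary
  measure, so finite sums of measures are covered as well.\<close>

lemma
  assumes sets: "\<And>\<omega>. \<omega> \<in> space M \<Longrightarrow> sets (\<xi> \<omega>) = sets borel"
    and em: "\<And>A. A \<in> sets borel \<Longrightarrow> (\<lambda>\<omega>. emeasure (\<xi> \<omega>) A) \<in> borel_measurable M"
  shows sets_intensity_measure: "sets (intensity_measure M \<xi>) = sets borel"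
    and emeasure_intensity_measure:
      "A \<in> sets borel \<Longrightarrow> emeasure (intensity_measure M \<xi>) A = (\<integral>\<^sup>+\<omega>. emeasure (\<xi> \<omega>) A \<partial>M)"
proof -
  show *: "sets (intensity_measure M \<xi>) = sets borel"
    unfolding intensity_measure_def using sets.sigma_sets_eq[of borel] by (simp add: sets_measure_of)
  assume A: "A \<in> sets borel"
  show "emeasure (intensity_measure M \<xi>) A = (\<integral>\<^sup>+\<omega>. emeasure (\<xi> \<omega>) A \<partial>M)"
  proof (rule emeasure_measure_of[OF intensity_measure_def])
    show "countably_additive (sets (intensity_measure M \<xi>)) (\<lambda>A. \<integral>\<^sup>+\<omega>. emeasure (\<xi> \<omega>) A \<partial>M)"
      unfolding countably_additive_def
    proof (intro allI impI)
      fix A :: "nat \<Rightarrow> _" assume "range A \<subseteq> sets (intensity_measure M \<xi>)" and d: "disjoint_family A"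
      then have r: "range A \<subseteq> sets borel" by (simp add: *)
      have "(\<Sum>i. \<integral>\<^sup>+\<omega>. emeasure (\<xi> \<omega>) (A i) \<partial>M) = (\<integral>\<^sup>+\<omega>. (\<Sum>i. emeasure (\<xi> \<omega>) (A i)) \<partial>M)"
        using r by (intro nn_integral_suminf[symmetric] em) auto
      also have "\<dots> = (\<integral>\<^sup>+\<omega>. emeasure (\<xi> \<omega>) (\<Union>i. A i) \<partial>M)"
        using r d by (intro nn_integral_cong suminf_emeasure) (auto simp: sets)
      finally show "(\<Sum>i. \<integral>\<^sup>+\<omega>. emeasure (\<xi> \<omega>) (A i) \<partial>M) = (\<integral>\<^sup>+\<omega>. emeasure (\<xi> \<omega>) (\<Union>i. A i) \<partial>M)" .
    qed
  qed (auto simp: positive_def * A)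
qed

text \<open>Campbell's formula, by induction over measurable functions from the case of
  indicators.\<close>

lemma nn_integral_intensity_measure:
  assumes sets: "\<And>\<omega>. \<omega> \<in> space M \<Longrightarrow> sets (\<xi> \<omega>) = sets borel"
    and em: "\<And>A. A \<in> sets borel \<Longrightarrow> (\<lambda>\<omega>. emeasure (\<xi> \<omega>) A) \<in> borel_measurable M"
    and f: "f \<in> borel_measurable borel"
  shows "(\<integral>\<^sup>+x. f x \<partial>intensity_measure M \<xi>) = (\<integral>\<^sup>+\<omega>. (\<integral>\<^sup>+x. f x \<partial>\<xi> \<omega>) \<partial>M)"
  using f
proof induct
  have S: "sets (intensity_measure M \<xi>) = sets borel"
    by (rule sets_intensity_measure[OF sets em])
  note m = nn_integral_family_measurable[OF sets em]
  have space: "\<omega> \<in> space M \<Longrightarrow> space (\<xi> \<omega>) = UNIV" for \<omega>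
    using sets[THEN sets_eq_imp_space_eq] by simp
  {
    case (cong f g)
    then have "f = g" by auto
    with cong show ?case by simp
  next
    case (set A)
    with sets_intensity_measure[OF sets em] have "A \<in> sets (intensity_measure M \<xi>)" by simp
    then have "(\<integral>\<^sup>+x. indicator A x \<partial>intensity_measure M \<xi>) = (\<integral>\<^sup>+\<omega>. emeasure (\<xi> \<omega>) A \<partial>M)"
      using emeasure_intensity_measure[OF sets em set] by simp
    also have "\<dots> = (\<integral>\<^sup>+\<omega>. (\<integral>\<^sup>+x. indicator A x \<partial>\<xi> \<omega>) \<partial>M)"
      using set by (intro nn_integral_cong) (simp add: sets)
    finally show ?case .
  next
    case (mult f c)
    have "(\<integral>\<^sup>+\<omega>. (\<integral>\<^sup>+x. c * f x \<partial>\<xi> \<omega>) \<partial>M) = (\<integral>\<^sup>+\<omega>. c * (\<integral>\<^sup>+x. f x \<partial>\<xi> \<omega>) \<partial>M)"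
      using mult by (intro nn_integral_cong nn_integral_cmult) (simp add: sets cong: measurable_cong_sets)
    moreover have "(\<integral>\<^sup>+x. c * f x \<partial>intensity_measure M \<xi>) = c * (\<integral>\<^sup>+x. f x \<partial>intensity_measure M \<xi>)"
      using mult by (intro nn_integral_cmult) (simp add: S cong: measurable_cong_sets)
    ultimately show ?case using mult by (simp add: nn_integral_cmult m)
  next
    case (add f g)
    have "(\<integral>\<^sup>+\<omega>. (\<integral>\<^sup>+x. g x + f x \<partial>\<xi> \<omega>) \<partial>M) = (\<integral>\<^sup>+\<omega>. (\<integral>\<^sup>+x. g x \<partial>\<xi> \<omega>) + (\<integral>\<^sup>+x. f x \<partial>\<xi> \<omega>) \<partial>M)"
      using add by (intro nn_integral_cong nn_integral_add) (simp_all add: sets cong: measurable_cong_sets)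
    moreover have "(\<integral>\<^sup>+x. g x + f x \<partial>intensity_measure M \<xi>)
        = (\<integral>\<^sup>+x. g x \<partial>intensity_measure M \<xi>) + (\<integral>\<^sup>+x. f x \<partial>intensity_measure M \<xi>)"
      using add by (intro nn_integral_add) (simp_all add: S cong: measurable_cong_sets)
    ultimately show ?case using add by (simp add: nn_integral_add m)
  next
    case (seq F)
    have "(\<integral>\<^sup>+\<omega>. (\<integral>\<^sup>+x. (SUP i. F i x) \<partial>\<xi> \<omega>) \<partial>M) = (\<integral>\<^sup>+\<omega>. (SUP i. \<integral>\<^sup>+x. F i x \<partial>\<xi> \<omega>) \<partial>M)"
      using seq by (intro nn_integral_cong nn_integral_monotone_convergence_SUP)
        (simp_all add: sets cong: measurable_cong_sets)
    also have "\<dots> = (SUP i. \<integral>\<^sup>+\<omega>. \<integral>\<^sup>+x. F i x \<partial>\<xi> \<omega> \<partial>M)"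
      using seq by (intro nn_integral_monotone_convergence_SUP m)
        (auto simp: incseq_def le_fun_def intro!: nn_integral_mono)
    also have "\<dots> = (SUP i. \<integral>\<^sup>+x. F i x \<partial>intensity_measure M \<xi>)" using seq by simp
    also have "\<dots> = (\<integral>\<^sup>+x. (SUP i. F i x) \<partial>intensity_measure M \<xi>)"
      using seq by (intro nn_integral_monotone_convergence_SUP[symmetric]) (simp_all add: S cong: measurable_cong_sets)
    finally show ?case by (simp add: SUP_apply image_image)
  }
qed

text \<open>A finite sum is an integral over a finite counting space. Countable additivity and the
  integral formula for superpositions are thereby instances of the facts on intensity
  measures.\<close>

lemma superposition_eq_intensity_measure:
  "superposition n \<xi>s \<omega> = intensity_measure (count_space {..<n}) (\<lambda>i. \<xi>s i \<omega>)"
  by (simp add: superposition_def intensity_measure_def nn_integral_count_space_finite)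

lemma emeasure_superposition:
  assumes "\<And>i. i < n \<Longrightarrow> sets (\<xi>s i \<omega>) = sets borel" "A \<in> sets borel"
  shows "emeasure (superposition n \<xi>s \<omega>) A = (\<Sum>i<n. emeasure (\<xi>s i \<omega>) A)"
  unfolding superposition_eq_intensity_measure
  by (subst emeasure_intensity_measure) (auto simp: assms nn_integral_count_space_finite)

lemma sum_in_ennreal_nats:
  assumes "finite I" "\<And>i. i \<in> I \<Longrightarrow> f i \<in> insert \<infinity> (range of_nat)"
  shows "(\<Sum>i\<in>I. f i) \<in> insert (\<infinity>::ennreal) (range of_nat)"
  using assms
proof (induction I)
  case (insert i I)
  then have "(\<Sum>i\<in>I. f i) \<in> insert \<infinity> (range of_nat)" "f i \<in> insert \<infinity> (range of_nat)" by auto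
  with insert(1,2) show ?case by (auto simp flip: of_nat_add)
qed (auto intro: image_eqI[of _ _ 0])

lemma superposition_counting_measures:
  assumes "\<And>i. i < n \<Longrightarrow> \<xi>s i \<omega> \<in> counting_measures"
  shows "superposition n \<xi>s \<omega> \<in> counting_measures"
proof -
  have s: "\<And>i. i < n \<Longrightarrow> sets (\<xi>s i \<omega>) = sets borel" using assms sets_counting_measures by blast
  have "sets (superposition n \<xi>s \<omega>) = sets borel"
    unfolding superposition_eq_intensity_measure using s by (intro sets_intensity_measure) auto
  moreover have "emeasure (superposition n \<xi>s \<omega>) A < \<infinity>" if "A \<in> sets borel" "bounded A" for A
    using that assms by (subst emeasure_superposition)
      (auto simp: s counting_measures_def boundedly_finite_def)
  moreover have "emeasure (superposition n \<xi>s \<omega>) A \<in> insert \<infinity> (range of_nat)" if "A \<in> sets borel" for A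
  proof -
    have "emeasure (superposition n \<xi>s \<omega>) A = (\<Sum>i<n. emeasure (\<xi>s i \<omega>) A)"
      using that by (intro emeasure_superposition s)
    moreover have "(\<Sum>i<n. emeasure (\<xi>s i \<omega>) A) \<in> insert \<infinity> (range of_nat)"
      using that assms by (intro sum_in_ennreal_nats) (auto simp: counting_measures_def)
    ultimately show ?thesis by simp
  qed
  ultimately show ?thesis unfolding counting_measures_def boundedly_finite_def by blast
qed

lemma measurable_superposition:
  assumes "\<And>i. i < n \<Longrightarrow> \<xi>s i \<in> N \<rightarrow>\<^sub>M counting_algebra"
  shows "superposition n \<xi>s \<in> N \<rightarrow>\<^sub>M counting_algebra"
proof -
  have c: "\<And>i \<omega>. i < n \<Longrightarrow> \<omega> \<in> space N \<Longrightarrow> \<xi>s i \<omega> \<in> counting_measures"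
    using measurable_space[OF assms] by simp
  show ?thesis
  proof (rule measurable_counting_algebraI)
    fix A :: "'b set" assume A: "A \<in> sets borel"
    have "(\<lambda>\<omega>. \<Sum>i<n. emeasure (\<xi>s i \<omega>) A) \<in> borel_measurable N"
      using measurable_compose[OF assms measurable_emeasure_counting_algebra[OF A]] by simp
    then show "(\<lambda>\<omega>. emeasure (superposition n \<xi>s \<omega>) A) \<in> borel_measurable N"
      by (rule measurable_cong[THEN iffD1, rotated])
        (use A c in \<open>auto intro!: emeasure_superposition[symmetric] sets_counting_measures\<close>)
  qed (use c in \<open>auto intro: superposition_counting_measures\<close>)
qed

lemma integral_superposition:
  assumes "\<And>i. i < n \<Longrightarrow> \<xi>s i \<omega> \<in> counting_measures" "g \<in> bounded_test"
  shows "(\<integral>x. g x \<partial>superposition n \<xi>s \<omega>) = (\<Sum>i<n. \<integral>x. g x \<partial>\<xi>s i \<omega>)"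
proof -
  have int: "integrable (\<xi>s i \<omega>) g" if "i < n" for i
    using assms that by (intro integrable_bounded_test counting_measures_boundedly_finite)
  have nn: "\<And>x. 0 \<le> g x" using bounded_test_nonneg[OF assms(2)] .
  have "integrable (superposition n \<xi>s \<omega>) g"
    using assms by (intro integrable_bounded_test counting_measures_boundedly_finite superposition_counting_measures)
  then have "ennreal (\<integral>x. g x \<partial>superposition n \<xi>s \<omega>) = (\<integral>\<^sup>+x. ennreal (g x) \<partial>superposition n \<xi>s \<omega>)"
    using nn by (intro nn_integral_eq_integral[symmetric]) auto
  also have "\<dots> = (\<Sum>i<n. \<integral>\<^sup>+x. ennreal (g x) \<partial>\<xi>s i \<omega>)"
    unfolding superposition_eq_intensity_measure
    using assms bounded_test_measurable[OF assms(2)]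
    by (subst nn_integral_intensity_measure) (auto simp: nn_integral_count_space_finite sets_counting_measures)
  also have "\<dots> = (\<Sum>i<n. ennreal (\<integral>x. g x \<partial>\<xi>s i \<omega>))"
    using int nn by (intro sum.cong nn_integral_eq_integral) auto
  also have "\<dots> = ennreal (\<Sum>i<n. \<integral>x. g x \<partial>\<xi>s i \<omega>)"
    using nn by (intro sum_ennreal) auto
  finally show ?thesis using nn by (subst (asm) ennreal_inj) (auto intro!: sum_nonneg)
qed

section \<open>Point configurations and thinning of a fixed configuration\<close>

lemma sets_dirac_sum [simp]: "sets (dirac_sum I x) = sets borel"
  by (simp add: dirac_sum_def)

lemma emeasure_dirac_sum:
  "A \<in> sets borel \<Longrightarrow> emeasure (dirac_sum I x) A = emeasure (count_space I) {i \<in> I. x i \<in> A}"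
  by (auto simp: dirac_sum_def emeasure_distr vimage_def Int_def conj_commute intro!: arg_cong2[where f=emeasure])

text \<open>The values of a sum of point masses are cardinalities, so integrality is automatic and
  only local finiteness remains to be checked.\<close>

lemma dirac_sum_counting_measures_iff:
  "dirac_sum I x \<in> counting_measures \<longleftrightarrow> (\<forall>A\<in>sets borel. bounded A \<longrightarrow> finite {i \<in> I. x i \<in> A})"
  unfolding counting_measures_def boundedly_finite_def
  by (auto simp: emeasure_dirac_sum emeasure_count_space less_top[symmetric])

lemma dirac_sum_counting_measures_subset:
  fixes x :: "nat \<Rightarrow> 'a::metric_space"
  assumes "dirac_sum I x \<in> counting_measures" "J \<subseteq> I"
  shows "dirac_sum J x \<in> counting_measures"
  unfolding dirac_sum_counting_measures_iff
proof (intro ballI impI)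
  fix A :: "'a set" assume A: "A \<in> sets borel" "bounded A"
  have "{i \<in> J. x i \<in> A} \<subseteq> {i \<in> I. x i \<in> A}" using assms(2) by auto
  moreover have "finite {i \<in> I. x i \<in> A}"
    using assms(1) A unfolding dirac_sum_counting_measures_iff by simp
  ultimately show "finite {i \<in> J. x i \<in> A}" by (rule finite_subset)
qed

text \<open>The count in \<open>A\<close> is the sum over all \<open>i\<close> of the indicators of
  the events that \<open>i\<close> is a present index whose point lies in \<open>A\<close>. Thinning
  uses random indices with fixed points, the Poisson construction lets both be random.\<close>

lemma measurable_dirac_sum:
  assumes I: "\<And>i. {\<omega> \<in> space M. i \<in> I \<omega>} \<in> sets M"
    and Y: "\<And>i. (\<lambda>\<omega>. Y \<omega> i) \<in> M \<rightarrow>\<^sub>M borel"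
    and c: "\<And>\<omega>. \<omega> \<in> space M \<Longrightarrow> dirac_sum (I \<omega>) (Y \<omega>) \<in> counting_measures"
  shows "(\<lambda>\<omega>. dirac_sum (I \<omega>) (Y \<omega>)) \<in> M \<rightarrow>\<^sub>M counting_algebra"
proof (rule measurable_counting_algebraI)
  fix A :: "'b set" assume A: "A \<in> sets borel"
  let ?S = "\<lambda>i. {\<omega> \<in> space M. i \<in> I \<omega>} \<inter> ((\<lambda>\<omega>. Y \<omega> i) -` A \<inter> space M)"
  have "emeasure (dirac_sum (I \<omega>) (Y \<omega>)) A = (\<Sum>i. indicator (?S i) \<omega>)" if "\<omega> \<in> space M" for \<omega>
  proof -
    have "emeasure (dirac_sum (I \<omega>) (Y \<omega>)) A = emeasure (count_space UNIV) {i \<in> I \<omega>. Y \<omega> i \<in> A}"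
      by (simp add: emeasure_dirac_sum A emeasure_count_space)
    also have "\<dots> = (\<integral>\<^sup>+i. indicator {i \<in> I \<omega>. Y \<omega> i \<in> A} i \<partial>count_space UNIV)" by simp
    also have "\<dots> = (\<Sum>i. indicator (?S i) \<omega>)"
      unfolding nn_integral_count_space_nat using that by (intro suminf_cong) (simp add: indicator_def)
    finally show ?thesis .
  qed
  moreover have [measurable]: "?S i \<in> sets M" for i
    using I[of i] measurable_sets[OF Y A] by blast
  have "(\<lambda>\<omega>. \<Sum>i. indicator (?S i) \<omega> :: ennreal) \<in> borel_measurable M"
    by measurable
  ultimately show "(\<lambda>\<omega>. emeasure (dirac_sum (I \<omega>) (Y \<omega>)) A) \<in> borel_measurable M"
    by (subst measurable_cong)
qed (rule c)

lemma integral_dirac_sum: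
  assumes "g \<in> borel_measurable borel" "\<And>i. i \<in> I - J \<Longrightarrow> g (x i) = (0::real)" "finite J" "J \<subseteq> I"
  shows "(\<integral>y. g y \<partial>dirac_sum I x) = (\<Sum>i\<in>J. g (x i))"
proof -
  have sub: "{i \<in> I. g (x i) \<noteq> 0} \<subseteq> J" using assms by auto
  have "(\<integral>y. g y \<partial>dirac_sum I x) = (\<integral>i. g (x i) \<partial>count_space I)"
    unfolding dirac_sum_def using assms(1) by (intro integral_distr) auto
  also have "\<dots> = (\<Sum>i | i \<in> I \<and> g (x i) \<noteq> 0. g (x i))"
    by (rule lebesgue_integral_count_space_finite_support[OF finite_subset[OF sub assms(3)]])
  also have "\<dots> = (\<Sum>i\<in>J. g (x i))"
    using assms sub by (intro sum.mono_neutral_left) auto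
  finally show ?thesis .
qed

text \<open>Among the Borel subsets of \<open>A\<close> of positive measure choose one of least measure: it cannot be
  split, so its part outside all its null basic open sets is a single point.\<close>

lemma counting_measure_has_atom:
  fixes \<nu> :: "'a::{metric_space, second_countable_topology} measure"
  assumes \<nu>: "\<nu> \<in> counting_measures" and A: "A \<in> sets borel" "bounded A" "emeasure \<nu> A \<noteq> 0"
  shows "\<exists>x\<in>A. emeasure \<nu> {x} \<noteq> 0"
proof -
  note sets [simp] = sets_counting_measures[OF \<nu>]
  have nat: "\<exists>k::nat. emeasure \<nu> C = of_nat k" if "C \<in> sets borel" "C \<subseteq> A" for C
  proof -
    have "emeasure \<nu> C \<noteq> \<infinity>"
      using \<nu> that bounded_subset[OF A(2)] by (auto simp: counting_measures_def boundedly_finite_def)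
    with \<nu> that show ?thesis by (auto simp: counting_measures_def)
  qed
  define P where "P k \<longleftrightarrow> k \<noteq> 0 \<and> (\<exists>C\<in>sets borel. C \<subseteq> A \<and> emeasure \<nu> C = of_nat k)" for k :: nat
  have "\<exists>k. P k" using nat[OF A(1)] A unfolding P_def by fastforce
  then have least: "P (LEAST k. P k)" by (rule LeastI_ex)
  define m where "m = (LEAST k. P k)"
  from least obtain C where C: "C \<in> sets borel" "C \<subseteq> A" "emeasure \<nu> C = of_nat m" and m: "m \<noteq> 0"
    by (auto simp: P_def m_def)
  have dich: "emeasure \<nu> D \<noteq> 0 \<Longrightarrow> of_nat m \<le> emeasure \<nu> D" if D: "D \<in> sets borel" "D \<subseteq> C" for D
  proof -
    assume nz: "emeasure \<nu> D \<noteq> 0"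
    from nat[of D] D C obtain k where k: "emeasure \<nu> D = of_nat k" by blast
    with nz D C have "P k" by (auto simp: P_def)
    then have "m \<le> k" unfolding m_def by (rule Least_le)
    then show ?thesis by (simp add: k)
  qed
  obtain \<D> :: "'a set set" where \<D>: "countable \<D>" "topological_basis \<D>"
    using ex_countable_basis by blast
  have op: "D \<in> \<D> \<Longrightarrow> open D" for D using \<D>(2) topological_basis_open by blast
  define U where "U = (\<Union>D\<in>{D \<in> \<D>. emeasure \<nu> (C \<inter> D) = 0}. C \<inter> D)"
  have Dm: "C \<inter> D \<in> sets borel" if "D \<in> \<D>" for D using op[OF that] C by auto
  have Um: "U \<in> sets borel" unfolding U_def using Dm \<D>(1) by (intro sets.countable_UN') auto
  have "(\<Union>D\<in>{D \<in> \<D>. emeasure \<nu> (C \<inter> D) = 0}. C \<inter> D) \<in> null_sets \<nu>"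
    by (rule null_sets_UN') (use \<D>(1) Dm in auto)
  then have U0: "U \<in> null_sets \<nu>" by (simp add: U_def)
  have CU: "emeasure \<nu> (C - U) = of_nat m"
    using C(3) emeasure_Diff_null_set[OF U0] C(1) by simp
  have "C - U \<noteq> {}" using CU m by (metis emeasure_empty of_nat_eq_0_iff)
  then obtain x where x: "x \<in> C - U" by blast
  have "y = x" if y: "y \<in> C - U" for y
  proof (rule ccontr)
    assume "y \<noteq> x"
    from hausdorff[OF this] obtain V W where VW: "open V" "open W" "y \<in> V" "x \<in> W" "V \<inter> W = {}" by blast
    obtain D where D: "D \<in> \<D>" "y \<in> D" "D \<subseteq> V" using topological_basisE[OF \<D>(2) VW(1,3)] by blast
    obtain E where E: "E \<in> \<D>" "x \<in> E" "E \<subseteq> W" using topological_basisE[OF \<D>(2) VW(2,4)] by blast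
    have "emeasure \<nu> (C \<inter> D) \<noteq> 0" "emeasure \<nu> (C \<inter> E) \<noteq> 0"
      using x y D E unfolding U_def by blast+
    then have "of_nat m + of_nat m \<le> emeasure \<nu> (C \<inter> D) + emeasure \<nu> (C \<inter> E)"
      using dich[OF Dm[OF D(1)]] dich[OF Dm[OF E(1)]] by (intro add_mono) auto
    also have "\<dots> = emeasure \<nu> ((C \<inter> D) \<union> (C \<inter> E))"
      using Dm[OF D(1)] Dm[OF E(1)] D E VW by (intro plus_emeasure) auto
    also have "\<dots> \<le> emeasure \<nu> C" using C by (intro emeasure_mono) auto
    finally have "of_nat (m + m) \<le> (of_nat m :: ennreal)" by (simp add: C(3))
    then have "m + m \<le> m" by (simp only: of_nat_le_iff)
    with m show False by simp
  qed
  with x have "C - U = {x}" by blast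
  with CU m have "emeasure \<nu> {x} \<noteq> 0" by simp
  then show ?thesis using x C by blast
qed

text \<open>Each atom has mass at least 1, so a ball contains finitely many and the set
  \<open>S\<close> of atoms is countable. Off \<open>S\<close> the measure vanishes on every ball,
  by \<open>counting_measure_has_atom\<close>. The pairs \<open>(x, j)\<close> with
  \<open>j < w x\<close> list each atom as often as its multiplicity; numbering them gives the index
  set and the points.\<close>

lemma counting_measure_eq_dirac_sum:
  fixes \<nu> :: "'a::{metric_space, second_countable_topology} measure"
  assumes \<nu>: "\<nu> \<in> counting_measures"
  shows "\<exists>I x. \<nu> = dirac_sum I x"
proof -
  note sets [simp] = sets_counting_measures[OF \<nu>]
  obtain x0 :: 'a where True by blast
  define S where "S = {x. emeasure \<nu> {x} \<noteq> 0}"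
  have fin_bd: "emeasure \<nu> B \<noteq> \<infinity>" if "B \<in> sets borel" "bounded B" for B
    using \<nu> that by (auto simp: counting_measures_def boundedly_finite_def)
  have nat: "\<exists>k::nat. emeasure \<nu> B = of_nat k" if "B \<in> sets borel" "bounded B" for B
    using \<nu> fin_bd[OF that] that by (auto simp: counting_measures_def)
  define w where "w x = (SOME k::nat. emeasure \<nu> {x} = of_nat k)" for x
  have w: "emeasure \<nu> {x} = of_nat (w x)" for x
    unfolding w_def by (rule someI_ex) (rule nat, auto)
  have fin: "finite (S \<inter> cball x0 r)" for r
  proof -
    obtain k where k: "emeasure \<nu> (cball x0 r) = of_nat k" using nat[of "cball x0 r"] by auto
    have "card F \<le> k" if F: "F \<subseteq> S \<inter> cball x0 r" "finite F" for F
    proof -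
      have "of_nat (card F) = (\<Sum>x\<in>F. 1::ennreal)" by simp
      also have "\<dots> \<le> (\<Sum>x\<in>F. emeasure \<nu> {x})"
      proof (rule sum_mono)
        fix x assume "x \<in> F"
        then have "w x \<noteq> 0" using F w[of x] by (auto simp: S_def)
        then show "1 \<le> emeasure \<nu> {x}" unfolding w
          by (metis One_nat_def Suc_leI neq0_conv of_nat_1 of_nat_mono)
      qed
      also have "\<dots> = emeasure \<nu> F" using F by (intro emeasure_eq_sum_singleton[symmetric]) auto
      also have "\<dots> \<le> emeasure \<nu> (cball x0 r)" using F by (intro emeasure_mono) auto
      finally show ?thesis unfolding k by (simp only: of_nat_le_iff)
    qed
    then show ?thesis using finite_if_finite_subsets_card_bdd by blast
  qed
  have cover: "(\<Union>k::nat. cball x0 (real k)) = UNIV"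
    using real_arch_simple by (auto simp: mem_cball)
  have "countable (\<Union>k::nat. S \<inter> cball x0 (real k))"
    using fin by (intro countable_UN) (auto intro: countable_finite)
  then have cS: "countable S" using cover by (simp flip: Int_UN_distrib)
  have "emeasure \<nu> ((UNIV - S) \<inter> cball x0 (real k)) = 0" for k
  proof (rule ccontr)
    assume nz: "emeasure \<nu> ((UNIV - S) \<inter> cball x0 (real k)) \<noteq> 0"
    have "UNIV - S \<in> sets borel" using sets.countable[OF _ cS, of borel] by auto
    with counting_measure_has_atom[OF \<nu> _ _ nz] show False by (auto simp: S_def bounded_Int)
  qed
  then have "(UNIV - S) \<inter> cball x0 (real k) \<in> null_sets \<nu>" for k :: nat
    using sets.countable[OF _ cS, of borel] by (auto intro!: null_setsI)
  then have "(\<Union>k::nat. (UNIV - S) \<inter> cball x0 (real k)) \<in> null_sets \<nu>" by (rule null_sets_UN)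
  then have null: "UNIV - S \<in> null_sets \<nu>" using cover by (simp only: Int_UN_distrib[symmetric]) simp
  define T where "T = {(x, j). j < w x}"
  have TS: "T \<subseteq> S \<times> UNIV" using w by (force simp: T_def S_def)
  then have cT: "countable T" using countable_subset[OF TS] cS by (simp add: countable_SIGMA)
  define I where "I = to_nat_on T ` T"
  define p where "p i = fst (from_nat_into T i)" for i
  have "\<nu> = dirac_sum I p"
  proof (rule measure_eqI)
    fix A assume "A \<in> sets \<nu>"
    then have A: "A \<in> sets borel" by simp
    have AS: "A \<inter> S \<in> sets borel" using A sets.countable[OF _ cS, of borel] by auto
    have eq: "{i \<in> I. p i \<in> A} = to_nat_on T ` {t \<in> T. fst t \<in> A}"
      using cT by (auto simp: I_def p_def)
    have inj: "inj_on (to_nat_on T) {t \<in> T. fst t \<in> A}"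
      using inj_on_to_nat_on[OF cT] by (rule inj_on_subset) auto
    have "emeasure (dirac_sum I p) A = emeasure (count_space UNIV) {i \<in> I. p i \<in> A}"
      by (simp add: emeasure_dirac_sum A emeasure_count_space)
    also have "\<dots> = emeasure (count_space UNIV) {t \<in> T. fst t \<in> A}"
      unfolding eq by (simp add: emeasure_count_space card_image[OF inj] finite_image_iff[OF inj])
    also have "\<dots> = (\<integral>\<^sup>+t. indicator {t \<in> T. fst t \<in> A} t \<partial>count_space UNIV)" by simp
    \<comment> \<open>Summing first over the copies \<open>j\<close> of a point turns the
      cardinality into the sum of the masses of the atoms in \<open>A\<close>.\<close>
    also have "\<dots> = (\<integral>\<^sup>+x. \<integral>\<^sup>+j. indicator {t \<in> T. fst t \<in> A} (x, j) \<partial>count_space UNIV \<partial>count_space UNIV)"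
      by (rule nn_integral_fst_count_space[symmetric])
    also have "\<dots> = (\<integral>\<^sup>+x. emeasure \<nu> {x} * indicator (A \<inter> S) x \<partial>count_space UNIV)"
    proof (intro nn_integral_cong)
      fix x
      have "(\<integral>\<^sup>+j. indicator {t \<in> T. fst t \<in> A} (x, j) \<partial>count_space UNIV)
        = (\<integral>\<^sup>+j. indicator (if x \<in> A then {..<w x} else {}) j \<partial>count_space UNIV)"
        by (intro nn_integral_cong) (auto simp: T_def indicator_def)
      also have "\<dots> = of_nat (w x) * indicator A x"
        by (subst nn_integral_indicator) (auto simp: emeasure_count_space)
      also have "\<dots> = emeasure \<nu> {x} * indicator (A \<inter> S) x"
        using w[of x] by (auto simp: indicator_def S_def)
      finally show "(\<integral>\<^sup>+j. indicator {t \<in> T. fst t \<in> A} (x, j) \<partial>count_space UNIV)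
        = emeasure \<nu> {x} * indicator (A \<inter> S) x" .
    qed
    also have "\<dots> = (\<integral>\<^sup>+x. emeasure \<nu> {x} \<partial>count_space (A \<inter> S))"
      by (subst nn_integral_count_space_indicator) auto
    also have "\<dots> = emeasure \<nu> (A \<inter> S)"
      using cS by (intro emeasure_countable_singleton[symmetric]) auto
    also have "A \<inter> S = A - (UNIV - S)" by auto
    also have "emeasure \<nu> (A - (UNIV - S)) = emeasure \<nu> A" using null A by (intro emeasure_Diff_null_set) auto
    finally show "emeasure \<nu> A = emeasure (dirac_sum I p) A" by simp
  qed simp
  then show ?thesis by blast
qed

section \<open>Laplace functional of a thinned configuration\<close>

text \<open>Only the coordinates in \<open>J\<close> occur, so the integral can be taken under the
  marginal on the finite product, where Fubini's theorem applies.\<close>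

lemma integral_PiM_prod:
  fixes f :: "'i \<Rightarrow> 'b \<Rightarrow> real"
  assumes M: "\<And>i. prob_space (M i)" and J: "finite J" and f: "\<And>i. i \<in> J \<Longrightarrow> integrable (M i) (f i)"
  shows "(\<integral>\<omega>. (\<Prod>i\<in>J. f i (\<omega> i)) \<partial>Pi\<^sub>M UNIV M) = (\<Prod>i\<in>J. \<integral>y. f i y \<partial>M i)"
proof -
  interpret product_prob_space M UNIV
    using M by (intro product_prob_space.intro product_sigma_finite.intro product_prob_space_axioms.intro
      prob_space_imp_sigma_finite)
  have "(\<Prod>i\<in>J. \<integral>y. f i y \<partial>M i) = (\<integral>\<omega>. (\<Prod>i\<in>J. f i (\<omega> i)) \<partial>Pi\<^sub>M J M)"
    by (rule product_integral_prod[OF J f, symmetric])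
  also have "\<dots> = (\<integral>\<omega>. (\<Prod>i\<in>J. f i (\<omega> i)) \<partial>distr (Pi\<^sub>M UNIV M) (Pi\<^sub>M J M) (\<lambda>\<omega>. restrict \<omega> J))"
    by (subst distr_PiM_restrict_finite[OF J]) auto
  also have "\<dots> = (\<integral>\<omega>. (\<Prod>i\<in>J. f i (restrict \<omega> J i)) \<partial>Pi\<^sub>M UNIV M)"
  proof (rule integral_distr)
    show "(\<lambda>\<omega>. \<Prod>i\<in>J. f i (\<omega> i)) \<in> borel_measurable (Pi\<^sub>M J M)"
      using f by (intro borel_measurable_prod measurable_PiM_component_rev) auto
  qed (rule measurable_restrict_subset, simp)
  finally show ?thesis by simp
qed

text \<open>\<open>1 - p * (1 - exp (- g x))\<close> is the convex combination of \<open>1\<close>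
  and \<open>exp (- g x)\<close> with weights \<open>1 - p\<close> and \<open>p\<close>. It is
  therefore positive even for \<open>p = 1\<close>, and minus its logarithm lies between 0 and
  \<open>g x\<close>.\<close>

lemma bounded_test_thinned:
  assumes "g \<in> bounded_test" "0 \<le> p" "p \<le> 1"
  shows "(\<lambda>x. - ln (1 - p * (1 - exp (- g x)))) \<in> bounded_test"
    and "exp (ln (1 - p * (1 - exp (- g x)))) = 1 - p * (1 - exp (- g x))"
proof -
  have pos: "exp (- g x) \<le> 1 - p * (1 - exp (- g x))" for x
  proof -
    have "p * (1 - exp (- g x)) \<le> 1 - exp (- g x)"
      using assms bounded_test_nonneg[OF assms(1), of x] by (intro mult_left_le_one_le) auto
    then show ?thesis by simp
  qed
  then have pos': "0 < 1 - p * (1 - exp (- g x))" for x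
    by (meson exp_gt_zero order_less_le_trans)
  then show "exp (ln (1 - p * (1 - exp (- g x)))) = 1 - p * (1 - exp (- g x))" by simp
  have [measurable]: "g \<in> borel_measurable borel" using assms by (simp add: bounded_test_measurable)
  show "(\<lambda>x. - ln (1 - p * (1 - exp (- g x)))) \<in> bounded_test"
  proof (rule bounded_test_le[OF assms(1), where c=1])
    show "- ln (1 - p * (1 - exp (- g x))) \<le> 1 * g x" for x
      using ln_le_cancel_iff[of "exp (- g x)", THEN iffD2, OF _ pos' pos] by simp
    show "0 \<le> - ln (1 - p * (1 - exp (- g x)))" for x
      using pos'[of x] assms bounded_test_nonneg[OF assms(1), of x] by (simp add: ln_le_zero_iff)
  qed auto
qed

lemma measurable_thinned_dirac_sum:
  assumes "dirac_sum I x \<in> counting_measures"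
  shows "(\<lambda>b. dirac_sum {i \<in> I. b i} x)
    \<in> Pi\<^sub>M UNIV (\<lambda>_. measure_pmf (bernoulli_pmf p)) \<rightarrow>\<^sub>M counting_algebra"
proof (rule measurable_dirac_sum)
  fix i :: nat
  let ?P = "Pi\<^sub>M UNIV (\<lambda>_::nat. measure_pmf (bernoulli_pmf p))"
  have "(\<lambda>b. b i) \<in> ?P \<rightarrow>\<^sub>M measure_pmf (bernoulli_pmf p)"
    by (rule measurable_component_singleton) simp
  from measurable_sets[OF this, of "{True}"] have "{b \<in> space ?P. b i} \<in> sets ?P"
    by (simp add: vimage_def Int_def conj_commute)
  then show "{b \<in> space ?P. i \<in> {i \<in> I. b i}} \<in> sets ?P"
    by (cases "i \<in> I") auto
qed (auto intro: dirac_sum_counting_measures_subset[OF assms])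

text \<open>Only the finitely many points in the bounded support of \<open>g\<close> matter. Their
  marks are independent, so the expectation factors, and a Bernoulli mark with parameter
  \<open>p\<close> at \<open>y\<close> contributes \<open>1 - p * (1 - exp (- g y))\<close>.\<close>

lemma integral_thinned_dirac_sum:
  assumes \<nu>: "dirac_sum I x \<in> counting_measures" and g: "g \<in> bounded_test" and p: "0 \<le> p" "p \<le> 1"
  shows "(\<integral>b. exp (- (\<integral>y. g y \<partial>dirac_sum {i \<in> I. b i} x)) \<partial>Pi\<^sub>M UNIV (\<lambda>_. measure_pmf (bernoulli_pmf p)))
    = exp (- (\<integral>y. - ln (1 - p * (1 - exp (- g y))) \<partial>dirac_sum I x))"
proof -
  obtain C B where "0 \<le> C" and B: "B \<in> sets borel" "bounded B" and "\<And>x. g x \<le> C * indicator B x"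
    and B0: "\<And>x. x \<notin> B \<Longrightarrow> g x = 0"
    by (rule bounded_testE[OF g]) (rule that)
  define J where "J = {i \<in> I. x i \<in> B}"
  have J: "finite J" "J \<subseteq> I" using \<nu> B by (auto simp: J_def dirac_sum_counting_measures_iff)
  have gm: "g \<in> borel_measurable borel" using g by (rule bounded_test_measurable)
  have 1: "(\<integral>y. g y \<partial>dirac_sum {i \<in> I. b i} x) = (\<Sum>i\<in>J. if b i then g (x i) else 0)" for b
  proof -
    have "(\<integral>y. g y \<partial>dirac_sum {i \<in> I. b i} x) = (\<Sum>i\<in>{i \<in> J. b i}. g (x i))"
      using J B B0 by (intro integral_dirac_sum gm) (auto simp: J_def intro: finite_subset[OF _ J(1)])
    then show ?thesis using J by (simp add: sum.inter_filter)
  qed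
  have 2: "exp (- (\<Sum>i\<in>J. if b i then g (x i) else 0)) = (\<Prod>i\<in>J. if b i then exp (- g (x i)) else 1)" for b
    using J(1) by (subst sum_negf[symmetric], subst exp_sum) (auto intro!: prod.cong)
  have "(\<integral>b. exp (- (\<integral>y. g y \<partial>dirac_sum {i \<in> I. b i} x)) \<partial>Pi\<^sub>M UNIV (\<lambda>_. measure_pmf (bernoulli_pmf p)))
    = (\<integral>b. (\<Prod>i\<in>J. if b i then exp (- g (x i)) else 1) \<partial>Pi\<^sub>M UNIV (\<lambda>_. measure_pmf (bernoulli_pmf p)))"
    unfolding 1 2 ..
  also have "\<dots> = (\<Prod>i\<in>J. \<integral>c. (if c then exp (- g (x i)) else 1) \<partial>measure_pmf (bernoulli_pmf p))"
    by (rule integral_PiM_prod[OF _ J(1)]) (auto intro: measure_pmf.prob_space_axioms integrable_measure_pmf_finite)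
  also have "\<dots> = (\<Prod>i\<in>J. 1 - p * (1 - exp (- g (x i))))"
    using p by (intro prod.cong) (auto simp: algebra_simps)
  also have "\<dots> = exp (- (\<Sum>i\<in>J. - ln (1 - p * (1 - exp (- g (x i))))))"
    using bounded_test_thinned(2)[OF g p] J(1) by (simp add: exp_sum sum_negf)
  also have "\<dots> = exp (- (\<integral>y. - ln (1 - p * (1 - exp (- g y))) \<partial>dirac_sum I x))"
    using J B B0 bounded_test_measurable[OF bounded_test_thinned(1)[OF g p]]
    by (subst integral_dirac_sum[where J=J]) (auto simp: J_def)
  finally show ?thesis .
qed

text \<open>Some enumeration exists, so the one selected by \<open>SOME\<close> really enumerates
  \<open>\<nu>\<close>; nothing else about the choice is used later.\<close>

lemma thinning_kernelE:
  fixes \<nu> :: "'a::{metric_space, second_countable_topology} measure"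
  assumes \<nu>: "\<nu> \<in> counting_measures"
  obtains I x where "\<nu> = dirac_sum I x"
    "thinning_kernel p \<nu> = distr (Pi\<^sub>M UNIV (\<lambda>_. measure_pmf (bernoulli_pmf p))) counting_algebra
          (\<lambda>b. dirac_sum {i \<in> I. b i} x)"
proof -
  obtain I x where Ix: "(SOME (I, x). \<nu> = dirac_sum I x) = (I, x)" by (cases "SOME (I, x). \<nu> = dirac_sum I x")
  have "\<exists>q. case q of (I, x) \<Rightarrow> \<nu> = dirac_sum I x" using counting_measure_eq_dirac_sum[OF \<nu>] by auto
  from someI_ex[OF this] have "\<nu> = dirac_sum I x" unfolding Ix by simp
  then show ?thesis by (rule that) (simp only: thinning_kernel_def Ix prod.case)
qed

text \<open>The right-hand side of the Laplace formula mentions \<open>\<nu>\<close> but no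
  enumeration, which makes the arbitrary choice in the kernel harmless.\<close>

lemma
  fixes \<nu> :: "'a::{metric_space, second_countable_topology} measure"
  assumes \<nu>: "\<nu> \<in> counting_measures"
  shows sets_thinning_kernel: "sets (thinning_kernel p \<nu>) = sets counting_algebra"
    and prob_space_thinning_kernel: "prob_space (thinning_kernel p \<nu>)"
    and integral_thinning_kernel: "g \<in> bounded_test \<Longrightarrow> 0 \<le> p \<Longrightarrow> p \<le> 1 \<Longrightarrow>
      (\<integral>\<nu>'. laplace g \<nu>' \<partial>thinning_kernel p \<nu>) = exp (- (\<integral>y. - ln (1 - p * (1 - exp (- g y))) \<partial>\<nu>))"
proof -
  obtain I x where Ix: "\<nu> = dirac_sum I x"
    "thinning_kernel p \<nu> = distr (Pi\<^sub>M UNIV (\<lambda>_. measure_pmf (bernoulli_pmf p))) counting_algebra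
          (\<lambda>b. dirac_sum {i \<in> I. b i} x)"
    by (rule thinning_kernelE[OF \<nu>]) (rule that)
  note m = measurable_thinned_dirac_sum[OF \<nu>[unfolded Ix(1)], of p]
  interpret P: prob_space "Pi\<^sub>M UNIV (\<lambda>_::nat. measure_pmf (bernoulli_pmf p))"
    by (intro prob_space_PiM measure_pmf.prob_space_axioms)
  show "sets (thinning_kernel p \<nu>) = sets counting_algebra" by (simp add: Ix(2))
  show "prob_space (thinning_kernel p \<nu>)" unfolding Ix(2) by (rule P.prob_space_distr[OF m])
  assume g: "g \<in> bounded_test" and p: "0 \<le> p" "p \<le> 1"
  have "(\<lambda>\<nu>'. - (\<integral>y. g y \<partial>\<nu>')) \<in> borel_measurable counting_algebra"
    by (rule borel_measurable_uminus[OF measurable_integral_counting_algebra[OF g]])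
  then have "(\<lambda>\<nu>'. laplace g \<nu>') \<in> borel_measurable counting_algebra"
    by (rule measurable_compose) (rule borel_measurable_exp)
  from integral_distr[OF m this] integral_thinned_dirac_sum[OF \<nu>[unfolded Ix(1)] g p]
  show "(\<integral>\<nu>'. laplace g \<nu>' \<partial>thinning_kernel p \<nu>) = exp (- (\<integral>y. - ln (1 - p * (1 - exp (- g y))) \<partial>\<nu>))"
    unfolding Ix(2) by (simp only: Ix(1))
qed

section \<open>Functions approximable by Laplace functionals\<close>

text \<open>Sums of tests correspond to products of Laplace functionals and the zero test to the
  constant 1. These closure properties make the linear span an algebra containing the
  constants.\<close>

definition test_cone :: "('a::metric_space \<Rightarrow> real) set \<Rightarrow> bool" where
  "test_cone G \<longleftrightarrow> G \<subseteq> bounded_test \<and> (\<lambda>_. 0) \<in> G \<and> (\<forall>f\<in>G. \<forall>g\<in>G. (\<lambda>x. f x + g x) \<in> G)"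

text \<open>The cone \<open>G\<close> is a parameter: all bounded tests serve for convergence, the tests supported in a set for
  independence, and the multiples of one indicator for the law of a single count.\<close>

inductive laplace_span :: "('a::metric_space \<Rightarrow> real) set \<Rightarrow> ('a measure \<Rightarrow> real) \<Rightarrow> bool" for G where
  laplace_span_base: "g \<in> G \<Longrightarrow> laplace_span G (\<lambda>\<nu>. laplace g \<nu>)"
| laplace_span_scale: "laplace_span G S \<Longrightarrow> laplace_span G (\<lambda>\<nu>. c * S \<nu>)"
| laplace_span_add: "laplace_span G S \<Longrightarrow> laplace_span G T \<Longrightarrow> laplace_span G (\<lambda>\<nu>. S \<nu> + T \<nu>)"

text \<open>Approximation is asked for on \<open>counting_measures\<close> only: there the tests are
  integrable, and the identities between Laplace functionals hold.\<close>

definition laplace_closure :: "('a::metric_space \<Rightarrow> real) set \<Rightarrow> ('a measure \<Rightarrow> real) \<Rightarrow> bool" where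
  "laplace_closure G \<Phi> \<longleftrightarrow> (\<forall>e>0. \<exists>S. laplace_span G S \<and> (\<forall>\<nu>\<in>counting_measures. \<bar>\<Phi> \<nu> - S \<nu>\<bar> < e))"

lemma test_cone_bounded_test: "test_cone bounded_test"
  by (auto simp: test_cone_def zero_bounded_test bounded_test_add)

lemma test_cone_subset: "test_cone G \<Longrightarrow> g \<in> G \<Longrightarrow> g \<in> bounded_test"
  by (auto simp: test_cone_def)

lemma laplace_integral_bounds:
  assumes "g \<in> bounded_test"
  shows "0 \<le> laplace g \<nu>" "laplace g \<nu> \<le> 1"
  using bounded_test_nonneg[OF assms] by (auto intro: integral_nonneg)

lemma laplace_span_bounded:
  assumes "test_cone G" "laplace_span G S"
  shows "\<exists>K. \<forall>\<nu>. \<bar>S \<nu>\<bar> \<le> K"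
  using assms(2)
proof induction
  case (laplace_span_base g)
  with laplace_integral_bounds[of g] test_cone_subset[OF assms(1)] show ?case
    by (intro exI[of _ 1]) auto
next
  case (laplace_span_scale S c)
  then obtain K where "\<And>\<nu>. \<bar>S \<nu>\<bar> \<le> K" by blast
  then show ?case by (intro exI[of _ "\<bar>c\<bar> * K"]) (auto simp: abs_mult intro: mult_left_mono)
next
  case (laplace_span_add S T)
  then obtain K L where "\<And>\<nu>. \<bar>S \<nu>\<bar> \<le> K" "\<And>\<nu>. \<bar>T \<nu>\<bar> \<le> L" by blast
  then show ?case by (intro exI[of _ "K + L"]) (metis abs_triangle_ineq add_mono order_trans)
qed

lemma laplace_measurable:
  assumes "g \<in> bounded_test"
  shows "(\<lambda>\<nu>. laplace g \<nu>) \<in> borel_measurable counting_algebra"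
  by (rule measurable_compose[OF borel_measurable_uminus[OF measurable_integral_counting_algebra[OF assms]]
    borel_measurable_exp])

lemma laplace_span_measurable:
  assumes "test_cone G" "laplace_span G S"
  shows "S \<in> borel_measurable counting_algebra"
  using assms(2)
proof induction
  case (laplace_span_base g)
  then show ?case by (rule laplace_measurable[OF test_cone_subset[OF assms(1)]])
qed auto

lemma exp_integral_add:
  assumes "\<nu> \<in> counting_measures" "f \<in> bounded_test" "g \<in> bounded_test"
  shows "exp (- (\<integral>x. f x + g x \<partial>\<nu>)) = laplace f \<nu> * laplace g \<nu>"
proof -
  have "(\<integral>x. f x + g x \<partial>\<nu>) = (\<integral>x. f x \<partial>\<nu>) + (\<integral>x. g x \<partial>\<nu>)"
    using assms by (intro Bochner_Integration.integral_add integrable_bounded_test counting_measures_boundedly_finite)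
  then show ?thesis by (simp add: exp_diff exp_minus divide_inverse)
qed

text \<open>The product of the functionals at \<open>g\<close> and \<open>f\<close> is the
  functional at \<open>g + f\<close>, but additivity of the integral needs integrability. Hence the
  product is matched on \<open>counting_measures\<close> by some member \<open>T\<close> of the span
  instead of being one itself.\<close>

lemma laplace_span_mult_base:
  assumes "test_cone G" "g \<in> G" "laplace_span G S"
  shows "\<exists>T. laplace_span G T \<and> (\<forall>\<nu>\<in>counting_measures. T \<nu> = laplace g \<nu> * S \<nu>)"
  using assms(3)
proof induction
  case (laplace_span_base f)
  with assms have "(\<lambda>x. g x + f x) \<in> G" by (auto simp: test_cone_def)
  from laplace_span.laplace_span_base[OF this] show ?case
    using exp_integral_add test_cone_subset[OF assms(1)] assms(2) laplace_span_base by blast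
next
  case (laplace_span_scale S c)
  then obtain T where "laplace_span G T" "\<forall>\<nu>\<in>counting_measures. T \<nu> = laplace g \<nu> * S \<nu>" by blast
  then show ?case by (intro exI[of _ "\<lambda>\<nu>. c * T \<nu>"]) (auto intro: laplace_span.laplace_span_scale)
next
  case (laplace_span_add S S')
  then obtain T T' where "laplace_span G T" "\<forall>\<nu>\<in>counting_measures. T \<nu> = laplace g \<nu> * S \<nu>"
     "laplace_span G T'" "\<forall>\<nu>\<in>counting_measures. T' \<nu> = laplace g \<nu> * S' \<nu>" by blast
  then show ?case
    by (intro exI[of _ "\<lambda>\<nu>. T \<nu> + T' \<nu>"]) (auto intro: laplace_span.laplace_span_add simp: algebra_simps)
qed

lemma laplace_span_mult:
  assumes "test_cone G" "laplace_span G R" "laplace_span G S"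
  shows "\<exists>T. laplace_span G T \<and> (\<forall>\<nu>\<in>counting_measures. T \<nu> = R \<nu> * S \<nu>)"
  using assms(2)
proof induction
  case (laplace_span_base f)
  then show ?case using laplace_span_mult_base[OF assms(1) _ assms(3)] by blast
next
  case (laplace_span_scale R c)
  then obtain T where "laplace_span G T" "\<forall>\<nu>\<in>counting_measures. T \<nu> = R \<nu> * S \<nu>" by blast
  then show ?case by (intro exI[of _ "\<lambda>\<nu>. c * T \<nu>"]) (auto intro: laplace_span.laplace_span_scale)
next
  case (laplace_span_add R R')
  then obtain T T' where "laplace_span G T" "\<forall>\<nu>\<in>counting_measures. T \<nu> = R \<nu> * S \<nu>"
     "laplace_span G T'" "\<forall>\<nu>\<in>counting_measures. T' \<nu> = R' \<nu> * S \<nu>" by blast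
  then show ?case
    by (intro exI[of _ "\<lambda>\<nu>. T \<nu> + T' \<nu>"]) (auto intro: laplace_span.laplace_span_add simp: algebra_simps)
qed

lemma laplace_closureD:
  assumes "laplace_closure G \<Phi>" "0 < e"
  obtains S where "laplace_span G S" "\<And>\<nu>. \<nu> \<in> counting_measures \<Longrightarrow> \<bar>\<Phi> \<nu> - S \<nu>\<bar> < e"
  using assms unfolding laplace_closure_def by blast

lemma laplace_closure_span: "laplace_span G S \<Longrightarrow> laplace_closure G S"
  unfolding laplace_closure_def by force

lemma laplace_closure_uniform_limit:
  assumes "\<And>e. 0 < e \<Longrightarrow> \<exists>\<Psi>. laplace_closure G \<Psi> \<and> (\<forall>\<nu>\<in>counting_measures. \<bar>\<Phi> \<nu> - \<Psi> \<nu>\<bar> < e)"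
  shows "laplace_closure G \<Phi>"
  unfolding laplace_closure_def
proof (intro allI impI)
  fix e :: real assume "0 < e"
  then have e: "0 < e / 2" by simp
  from assms[OF this] obtain \<Psi> where \<Psi>: "laplace_closure G \<Psi>" "\<forall>\<nu>\<in>counting_measures. \<bar>\<Phi> \<nu> - \<Psi> \<nu>\<bar> < e / 2" by blast
  from laplace_closureD[OF \<Psi>(1) e] obtain S where S: "laplace_span G S"
    "\<And>\<nu>. \<nu> \<in> counting_measures \<Longrightarrow> \<bar>\<Psi> \<nu> - S \<nu>\<bar> < e / 2" by blast
  have "\<bar>\<Phi> \<nu> - S \<nu>\<bar> < e" if "\<nu> \<in> counting_measures" for \<nu>
    using S(2)[OF that] bspec[OF \<Psi>(2) that] by (simp add: abs_if split: if_splits)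
  with S(1) show "\<exists>S. laplace_span G S \<and> (\<forall>\<nu>\<in>counting_measures. \<bar>\<Phi> \<nu> - S \<nu>\<bar> < e)" by blast
qed

lemma laplace_closure_cong:
  assumes "laplace_closure G \<Phi>" "\<And>\<nu>. \<nu> \<in> counting_measures \<Longrightarrow> \<Psi> \<nu> = \<Phi> \<nu>"
  shows "laplace_closure G \<Psi>"
  using assms by (intro laplace_closure_uniform_limit exI[of _ \<Phi>]) auto

lemma laplace_closure_bounded:
  assumes "test_cone G" "laplace_closure G \<Phi>"
  shows "\<exists>K>0. \<forall>\<nu>\<in>counting_measures. \<bar>\<Phi> \<nu>\<bar> \<le> K"
proof -
  obtain S where S: "laplace_span G S" "\<And>\<nu>. \<nu> \<in> counting_measures \<Longrightarrow> \<bar>\<Phi> \<nu> - S \<nu>\<bar> < 1"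
    using laplace_closureD[OF assms(2), of 1] by auto
  obtain K where K: "\<And>\<nu>. \<bar>S \<nu>\<bar> \<le> K" using laplace_span_bounded[OF assms(1) S(1)] by blast
  have "\<bar>\<Phi> \<nu>\<bar> \<le> K + 1" if "\<nu> \<in> counting_measures" for \<nu> using S(2)[OF that] K[of \<nu>] by linarith
  moreover have "0 < K + 1" using K[of undefined] by linarith
  ultimately show ?thesis by blast
qed

lemma laplace_closure_scale:
  assumes "laplace_closure G \<Phi>"
  shows "laplace_closure G (\<lambda>\<nu>. c * \<Phi> \<nu>)"
proof (rule laplace_closure_uniform_limit)
  fix e :: real assume e: "0 < e"
  then have "0 < e / (\<bar>c\<bar> + 1)" by simp
  from laplace_closureD[OF assms this] obtain S where S: "laplace_span G S"
    "\<And>\<nu>. \<nu> \<in> counting_measures \<Longrightarrow> \<bar>\<Phi> \<nu> - S \<nu>\<bar> < e / (\<bar>c\<bar> + 1)" by blast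
  have "\<bar>c * \<Phi> \<nu> - c * S \<nu>\<bar> < e" if "\<nu> \<in> counting_measures" for \<nu>
  proof -
    have "\<bar>c * \<Phi> \<nu> - c * S \<nu>\<bar> = \<bar>c\<bar> * \<bar>\<Phi> \<nu> - S \<nu>\<bar>" by (simp add: abs_mult[symmetric] right_diff_distrib)
    also have "\<dots> \<le> \<bar>c\<bar> * (e / (\<bar>c\<bar> + 1))" using S(2)[OF that] by (intro mult_left_mono) auto
    also have "\<dots> < e" using e by (simp add: field_simps)
    finally show ?thesis .
  qed
  with S(1) show "\<exists>\<Psi>. laplace_closure G \<Psi> \<and> (\<forall>\<nu>\<in>counting_measures. \<bar>c * \<Phi> \<nu> - \<Psi> \<nu>\<bar> < e)"
    by (intro exI[of _ "\<lambda>\<nu>. c * S \<nu>"]) (auto intro!: laplace_closure_span laplace_span_scale)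
qed

lemma laplace_closure_add:
  assumes "laplace_closure G \<Phi>" "laplace_closure G \<Psi>"
  shows "laplace_closure G (\<lambda>\<nu>. \<Phi> \<nu> + \<Psi> \<nu>)"
proof (rule laplace_closure_uniform_limit)
  fix e :: real assume "0 < e"
  then have e: "0 < e / 2" by simp
  from laplace_closureD[OF assms(1) e] obtain S where S: "laplace_span G S"
    "\<And>\<nu>. \<nu> \<in> counting_measures \<Longrightarrow> \<bar>\<Phi> \<nu> - S \<nu>\<bar> < e / 2" by blast
  from laplace_closureD[OF assms(2) e] obtain T where T: "laplace_span G T"
    "\<And>\<nu>. \<nu> \<in> counting_measures \<Longrightarrow> \<bar>\<Psi> \<nu> - T \<nu>\<bar> < e / 2" by blast
  have "\<bar>\<Phi> \<nu> + \<Psi> \<nu> - (S \<nu> + T \<nu>)\<bar> < e" if "\<nu> \<in> counting_measures" for \<nu>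
    using S(2)[OF that] T(2)[OF that] by (auto simp: abs_if split: if_splits)
  with S(1) T(1) show "\<exists>X. laplace_closure G X \<and> (\<forall>\<nu>\<in>counting_measures. \<bar>\<Phi> \<nu> + \<Psi> \<nu> - X \<nu>\<bar> < e)"
    by (intro exI[of _ "\<lambda>\<nu>. S \<nu> + T \<nu>"]) (auto intro!: laplace_closure_span laplace_span_add)
qed

lemma laplace_closure_mult:
  assumes G: "test_cone G" and \<Phi>: "laplace_closure G \<Phi>" and \<Psi>: "laplace_closure G \<Psi>"
  shows "laplace_closure G (\<lambda>\<nu>. \<Phi> \<nu> * \<Psi> \<nu>)"
proof (rule laplace_closure_uniform_limit)
  fix e :: real assume e: "0 < e"
  obtain K where K: "0 < K" "\<And>\<nu>. \<nu> \<in> counting_measures \<Longrightarrow> \<bar>\<Phi> \<nu>\<bar> \<le> K"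
    using laplace_closure_bounded[OF G \<Phi>] by blast
  from e K have "0 < e / (2 * K)" by simp
  from laplace_closureD[OF \<Psi> this] obtain T where T: "laplace_span G T"
    "\<And>\<nu>. \<nu> \<in> counting_measures \<Longrightarrow> \<bar>\<Psi> \<nu> - T \<nu>\<bar> < e / (2 * K)" by blast
  obtain L0 where L0: "\<And>\<nu>. \<bar>T \<nu>\<bar> \<le> L0" using laplace_span_bounded[OF G T(1)] by blast
  define L where "L = \<bar>L0\<bar> + 1"
  have L: "0 < L" by (simp add: L_def)
  have LT: "\<bar>T \<nu>\<bar> \<le> L" for \<nu> using L0[of \<nu>] by (simp add: L_def)
  \<comment> \<open>The tolerance for \<open>\<Phi>\<close> is measured against a bound of the
    approximant \<open>T\<close>, so \<open>S\<close> has to be chosen after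
    \<open>T\<close>.\<close>
  from e L have "0 < e / (2 * L)" by simp
  from laplace_closureD[OF \<Phi> this] obtain S where S: "laplace_span G S"
    "\<And>\<nu>. \<nu> \<in> counting_measures \<Longrightarrow> \<bar>\<Phi> \<nu> - S \<nu>\<bar> < e / (2 * L)" by blast
  obtain R where R: "laplace_span G R" "\<And>\<nu>. \<nu> \<in> counting_measures \<Longrightarrow> R \<nu> = S \<nu> * T \<nu>"
    using laplace_span_mult[OF G S(1) T(1)] by blast
  have "\<bar>\<Phi> \<nu> * \<Psi> \<nu> - R \<nu>\<bar> < e" if \<nu>: "\<nu> \<in> counting_measures" for \<nu>
  proof -
    have "\<Phi> \<nu> * \<Psi> \<nu> - R \<nu> = \<Phi> \<nu> * (\<Psi> \<nu> - T \<nu>) + (\<Phi> \<nu> - S \<nu>) * T \<nu>"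
      by (simp add: R(2)[OF \<nu>] algebra_simps)
    then have "\<bar>\<Phi> \<nu> * \<Psi> \<nu> - R \<nu>\<bar> \<le> \<bar>\<Phi> \<nu>\<bar> * \<bar>\<Psi> \<nu> - T \<nu>\<bar> + \<bar>\<Phi> \<nu> - S \<nu>\<bar> * \<bar>T \<nu>\<bar>"
      by (metis abs_mult abs_triangle_ineq)
    also have "\<dots> \<le> K * \<bar>\<Psi> \<nu> - T \<nu>\<bar> + \<bar>\<Phi> \<nu> - S \<nu>\<bar> * L"
      using K(2)[OF \<nu>] LT by (intro add_mono mult_right_mono mult_left_mono) auto
    also have "\<dots> < K * (e / (2 * K)) + e / (2 * L) * L"
      using S(2)[OF \<nu>] T(2)[OF \<nu>] K(1) L
      by (intro add_strict_mono mult_strict_left_mono mult_strict_right_mono) auto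
    also have "\<dots> = e" using K(1) L by simp
    finally show ?thesis .
  qed
  with R(1) show "\<exists>X. laplace_closure G X \<and> (\<forall>\<nu>\<in>counting_measures. \<bar>\<Phi> \<nu> * \<Psi> \<nu> - X \<nu>\<bar> < e)"
    by (intro exI[of _ R]) (auto intro: laplace_closure_span)
qed

lemma laplace_closure_const:
  assumes "test_cone G"
  shows "laplace_closure G (\<lambda>_. c)"
proof -
  have "laplace_span G (\<lambda>\<nu>. c * exp (- (\<integral>x. 0 \<partial>\<nu>)))"
    using assms by (intro laplace_span_scale laplace_span_base) (simp add: test_cone_def)
  then show ?thesis using laplace_closure_span by simp
qed

lemma laplace_closure_polynomial:
  assumes "test_cone G" "laplace_closure G \<Phi>" "real_polynomial_function (f :: real \<Rightarrow> real)"
  shows "laplace_closure G (\<lambda>\<nu>. f (\<Phi> \<nu>))"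
  using assms(3)
proof induction
  case (linear f)
  then obtain c where "f = (\<lambda>x. x * c)" by (rule real_bounded_linear[THEN iffD1, THEN exE])
  then show ?case using laplace_closure_scale[OF assms(2), of c] by (simp add: mult.commute)
qed (auto intro: laplace_closure_const laplace_closure_add laplace_closure_mult assms(1))

lemma laplace_closure_continuous:
  assumes G: "test_cone G" and \<Phi>: "laplace_closure G \<Phi>" and f: "continuous_on UNIV (f :: real \<Rightarrow> real)"
  shows "laplace_closure G (\<lambda>\<nu>. f (\<Phi> \<nu>))"
proof (rule laplace_closure_uniform_limit)
  fix e :: real assume e: "0 < e"
  obtain K where K: "\<And>\<nu>. \<nu> \<in> counting_measures \<Longrightarrow> \<bar>\<Phi> \<nu>\<bar> \<le> K"
    using laplace_closure_bounded[OF G \<Phi>] by blast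
  have "continuous_on {-K..K} f" using f by (rule continuous_on_subset) simp
  then obtain p where p: "real_polynomial_function p" "\<And>x. x \<in> {-K..K} \<Longrightarrow> \<bar>f x - p x\<bar> < e"
    using Stone_Weierstrass_real_polynomial_function[OF compact_Icc _ e] by metis
  have "\<Phi> \<nu> \<in> {-K..K}" if "\<nu> \<in> counting_measures" for \<nu> using K[OF that] by (auto simp: abs_le_iff)
  then show "\<exists>X. laplace_closure G X \<and> (\<forall>\<nu>\<in>counting_measures. \<bar>f (\<Phi> \<nu>) - X \<nu>\<bar> < e)"
    using p laplace_closure_polynomial[OF G \<Phi> p(1)] by (intro exI[of _ "\<lambda>\<nu>. p (\<Phi> \<nu>)"]) blast
qed

lemma laplace_closure_max:
  assumes G: "test_cone G" and \<Phi>: "laplace_closure G \<Phi>" and \<Psi>: "laplace_closure G \<Psi>"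
  shows "laplace_closure G (\<lambda>\<nu>. max (\<Phi> \<nu>) (\<Psi> \<nu>))"
proof -
  have "laplace_closure G (\<lambda>\<nu>. \<Phi> \<nu> + (-1) * \<Psi> \<nu>)"
    by (intro laplace_closure_add laplace_closure_scale \<Phi> \<Psi>)
  from laplace_closure_continuous[OF G this, of abs]
  have "laplace_closure G (\<lambda>\<nu>. \<bar>\<Phi> \<nu> + (-1) * \<Psi> \<nu>\<bar>)" by (simp add: continuous_on_rabs)
  then have "laplace_closure G (\<lambda>\<nu>. (1/2) * (\<Phi> \<nu> + \<Psi> \<nu> + \<bar>\<Phi> \<nu> + (-1) * \<Psi> \<nu>\<bar>))"
    by (intro laplace_closure_scale laplace_closure_add \<Phi> \<Psi>)
  then show ?thesis by (rule laplace_closure_cong) (auto simp: max_def abs_if)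
qed

section \<open>Counts of bounded sets as limits of Laplace functionals\<close>

lemma counting_measure_natE:
  assumes "\<nu> \<in> counting_measures" "A \<in> sets borel" "bounded A"
  obtains k :: nat where "emeasure \<nu> A = of_nat k" "measure \<nu> A = real k"
proof -
  have "emeasure \<nu> A \<noteq> \<infinity>" using assms by (auto simp: counting_measures_def boundedly_finite_def)
  with assms obtain k where k: "emeasure \<nu> A = of_nat k" by (auto simp: counting_measures_def)
  then have "measure \<nu> A = real k" by (simp add: measure_def)
  with k that show ?thesis by blast
qed

text \<open>The values \<open>exp (- real k)\<close> are isolated from each other, so the indicator
  of one of them extends to a continuous function of the Laplace functional at
  \<open>indicator A\<close>. That indicator is all that the cone has to contain.\<close>

lemma laplace_closure_count_eq:
  fixes A :: "'a::metric_space set"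
  assumes G: "test_cone G" and A: "A \<in> sets borel" "bounded A" "indicator A \<in> G"
  shows "laplace_closure G (\<lambda>\<nu>. of_bool (measure \<nu> A = real j))"
proof -
  \<comment> \<open>A tent of height 1 at \<open>exp (- j)\<close> with slope
    \<open>exp (j + 1)\<close>. It vanishes at all other \<open>exp (- k)\<close>: the nearest one
    is at distance \<open>exp (- j - 1) * (exp 1 - 1)\<close>, which is at least
    \<open>exp (- j - 1)\<close> because \<open>exp 1 \<ge> 2\<close>.\<close>
  define f :: "real \<Rightarrow> real" where "f y = max 0 (1 - exp (real j + 1) * \<bar>y - exp (- real j)\<bar>)" for y
  have "laplace_closure G (\<lambda>\<nu>. f (exp (- (\<integral>x. indicator A x \<partial>\<nu>))))"
    unfolding f_def
    by (intro laplace_closure_continuous[OF G laplace_closure_span[OF laplace_span_base[OF A(3)]]] continuous_intros)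
  then show ?thesis
  proof (rule laplace_closure_cong)
    fix \<nu> :: "'a measure" assume \<nu>: "\<nu> \<in> counting_measures"
    obtain k :: nat where k: "measure \<nu> A = real k" using counting_measure_natE[OF \<nu> A(1,2)] by blast
    have "(\<integral>x. indicator A x \<partial>\<nu>) = real k"
      using k by (simp add: space_counting_measures[OF \<nu>])
    moreover have "f (exp (- real k)) = of_bool (k = j)"
    proof (cases "k = j")
      case False
      have "(exp 1 :: real) \<ge> 2" using exp_ge_add_one_self[of 1] by simp
      have "1 \<le> exp (real j + 1) * \<bar>exp (- real k) - exp (- real j)\<bar>"
      proof (cases "k < j")
        case True
        then have "exp 1 \<le> exp (real j - real k)" by simp
        with \<open>exp 1 \<ge> 2\<close> have "1 \<le> exp (real j - real k) - 1" by linarith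
        then have "exp 1 * 1 \<le> exp 1 * (exp (real j - real k) - 1)"
          by (intro mult_left_mono) auto
        also have "\<dots> = exp (real j + 1) * (exp (- real k) - exp (- real j))"
          by (simp add: right_diff_distrib exp_add[symmetric] algebra_simps)
        also have "exp (- real k) - exp (- real j) = \<bar>exp (- real k) - exp (- real j)\<bar>" using True by simp
        finally show ?thesis using \<open>exp 1 \<ge> 2\<close> by simp
      next
        case False
        with \<open>k \<noteq> j\<close> have kj: "real j + 1 - real k \<le> 0" by linarith
        then have "exp (real j + 1 - real k) \<le> 1" by simp
        then have "1 \<le> exp 1 - exp (real j + 1 - real k)" using \<open>exp 1 \<ge> 2\<close> by linarith
        also have "\<dots> = exp (real j + 1) * (exp (- real j) - exp (- real k))"
          by (simp add: right_diff_distrib exp_add[symmetric] algebra_simps)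
        also have "exp (- real j) - exp (- real k) = \<bar>exp (- real k) - exp (- real j)\<bar>" using kj by simp
        finally show ?thesis .
      qed
      then show ?thesis using False by (simp add: f_def)
    qed (simp add: f_def)
    ultimately show "of_bool (measure \<nu> A = real j) = f (exp (- (\<integral>x. indicator A x \<partial>\<nu>)))"
      by (simp add: k)
  qed
qed

text \<open>Turns uniform approximation into sequences with a common bound, as dominated convergence
  requires.\<close>

lemma laplace_closure_sequence:
  assumes G: "test_cone G" and \<Phi>: "laplace_closure G \<Phi>"
  obtains S K where "\<And>r::nat. laplace_span G (S r)" "\<And>r \<nu>. \<nu> \<in> counting_measures \<Longrightarrow> \<bar>S r \<nu>\<bar> \<le> K"
    "\<And>\<nu>. \<nu> \<in> counting_measures \<Longrightarrow> (\<lambda>r. S r \<nu>) \<longlonglongrightarrow> \<Phi> \<nu>"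
proof -
  have "\<exists>S. laplace_span G S \<and> (\<forall>\<nu>\<in>counting_measures. \<bar>\<Phi> \<nu> - S \<nu>\<bar> < 1 / real (Suc r))" for r
    using \<Phi> unfolding laplace_closure_def by auto
  then obtain S where S: "\<And>r. laplace_span G (S r)"
    "\<And>r \<nu>. \<nu> \<in> counting_measures \<Longrightarrow> \<bar>\<Phi> \<nu> - S r \<nu>\<bar> < 1 / real (Suc r)" by metis
  obtain K where K: "\<And>\<nu>. \<nu> \<in> counting_measures \<Longrightarrow> \<bar>\<Phi> \<nu>\<bar> \<le> K"
    using laplace_closure_bounded[OF G \<Phi>] by blast
  have "\<bar>S r \<nu>\<bar> \<le> K + 1" if "\<nu> \<in> counting_measures" for r \<nu>
  proof -
    have "1 / real (Suc r) \<le> 1" by simp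
    then show ?thesis using S(2)[OF that, of r] K[OF that] by linarith
  qed
  moreover have "(\<lambda>r. S r \<nu>) \<longlonglongrightarrow> \<Phi> \<nu>" if "\<nu> \<in> counting_measures" for \<nu>
  proof -
    have "(\<lambda>r. S r \<nu> - \<Phi> \<nu>) \<longlonglongrightarrow> 0"
      using S(2)[OF that] by (intro Lim_null_comparison[OF always_eventually LIMSEQ_Suc[OF lim_1_over_n]])
        (auto simp: abs_minus_commute less_imp_le)
    then show ?thesis by (rule LIM_zero_cancel)
  qed
  ultimately show ?thesis using S(1) that[of S "K + 1"] by blast
qed

lemma laplace_closure_measurable:
  assumes "test_cone G" "laplace_closure G \<Phi>"
  shows "\<Phi> \<in> borel_measurable counting_algebra"
proof -
  obtain S K where S: "\<And>r::nat. laplace_span G (S r)" "\<And>\<nu>. \<nu> \<in> counting_measures \<Longrightarrow> (\<lambda>r. S r \<nu>) \<longlonglongrightarrow> \<Phi> \<nu>"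
    using laplace_closure_sequence[OF assms] by metis
  show ?thesis
    by (rule borel_measurable_LIMSEQ_metric[where f=S])
      (use S laplace_span_measurable[OF assms(1)] in auto)
qed

section \<open>Convergence, uniqueness and independence from Laplace functionals\<close>

locale counting_law = prob_space P for P :: "'a::metric_space measure measure" +
  assumes sets_P: "sets P = sets counting_algebra"
begin

lemma space_P: "space P = counting_measures"
  using sets_eq_imp_space_eq[OF sets_P] by simp

lemma integrable_bounded:
  assumes "\<Phi> \<in> borel_measurable counting_algebra" "\<And>\<nu>. \<nu> \<in> counting_measures \<Longrightarrow> \<bar>\<Phi> \<nu>\<bar> \<le> K"
  shows "integrable P (\<Phi> :: _ \<Rightarrow> real)"
  using assms by (intro integrable_const_bound[where B=K]) (auto simp: sets_P space_P cong: measurable_cong_sets)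

lemma integrable_laplace_closure:
  assumes "test_cone G" "laplace_closure G \<Phi>"
  shows "integrable P \<Phi>"
proof -
  obtain K where "\<And>\<nu>. \<nu> \<in> counting_measures \<Longrightarrow> \<bar>\<Phi> \<nu>\<bar> \<le> K"
    using laplace_closure_bounded[OF assms] by blast
  with laplace_closure_measurable[OF assms] show ?thesis by (rule integrable_bounded)
qed

lemma integral_tendsto_bounded:
  assumes "\<And>r. S r \<in> borel_measurable counting_algebra" "\<Phi> \<in> borel_measurable counting_algebra"
    and "\<And>r \<nu>. \<nu> \<in> counting_measures \<Longrightarrow> \<bar>S r \<nu>\<bar> \<le> K"
    and "\<And>\<nu>. \<nu> \<in> counting_measures \<Longrightarrow> (\<lambda>r. S r \<nu>) \<longlonglongrightarrow> (\<Phi> \<nu> :: real)"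
  shows "(\<lambda>r. \<integral>\<nu>. S r \<nu> \<partial>P) \<longlonglongrightarrow> (\<integral>\<nu>. \<Phi> \<nu> \<partial>P)"
proof (rule integral_dominated_convergence[where w="\<lambda>_. K"])
  show "\<Phi> \<in> borel_measurable P" "\<And>i. S i \<in> borel_measurable P"
    using assms by (auto simp: sets_P cong: measurable_cong_sets)
qed (use assms in \<open>auto simp: space_P\<close>)

end

text \<open>The approximation is uniform and all the laws are probabilities, so replacing
  \<open>\<Phi>\<close> by a member of the span changes every integral by at most the same amount,
  whatever \<open>n\<close>. On the span, convergence follows from the generators by
  linearity.\<close>

lemma laplace_closure_convergence:
  assumes P: "\<And>n. counting_law (P n)" and Q: "counting_law Q" and G: "test_cone G"
    and conv: "\<And>g. g \<in> G \<Longrightarrow>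
      (\<lambda>n. \<integral>\<nu>. laplace g \<nu> \<partial>P n) \<longlonglongrightarrow> (\<integral>\<nu>. laplace g \<nu> \<partial>Q)"
    and \<Phi>: "laplace_closure G \<Phi>"
  shows "(\<lambda>n. \<integral>\<nu>. \<Phi> \<nu> \<partial>P n) \<longlonglongrightarrow> (\<integral>\<nu>. \<Phi> \<nu> \<partial>Q)"
proof -
  note int = counting_law.integrable_laplace_closure[OF _ G laplace_closure_span]
  have span: "(\<lambda>n. \<integral>\<nu>. S \<nu> \<partial>P n) \<longlonglongrightarrow> (\<integral>\<nu>. S \<nu> \<partial>Q)" if "laplace_span G S" for S
    using that
  proof induction
    case (laplace_span_base g)
    then show ?case by (rule conv)
  next
    case (laplace_span_scale S c)
    then show ?case by (auto intro: tendsto_intros)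
  next
    case (laplace_span_add S T)
    then show ?case
      by (simp add: Bochner_Integration.integral_add[OF int[OF P] int[OF P]]
          Bochner_Integration.integral_add[OF int[OF Q] int[OF Q]] tendsto_add)
  qed
  have close: "\<bar>(\<integral>\<nu>. \<Phi> \<nu> \<partial>R) - (\<integral>\<nu>. S \<nu> \<partial>R)\<bar> \<le> e"
    if R: "counting_law R" and S: "laplace_span G S" "\<And>\<nu>. \<nu> \<in> counting_measures \<Longrightarrow> \<bar>\<Phi> \<nu> - S \<nu>\<bar> < e" for R S e
  proof -
    interpret R: counting_law R by fact
    have i: "integrable R \<Phi>" "integrable R S"
      using R.integrable_laplace_closure[OF G] \<Phi> laplace_closure_span[OF S(1)] by auto
    then have "\<bar>(\<integral>\<nu>. \<Phi> \<nu> \<partial>R) - (\<integral>\<nu>. S \<nu> \<partial>R)\<bar> = \<bar>\<integral>\<nu>. \<Phi> \<nu> - S \<nu> \<partial>R\<bar>" by simp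
    also have "\<dots> \<le> (\<integral>\<nu>. \<bar>\<Phi> \<nu> - S \<nu>\<bar> \<partial>R)" by (rule integral_abs_bound)
    also have "\<dots> \<le> (\<integral>\<nu>. e \<partial>R)"
      using i S(2) by (intro integral_mono) (auto simp: R.space_P intro: less_imp_le)
    also have "\<dots> = e" by (simp add: R.prob_space)
    finally show ?thesis .
  qed
  show ?thesis
  proof (rule LIMSEQ_I)
    fix e :: real assume "0 < e"
    then have e: "0 < e / 4" by simp
    obtain S where S: "laplace_span G S" "\<And>\<nu>. \<nu> \<in> counting_measures \<Longrightarrow> \<bar>\<Phi> \<nu> - S \<nu>\<bar> < e / 4"
      using laplace_closureD[OF \<Phi> e] by blast
    obtain n0 where n0: "\<And>n. n0 \<le> n \<Longrightarrow> \<bar>(\<integral>\<nu>. S \<nu> \<partial>P n) - (\<integral>\<nu>. S \<nu> \<partial>Q)\<bar> < e / 4"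
      using LIMSEQ_D[OF span[OF S(1)] e] by auto
    have "\<bar>(\<integral>\<nu>. \<Phi> \<nu> \<partial>P n) - (\<integral>\<nu>. \<Phi> \<nu> \<partial>Q)\<bar> < e" if "n0 \<le> n" for n
      using n0[OF that] close[OF P[of n] S] close[OF Q S] \<open>0 < e\<close> by linarith
    then show "\<exists>no. \<forall>n\<ge>no. norm ((\<integral>\<nu>. \<Phi> \<nu> \<partial>P n) - (\<integral>\<nu>. \<Phi> \<nu> \<partial>Q)) < e" by auto
  qed
qed

text \<open>Convergence along the constant sequence \<open>P\<close> with limit law
  \<open>Q\<close>.\<close>

lemma laplace_closure_unique:
  assumes "counting_law P" "counting_law Q" "test_cone G"
    and "\<And>g. g \<in> G \<Longrightarrow> (\<integral>\<nu>. laplace g \<nu> \<partial>P) = (\<integral>\<nu>. laplace g \<nu> \<partial>Q)"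
    and "laplace_closure G \<Phi>"
  shows "(\<integral>\<nu>. \<Phi> \<nu> \<partial>P) = (\<integral>\<nu>. \<Phi> \<nu> \<partial>Q)"
  using laplace_closure_convergence[of "\<lambda>_. P" Q G \<Phi>] assms by (simp add: LIMSEQ_const_iff)

text \<open>Factorization extends from the generators to the spans by bilinearity, one factor at a
  time, and then to the closures along bounded pointwise convergent sequences. Two cones are used so
  that the factors can be supported on disjoint sets.\<close>

lemma laplace_closure_independent:
  assumes Q: "counting_law Q" and G: "test_cone G" and H: "test_cone H"
    and fact: "\<And>g h. g \<in> G \<Longrightarrow> h \<in> H \<Longrightarrow>
      (\<integral>\<nu>. laplace g \<nu> * laplace h \<nu> \<partial>Q)
      = (\<integral>\<nu>. laplace g \<nu> \<partial>Q) * (\<integral>\<nu>. laplace h \<nu> \<partial>Q)"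
    and \<Phi>: "laplace_closure G \<Phi>" and \<Psi>: "laplace_closure H \<Psi>"
  shows "(\<integral>\<nu>. \<Phi> \<nu> * \<Psi> \<nu> \<partial>Q) = (\<integral>\<nu>. \<Phi> \<nu> \<partial>Q) * (\<integral>\<nu>. \<Psi> \<nu> \<partial>Q)"
proof -
  interpret Q: counting_law Q by fact
  have int2: "integrable Q (\<lambda>\<nu>. S \<nu> * T \<nu>)" if ST: "laplace_span G S" "laplace_span H T" for S T
  proof -
    obtain K L where KL: "\<And>\<nu>. \<bar>S \<nu>\<bar> \<le> K" "\<And>\<nu>. \<bar>T \<nu>\<bar> \<le> L"
      using laplace_span_bounded[OF G ST(1)] laplace_span_bounded[OF H ST(2)] by blast
    show ?thesis
    proof (rule Q.integrable_bounded[where K="K * L"])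
      show "(\<lambda>\<nu>. S \<nu> * T \<nu>) \<in> borel_measurable counting_algebra"
        using laplace_span_measurable[OF G ST(1)] laplace_span_measurable[OF H ST(2)] by (rule borel_measurable_times)
      show "\<bar>S \<nu> * T \<nu>\<bar> \<le> K * L" for \<nu>
        unfolding abs_mult using KL order_trans[OF abs_ge_zero KL(1)] by (intro mult_mono) auto
    qed
  qed
  have int1: "integrable Q S" if "laplace_span G S" for S
    using that by (intro Q.integrable_laplace_closure[OF G] laplace_closure_span)
  have int1': "integrable Q S" if "laplace_span H S" for S
    using that by (intro Q.integrable_laplace_closure[OF H] laplace_closure_span)
  have base: "(\<integral>\<nu>. laplace g \<nu> * T \<nu> \<partial>Q) = (\<integral>\<nu>. laplace g \<nu> \<partial>Q) * (\<integral>\<nu>. T \<nu> \<partial>Q)"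
    if g: "g \<in> G" and T: "laplace_span H T" for g T
    using T
  proof induction
    case (laplace_span_base h)
    then show ?case by (rule fact[OF g])
  next
    case (laplace_span_scale T c)
    have "(\<integral>\<nu>. laplace g \<nu> * (c * T \<nu>) \<partial>Q) = (\<integral>\<nu>. c * (laplace g \<nu> * T \<nu>) \<partial>Q)"
      by (simp add: mult_ac)
    then show ?case using laplace_span_scale by simp
  next
    case (laplace_span_add T T')
    then show ?case
      using int2[OF laplace_span.laplace_span_base[OF g]] int1' by (simp add: distrib_left)
  qed
  have span: "(\<integral>\<nu>. S \<nu> * T \<nu> \<partial>Q) = (\<integral>\<nu>. S \<nu> \<partial>Q) * (\<integral>\<nu>. T \<nu> \<partial>Q)"
    if S: "laplace_span G S" and T: "laplace_span H T" for S T
    using S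
  proof induction
    case (laplace_span_base g)
    then show ?case by (rule base[OF _ T])
  next
    case (laplace_span_scale S c)
    have "(\<integral>\<nu>. c * S \<nu> * T \<nu> \<partial>Q) = (\<integral>\<nu>. c * (S \<nu> * T \<nu>) \<partial>Q)" by (simp add: mult_ac)
    then show ?case using laplace_span_scale by simp
  next
    case (laplace_span_add S S')
    then show ?case using int2[OF _ T] int1 by (simp add: distrib_right)
  qed
  obtain S K where S: "\<And>r::nat. laplace_span G (S r)" "\<And>r \<nu>. \<nu> \<in> counting_measures \<Longrightarrow> \<bar>S r \<nu>\<bar> \<le> K"
    "\<And>\<nu>. \<nu> \<in> counting_measures \<Longrightarrow> (\<lambda>r. S r \<nu>) \<longlonglongrightarrow> \<Phi> \<nu>"
    by (rule laplace_closure_sequence[OF G \<Phi>]) (rule that)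
  obtain T L where T: "\<And>r::nat. laplace_span H (T r)" "\<And>r \<nu>. \<nu> \<in> counting_measures \<Longrightarrow> \<bar>T r \<nu>\<bar> \<le> L"
    "\<And>\<nu>. \<nu> \<in> counting_measures \<Longrightarrow> (\<lambda>r. T r \<nu>) \<longlonglongrightarrow> \<Psi> \<nu>"
    by (rule laplace_closure_sequence[OF H \<Psi>]) (rule that)
  note mS = laplace_span_measurable[OF G S(1)] and mT = laplace_span_measurable[OF H T(1)]
    and m\<Phi> = laplace_closure_measurable[OF G \<Phi>] and m\<Psi> = laplace_closure_measurable[OF H \<Psi>]
  have "(\<lambda>r. \<integral>\<nu>. S r \<nu> * T r \<nu> \<partial>Q) \<longlonglongrightarrow> (\<integral>\<nu>. \<Phi> \<nu> * \<Psi> \<nu> \<partial>Q)"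
  proof (rule Q.integral_tendsto_bounded[where K="K * L"])
    show "\<bar>S r \<nu> * T r \<nu>\<bar> \<le> K * L" if \<nu>: "\<nu> \<in> counting_measures" for r \<nu>
      unfolding abs_mult using S(2)[OF \<nu>] T(2)[OF \<nu>] order_trans[OF abs_ge_zero S(2)[OF \<nu>]] by (intro mult_mono) auto
    show "(\<lambda>r. S r \<nu> * T r \<nu>) \<longlonglongrightarrow> \<Phi> \<nu> * \<Psi> \<nu>" if \<nu>: "\<nu> \<in> counting_measures" for \<nu>
      using S(3)[OF \<nu>] T(3)[OF \<nu>] by (rule tendsto_mult)
  qed (rule borel_measurable_times mS mT m\<Phi> m\<Psi>)+
  moreover have "(\<lambda>r. (\<integral>\<nu>. S r \<nu> \<partial>Q) * (\<integral>\<nu>. T r \<nu> \<partial>Q)) \<longlonglongrightarrow> (\<integral>\<nu>. \<Phi> \<nu> \<partial>Q) * (\<integral>\<nu>. \<Psi> \<nu> \<partial>Q)"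
    by (intro tendsto_mult Q.integral_tendsto_bounded[OF mS m\<Phi> S(2,3)] Q.integral_tendsto_bounded[OF mT m\<Psi> T(2,3)])
  ultimately show ?thesis
    unfolding span[OF S(1) T(1)] by (rule LIMSEQ_unique)
qed

text \<open>Reduces measurability of a family of laws to that of its Laplace functionals, the only
  thing computed for the thinning kernel.\<close>

lemma laplace_closure_kernel_measurable:
  assumes K: "\<And>\<omega>. \<omega> \<in> space M \<Longrightarrow> counting_law (K \<omega>)" and G: "test_cone G"
    and base: "\<And>g. g \<in> G \<Longrightarrow> (\<lambda>\<omega>. \<integral>\<nu>. laplace g \<nu> \<partial>K \<omega>) \<in> borel_measurable M"
    and \<Phi>: "laplace_closure G \<Phi>"
  shows "(\<lambda>\<omega>. \<integral>\<nu>. \<Phi> \<nu> \<partial>K \<omega>) \<in> borel_measurable M"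
proof -
  note int = counting_law.integrable_laplace_closure[OF K G laplace_closure_span]
  have span: "(\<lambda>\<omega>. \<integral>\<nu>. S \<nu> \<partial>K \<omega>) \<in> borel_measurable M" if "laplace_span G S" for S
    using that
  proof induction
    case (laplace_span_base g)
    then show ?case by (rule base)
  next
    case (laplace_span_add S T)
    then have "(\<lambda>\<omega>. (\<integral>\<nu>. S \<nu> \<partial>K \<omega>) + (\<integral>\<nu>. T \<nu> \<partial>K \<omega>)) \<in> borel_measurable M" by simp
    then show ?case
      by (rule measurable_cong[THEN iffD1, rotated])
        (simp add: Bochner_Integration.integral_add[OF int[OF _ laplace_span_add(1)] int[OF _ laplace_span_add(2)]])
  qed auto
  obtain S L where S: "\<And>r::nat. laplace_span G (S r)" "\<And>r \<nu>. \<nu> \<in> counting_measures \<Longrightarrow> \<bar>S r \<nu>\<bar> \<le> L"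
    "\<And>\<nu>. \<nu> \<in> counting_measures \<Longrightarrow> (\<lambda>r. S r \<nu>) \<longlonglongrightarrow> \<Phi> \<nu>"
    by (rule laplace_closure_sequence[OF G \<Phi>]) (rule that)
  show ?thesis
  proof (rule borel_measurable_LIMSEQ_metric)
    show "(\<lambda>\<omega>. \<integral>\<nu>. S r \<nu> \<partial>K \<omega>) \<in> borel_measurable M" for r by (rule span[OF S(1)])
    show "(\<lambda>r. \<integral>\<nu>. S r \<nu> \<partial>K \<omega>) \<longlonglongrightarrow> (\<integral>\<nu>. \<Phi> \<nu> \<partial>K \<omega>)" if "\<omega> \<in> space M" for \<omega>
      by (rule counting_law.integral_tendsto_bounded[OF K[OF that] laplace_span_measurable[OF G S(1)]
        laplace_closure_measurable[OF G \<Phi>] S(2,3)])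
  qed
qed

section \<open>Generation of the sigma-algebra and measurability of thinning\<close>

text \<open>The generator contains the events that a bounded set has a given count, and these
  already make every evaluation measurable. It is stable under intersection because the closure is
  stable under products.\<close>

lemma sets_counting_algebra_eq_sigma_sets:
  "sets (counting_algebra :: 'a::metric_space measure measure) = sigma_sets counting_measures
    {E. E \<subseteq> counting_measures \<and> laplace_closure bounded_test (indicator E)}" (is "_ = sigma_sets _ ?E")
proof
  have "E \<in> sets counting_algebra" if "E \<in> ?E" for E
  proof -
    have "(indicator E :: _ \<Rightarrow> real) \<in> borel_measurable counting_algebra"
      using that by (intro laplace_closure_measurable[OF test_cone_bounded_test]) auto
    then have "E \<inter> space counting_algebra \<in> sets counting_algebra" by (simp only: borel_measurable_indicator_iff)
    with that show ?thesis by (simp add: Int_absorb2)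
  qed
  then show "sigma_sets counting_measures ?E \<subseteq> sets counting_algebra"
    using sets.sigma_sets_subset[of ?E counting_algebra] by auto
next
  let ?S = "sigma (counting_measures :: 'a measure set) ?E"
  have E: "?E \<subseteq> Pow counting_measures" by auto
  have space: "space ?S = counting_measures" by (rule space_measure_of[OF E])
  have bdd: "(\<lambda>\<nu>. emeasure \<nu> A) \<in> borel_measurable ?S" if A: "A \<in> sets borel" "bounded A" for A :: "'a set"
  proof -
    \<comment> \<open>On a bounded set the count is a natural number, so only the preimages of
      single values have to be examined.\<close>
    have "(\<lambda>\<nu>. emeasure \<nu> A) \<in> ?S \<rightarrow>\<^sub>M count_space (range of_nat)"
    proof (subst measurable_count_space_eq_countable)
      show "countable (range (of_nat :: nat \<Rightarrow> ennreal))" by simp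
      have 1: "(\<lambda>\<nu>. emeasure \<nu> A) \<in> space ?S \<rightarrow> range of_nat"
        unfolding space using counting_measure_natE[OF _ A] by (metis Pi_I rangeI)
      have 2: "(\<lambda>\<nu>. emeasure \<nu> A) -` {of_nat j} \<inter> space ?S \<in> sets ?S" for j :: nat
      proof -
        let ?F = "{\<nu> \<in> counting_measures. measure \<nu> A = real j}"
        have "laplace_closure bounded_test (\<lambda>\<nu>. of_bool (measure \<nu> A = real j))"
          using A by (intro laplace_closure_count_eq test_cone_bounded_test indicator_bounded_test)
        then have "laplace_closure bounded_test (indicator ?F)"
          by (rule laplace_closure_cong) (simp add: indicator_def)
        then have "?F \<in> sets ?S" by (auto simp: sets_measure_of[OF E])
        also have "?F = (\<lambda>\<nu>. emeasure \<nu> A) -` {of_nat j} \<inter> space ?S"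
        proof -
          have "(measure \<nu> A = real j) = (emeasure \<nu> A = of_nat j)" if "\<nu> \<in> counting_measures" for \<nu>
            using counting_measure_natE[OF that A] by (metis of_nat_eq_iff)
          then show ?thesis unfolding space by auto
        qed
        finally show ?thesis .
      qed
      show "(\<lambda>\<nu>. emeasure \<nu> A) \<in> space ?S \<rightarrow> range of_nat \<and>
        (\<forall>a\<in>range of_nat. (\<lambda>\<nu>. emeasure \<nu> A) -` {a} \<inter> space ?S \<in> sets ?S)"
        using 1 2 by blast
    qed
    from measurable_compose[OF this, of "\<lambda>x. x" borel] show ?thesis by simp
  qed
  have "(\<lambda>\<nu>. emeasure \<nu> A) \<in> borel_measurable ?S" if A: "A \<in> sets borel" for A :: "'a set"
  proof -
    obtain x0 :: 'a where True by blast
    let ?A = "\<lambda>k::nat. A \<inter> cball x0 (real k)"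
    \<comment> \<open>On an unbounded set the count may be infinite; it is the supremum of the
      counts of the bounded parts.\<close>
    have "(\<lambda>\<nu>. SUP k. emeasure \<nu> (?A k)) \<in> borel_measurable ?S"
      using A by (intro borel_measurable_SUP bdd) (auto intro: bounded_subset[OF bounded_cball])
    moreover have "(SUP k. emeasure \<nu> (?A k)) = emeasure \<nu> A" if "\<nu> \<in> space ?S" for \<nu>
    proof -
      have "\<nu> \<in> counting_measures" using that by (simp add: space)
      then have "(SUP k. emeasure \<nu> (?A k)) = emeasure \<nu> (\<Union>k. ?A k)"
        using A by (intro SUP_emeasure_incseq)
          (auto simp: sets_counting_measures incseq_def)
      also have "(\<Union>k. ?A k) = A" using real_arch_simple by auto
      finally show ?thesis .
    qed
    ultimately show ?thesis by (rule measurable_cong[THEN iffD1, rotated])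
  qed
  then have "(\<lambda>\<nu>. \<nu>) \<in> ?S \<rightarrow>\<^sub>M counting_algebra"
    by (intro measurable_counting_algebraI) (simp_all add: space)
  from measurable_sets[OF this] have "sets counting_algebra \<subseteq> sets ?S"
    using sets.sets_into_space[of _ "counting_algebra :: 'a measure measure"]
    by (auto simp: space Int_absorb2)
  then show "sets counting_algebra \<subseteq> sigma_sets counting_measures ?E"
    by (simp add: sets_measure_of[OF E])
qed

text \<open>The Laplace functional of the kernel at \<open>g\<close> is that of \<open>\<nu>\<close>
  at the transformed test, hence measurable in \<open>\<nu>\<close>. This passes to the indicators
  in the closure, whose events form an intersection-stable generator.\<close>

lemma measurable_thinning_kernel:
  assumes p: "0 \<le> p" "p \<le> 1"
  shows "thinning_kernel p \<in> (counting_algebra :: 'a::polish_space measure measure) \<rightarrow>\<^sub>M subprob_algebra counting_algebra"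
proof (rule measurable_subprob_algebra_generated[OF sets_counting_algebra_eq_sigma_sets])
  have law: "counting_law (thinning_kernel p \<nu>)" if "\<nu> \<in> space counting_algebra" for \<nu> :: "'a measure"
    using that by (simp add: counting_law_def counting_law_axioms_def sets_thinning_kernel prob_space_thinning_kernel)
  show "Int_stable {E :: 'a measure set. E \<subseteq> counting_measures \<and> laplace_closure bounded_test (indicator E)}"
  proof (rule Int_stableI, safe)
    fix D E :: "'a measure set"
    assume "laplace_closure bounded_test (indicator D)" "laplace_closure bounded_test (indicator E)"
    from laplace_closure_mult[OF test_cone_bounded_test this] show "laplace_closure bounded_test (indicator (D \<inter> E))"
      by (rule laplace_closure_cong) (simp add: indicator_inter_arith)
  qed auto
  show "subprob_space (thinning_kernel p \<nu>)" if "\<nu> \<in> space counting_algebra" for \<nu> :: "'a measure"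
    using that by (simp add: prob_space_thinning_kernel prob_space_imp_subprob_space)
  show "sets (thinning_kernel p \<nu>) = sets counting_algebra" if "\<nu> \<in> space counting_algebra" for \<nu> :: "'a measure"
    using that by (simp add: sets_thinning_kernel)
  have base: "(\<lambda>\<nu>. \<integral>\<nu>'. laplace g \<nu>' \<partial>thinning_kernel p \<nu>) \<in> borel_measurable counting_algebra"
    if "g \<in> bounded_test" for g :: "'a \<Rightarrow> real"
    using laplace_measurable[OF bounded_test_thinned(1)[OF that p]]
    by (rule measurable_cong[THEN iffD1, rotated]) (simp add: integral_thinning_kernel that p)
  show "(\<lambda>\<nu>. emeasure (thinning_kernel p \<nu>) E) \<in> borel_measurable counting_algebra"
    if "E \<in> {E. E \<subseteq> counting_measures \<and> laplace_closure bounded_test (indicator E)}" for E :: "'a measure set"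
  proof -
    have "(\<lambda>\<nu>. \<integral>\<nu>'. (indicator E \<nu>' :: real) \<partial>thinning_kernel p \<nu>) \<in> borel_measurable counting_algebra"
      by (rule laplace_closure_kernel_measurable[OF law test_cone_bounded_test base]) (use that in auto)
    then have "(\<lambda>\<nu>. ennreal (\<integral>\<nu>'. indicator E \<nu>' \<partial>thinning_kernel p \<nu>)) \<in> borel_measurable counting_algebra"
      by (rule measurable_compose) (rule measurable_ennreal)
    then show ?thesis
    proof (rule measurable_cong[THEN iffD1, rotated])
      fix \<nu> :: "'a measure" assume \<nu>: "\<nu> \<in> space counting_algebra"
      interpret counting_law "thinning_kernel p \<nu>" by (rule law[OF \<nu>])
      show "ennreal (\<integral>\<nu>'. indicator E \<nu>' \<partial>thinning_kernel p \<nu>) = emeasure (thinning_kernel p \<nu>) E"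
        using that by (simp add: emeasure_eq_measure space_P Int_absorb2)
    qed
  qed
  have "(\<lambda>\<nu>::'a measure. emeasure (thinning_kernel p \<nu>) counting_measures) \<in> borel_measurable counting_algebra \<longleftrightarrow>
    (\<lambda>\<nu>::'a measure. 1 :: ennreal) \<in> borel_measurable counting_algebra"
  proof (rule measurable_cong)
    fix \<nu> :: "'a measure" assume \<nu>: "\<nu> \<in> space counting_algebra"
    interpret counting_law "thinning_kernel p \<nu>" by (rule law[OF \<nu>])
    show "emeasure (thinning_kernel p \<nu>) counting_measures = 1" using emeasure_space_1 by (simp add: space_P)
  qed
  then show "(\<lambda>\<nu>::'a measure. emeasure (thinning_kernel p \<nu>) counting_measures) \<in> borel_measurable counting_algebra"
    by simp
qed auto

section \<open>Laplace functionals of thinned superpositions\<close>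

lemma bounded_test_one_minus_exp:
  assumes "g \<in> bounded_test"
  shows "(\<lambda>x. 1 - exp (- g x)) \<in> bounded_test"
proof (rule bounded_test_le[OF assms, where c=1])
  have [measurable]: "g \<in> borel_measurable borel" by (rule bounded_test_measurable[OF assms])
  show "(\<lambda>x. 1 - exp (- g x)) \<in> borel_measurable borel" by measurable
  show "0 \<le> 1 - exp (- g x)" "1 - exp (- g x) \<le> 1 * g x" for x
    using bounded_test_nonneg[OF assms, of x] exp_ge_add_one_self[of "- g x"] by auto
qed simp

lemma point_process_counting_measures:
  "point_process M \<xi> \<Longrightarrow> \<omega> \<in> space M \<Longrightarrow> \<xi> \<omega> \<in> counting_measures"
  unfolding point_process_def using measurable_space[of \<xi> M counting_algebra \<omega>] by simp

text \<open>Here bounded finiteness of the intensity measure enters: it makes the integral of a test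
  against \<open>\<xi>\<close> integrable. Applied to \<open>1 - exp (- g)\<close>, this supplies
  the dominating function for the limit.\<close>

lemma
  assumes \<xi>: "point_process M \<xi>" and \<mu>: "boundedly_finite (intensity_measure M \<xi>)" and g: "g \<in> bounded_test"
  shows integrable_point_process: "integrable M (\<lambda>\<omega>. \<integral>x. g x \<partial>\<xi> \<omega>)"
    and integral_point_process: "(\<integral>\<omega>. (\<integral>x. g x \<partial>\<xi> \<omega>) \<partial>M) = (\<integral>x. g x \<partial>intensity_measure M \<xi>)"
proof -
  note cm = point_process_counting_measures[OF \<xi>]
  have meas: "\<xi> \<in> M \<rightarrow>\<^sub>M counting_algebra" using \<xi> by (simp add: point_process_def)
  have nn: "0 \<le> g x" for x by (rule bounded_test_nonneg[OF g])
  have "(\<integral>\<^sup>+x. ennreal (g x) \<partial>intensity_measure M \<xi>) = (\<integral>\<^sup>+\<omega>. (\<integral>\<^sup>+x. ennreal (g x) \<partial>\<xi> \<omega>) \<partial>M)"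
    using cm bounded_test_measurable[OF g]
    by (intro nn_integral_intensity_measure measurable_compose[OF meas] measurable_emeasure_counting_algebra)
      (auto simp: sets_counting_measures)
  also have "\<dots> = (\<integral>\<^sup>+\<omega>. ennreal (\<integral>x. g x \<partial>\<xi> \<omega>) \<partial>M)"
    using cm nn by (intro nn_integral_cong nn_integral_eq_integral integrable_bounded_test g
      counting_measures_boundedly_finite) auto
  finally have "(\<integral>\<^sup>+\<omega>. ennreal (\<integral>x. g x \<partial>\<xi> \<omega>) \<partial>M) = (\<integral>\<^sup>+x. ennreal (g x) \<partial>intensity_measure M \<xi>)" ..
  also have "\<dots> = ennreal (\<integral>x. g x \<partial>intensity_measure M \<xi>)"
    using nn by (intro nn_integral_eq_integral integrable_bounded_test \<mu> g) auto
  finally have eq: "(\<integral>\<^sup>+\<omega>. ennreal (\<integral>x. g x \<partial>\<xi> \<omega>) \<partial>M) = ennreal (\<integral>x. g x \<partial>intensity_measure M \<xi>)" .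
  have m: "(\<lambda>\<omega>. \<integral>x. g x \<partial>\<xi> \<omega>) \<in> borel_measurable M"
    by (rule measurable_compose[OF meas measurable_integral_counting_algebra[OF g]])
  show "integrable M (\<lambda>\<omega>. \<integral>x. g x \<partial>\<xi> \<omega>)"
    using eq nn by (intro integrableI_nonneg m) (auto intro: Bochner_Integration.integral_nonneg)
  show "(\<integral>\<omega>. (\<integral>x. g x \<partial>\<xi> \<omega>) \<partial>M) = (\<integral>x. g x \<partial>intensity_measure M \<xi>)"
    using eq nn by (subst integral_eq_nn_integral[OF m]) (auto intro: Bochner_Integration.integral_nonneg)
qed

text \<open>With \<open>y = a n / n\<close> in \<open>[0, 1/2]\<close>, \<open>ln (1 - y)\<close>
  lies between \<open>- y - 2 y^2\<close> and \<open>- y\<close>. Multiplied by \<open>n\<close>,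
  both bounds tend to \<open>- l\<close> because \<open>n y = a n\<close> and \<open>y\<close> tends
  to 0.\<close>

lemma tendsto_one_minus_over_n_power:
  fixes a :: "nat \<Rightarrow> real"
  assumes a: "a \<longlonglongrightarrow> l" "\<And>n. 0 \<le> a n"
  shows "(\<lambda>n. (1 - a n / real n) ^ n) \<longlonglongrightarrow> exp (- l)"
proof -
  have inv: "(\<lambda>n. a n / real n) \<longlonglongrightarrow> 0"
    using tendsto_mult[OF a(1) lim_1_over_n] by simp
  then have ev: "\<forall>\<^sub>F n in sequentially. a n / real n < 1/2" by (rule order_tendstoD) simp
  have "(\<lambda>n. - a n - 2 * a n * (a n / real n)) \<longlonglongrightarrow> - l - 2 * l * 0"
    by (intro tendsto_intros a inv)
  then have lower: "(\<lambda>n. - a n - 2 * a n * (a n / real n)) \<longlonglongrightarrow> - l" by simp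
  have upper: "(\<lambda>n. - a n) \<longlonglongrightarrow> - l" by (intro tendsto_intros a)
  have "(\<lambda>n. real n * ln (1 - a n / real n)) \<longlonglongrightarrow> - l"
  proof (rule tendsto_sandwich[OF _ _ lower upper])
    show "\<forall>\<^sub>F n in sequentially. - a n - 2 * a n * (a n / real n) \<le> real n * ln (1 - a n / real n)"
      using ev eventually_gt_at_top[of 0]
    proof eventually_elim
      case (elim n)
      define y where "y = a n / real n"
      have "real n * (- y - 2 * y\<^sup>2) \<le> real n * ln (1 - y)"
        using elim a(2)[of n] by (intro mult_left_mono ln_one_minus_pos_lower_bound) (auto simp: y_def)
      moreover have "real n * (- y - 2 * y\<^sup>2) = - (real n * y) - 2 * (real n * y) * y"
        by (simp add: power2_eq_square right_diff_distrib)
      moreover have "real n * y = a n" using elim by (simp add: y_def)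
      ultimately show ?case by (simp add: y_def)
    qed
    show "\<forall>\<^sub>F n in sequentially. real n * ln (1 - a n / real n) \<le> - a n"
      using ev eventually_gt_at_top[of 0]
    proof eventually_elim
      case (elim n)
      have "real n * ln (1 - a n / real n) \<le> real n * (- (a n / real n))"
        using elim a(2)[of n] by (intro mult_left_mono ln_one_minus_pos_upper_bound) auto
      then show ?case using elim by simp
    qed
  qed
  then have "(\<lambda>n. exp (real n * ln (1 - a n / real n))) \<longlonglongrightarrow> exp (- l)" by (rule tendsto_exp)
  moreover have "\<forall>\<^sub>F n in sequentially. exp (real n * ln (1 - a n / real n)) = (1 - a n / real n) ^ n"
    using ev
  proof eventually_elim
    case (elim n)
    then have "0 < 1 - a n / real n" by linarith
    then show ?case by (simp add: exp_of_nat_mult)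
  qed
  ultimately show ?thesis by (rule Lim_transform_eventually)
qed

text \<open>The bounds \<open>y \<le> - ln (1 - y) \<le> y + 2 y\<^sup>2\<close> with \<open>y = (1 - exp (- g x)) / n\<close>, integrated over \<open>\<nu>\<close>.\<close>

lemma integral_thinned_bounds:
  assumes \<nu>: "boundedly_finite \<nu>" and g: "g \<in> bounded_test" and n: "2 \<le> n"
  defines "U \<equiv> \<integral>x. 1 - exp (- g x) \<partial>\<nu>"
    and "z \<equiv> \<integral>x. - ln (1 - 1 / real n * (1 - exp (- g x))) \<partial>\<nu>"
  shows "U \<le> real n * z" "real n * z \<le> (1 + 2 / real n) * U"
proof -
  let ?u = "\<lambda>x. 1 - exp (- g x)" and ?h = "\<lambda>x. - ln (1 - 1 / real n * (1 - exp (- g x)))"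
  have iu: "integrable \<nu> ?u" by (intro integrable_bounded_test \<nu> bounded_test_one_minus_exp g)
  have ih: "integrable \<nu> ?h" using n by (intro integrable_bounded_test \<nu> bounded_test_thinned(1) g) auto
  have u: "0 \<le> ?u x" "?u x < 1" for x using bounded_test_nonneg[OF g, of x] by auto
  \<comment> \<open>\<open>2 \<le> n\<close> gives \<open>1 / real n * ?u x \<le> 1/2\<close>, the
    range in which the quadratic lower bound for \<open>ln (1 - y)\<close> is valid.\<close>
  have y: "0 \<le> 1 / real n * ?u x" "1 / real n * ?u x \<le> 1/2" for x
  proof -
    show "0 \<le> 1 / real n * ?u x" using u by simp
    have "1 / real n * ?u x \<le> 1 / 2 * 1" using u[of x] n by (intro mult_mono) (auto simp: field_simps)
    then show "1 / real n * ?u x \<le> 1/2" by simp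
  qed
  have lower: "?u x \<le> real n * ?h x" for x
  proof -
    have "1 / real n * ?u x < 1" using y(2)[of x] by linarith
    from ln_one_minus_pos_upper_bound[OF y(1) this] have "1 / real n * ?u x \<le> ?h x" by linarith
    then have "real n * (1 / real n * ?u x) \<le> real n * ?h x" by (rule mult_left_mono) simp
    then show ?thesis using n by simp
  qed
  have upper: "real n * ?h x \<le> (1 + 2 / real n) * ?u x" for x
  proof -
    have "real n * ?h x \<le> real n * (1 / real n * ?u x + 2 * (1 / real n * ?u x)\<^sup>2)"
      using ln_one_minus_pos_lower_bound[OF y[of x]] by (intro mult_left_mono) linarith+
    also have "\<dots> = ?u x + 2 / real n * (?u x * ?u x)" using n by (simp add: field_simps power2_eq_square)
    also have "\<dots> \<le> ?u x + 2 / real n * (?u x * 1)"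
      using u[of x] by (intro add_left_mono mult_left_mono) auto
    finally show ?thesis by (simp add: algebra_simps)
  qed
  have "U \<le> (\<integral>x. real n * ?h x \<partial>\<nu>)"
    unfolding U_def by (intro integral_mono iu integrable_mult_right ih lower)
  then show "U \<le> real n * z" by (simp add: z_def)
  have "(\<integral>x. real n * ?h x \<partial>\<nu>) \<le> (\<integral>x. (1 + 2 / real n) * ?u x \<partial>\<nu>)"
    by (intro integral_mono integrable_mult_right iu ih upper)
  then show "real n * z \<le> (1 + 2 / real n) * U" by (simp add: z_def U_def)
qed

text \<open>\<open>n * z n\<close> lies between \<open>U\<close> and \<open>(1 + 2 / n) * U\<close>,
  hence \<open>z n \<le> 2 * U / n\<close> for \<open>n \<ge> 2\<close>. The inequalities
  \<open>t / (1 + t) \<le> 1 - exp (- t) \<le> t\<close> at \<open>t = z n\<close> then squeeze the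
  expression between \<open>U / (1 + 2 * U / n)\<close> and \<open>(1 + 2 / n) * U\<close>. The
  bound \<open>2 * U\<close> serves for domination.\<close>

lemma tendsto_thinned_laplace:
  assumes \<nu>: "boundedly_finite \<nu>" and g: "g \<in> bounded_test"
  defines "z \<equiv> \<lambda>n::nat. \<integral>x. - ln (1 - 1 / real n * (1 - exp (- g x))) \<partial>\<nu>"
    and "U \<equiv> \<integral>x. 1 - exp (- g x) \<partial>\<nu>"
  shows "2 \<le> n \<Longrightarrow> real n * (1 - exp (- z n)) \<le> 2 * U"
    and "(\<lambda>n. real n * (1 - exp (- z n))) \<longlonglongrightarrow> U"
proof -
  have U: "0 \<le> U" unfolding U_def using bounded_test_nonneg[OF g] by (intro Bochner_Integration.integral_nonneg) auto
  have b: "U \<le> real n * z n" "real n * z n \<le> (1 + 2 / real n) * U" if "2 \<le> n" for n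
    using integral_thinned_bounds[OF \<nu> g that] by (simp_all add: z_def U_def)
  have up: "real n * (1 - exp (- z n)) \<le> (1 + 2 / real n) * U" if "2 \<le> n" for n
  proof -
    have "real n * (1 - exp (- z n)) \<le> real n * z n"
      using exp_ge_add_one_self[of "- z n"] by (intro mult_left_mono) auto
    with b(2)[OF that] show ?thesis by linarith
  qed
  have two: "(1 + 2 / real n) * U \<le> 2 * U" if "2 \<le> n" for n
    using that U by (intro mult_right_mono) (auto simp: field_simps)
  show "2 \<le> n \<Longrightarrow> real n * (1 - exp (- z n)) \<le> 2 * U" using up[of n] two[of n] by linarith
  have low: "U / (1 + 2 * U / real n) \<le> real n * (1 - exp (- z n))" if n: "2 \<le> n" for n
  proof -
    have "0 \<le> real n * z n" "real n * z n \<le> 2 * U" using b[OF n] two[OF n] U by linarith+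
    then have zn: "0 \<le> z n" "z n \<le> 2 * U / real n"
      using n by (auto simp: zero_le_mult_iff pos_le_divide_eq mult.commute)
    have "U / (1 + 2 * U / real n) \<le> U / (1 + z n)"
      using zn U by (intro divide_left_mono) auto
    also have "\<dots> \<le> real n * z n / (1 + z n)" using b(1)[OF n] zn by (intro divide_right_mono) auto
    also have "\<dots> = real n * (1 - 1 / (1 + z n))" using zn by (simp add: field_simps)
    also have "\<dots> \<le> real n * (1 - exp (- z n))"
    proof (intro mult_left_mono diff_left_mono)
      have "exp (- z n) = 1 / exp (z n)" by (simp add: exp_minus divide_inverse)
      also have "\<dots> \<le> 1 / (1 + z n)" using zn exp_ge_add_one_self[of "z n"] by (intro divide_left_mono) auto
      finally show "exp (- z n) \<le> 1 / (1 + z n)" .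
    qed simp
    finally show ?thesis .
  qed
  have inv: "(\<lambda>n. c / real n) \<longlonglongrightarrow> 0" for c :: real
    using tendsto_mult[OF tendsto_const lim_1_over_n, of c] by simp
  have "(\<lambda>n. U / (1 + 2 * U / real n)) \<longlonglongrightarrow> U / (1 + 0)" "(\<lambda>n. (1 + 2 / real n) * U) \<longlonglongrightarrow> (1 + 0) * U"
    by (intro tendsto_intros inv; simp)+
  then have lims: "(\<lambda>n. U / (1 + 2 * U / real n)) \<longlonglongrightarrow> U" "(\<lambda>n. (1 + 2 / real n) * U) \<longlonglongrightarrow> U" by simp_all
  show "(\<lambda>n. real n * (1 - exp (- z n))) \<longlonglongrightarrow> U"
    by (rule tendsto_sandwich[OF _ _ lims])
      (use low up in \<open>auto intro!: eventually_mono[OF eventually_ge_at_top[of 2]]\<close>)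
qed

lemma thinned_laplace_limit:
  assumes \<xi>: "point_process M \<xi>" and \<mu>: "boundedly_finite (intensity_measure M \<xi>)" and g: "g \<in> bounded_test"
  shows "(\<lambda>n. (\<integral>\<omega>. exp (- (\<integral>x. - ln (1 - 1 / real n * (1 - exp (- g x))) \<partial>\<xi> \<omega>)) \<partial>M) ^ n)
    \<longlonglongrightarrow> exp (- (\<integral>x. 1 - exp (- g x) \<partial>intensity_measure M \<xi>))"
proof -
  interpret prob_space M using \<xi> by (simp add: point_process_def)
  have meas: "\<xi> \<in> M \<rightarrow>\<^sub>M counting_algebra" using \<xi> by (simp add: point_process_def)
  note bf = counting_measures_boundedly_finite[OF point_process_counting_measures[OF \<xi>]]
  \<comment> \<open>For \<open>n = 0\<close> the quotient is 0, so the bounds hold for every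
    \<open>n\<close>.\<close>
  have p: "0 \<le> 1 / real n" "1 / real n \<le> 1" for n :: nat by (cases n; simp add: field_simps)+
  note h = bounded_test_thinned(1)[OF g p] and u = bounded_test_one_minus_exp[OF g]
  define z where "z n \<omega> = (\<integral>x. - ln (1 - 1 / real n * (1 - exp (- g x))) \<partial>\<xi> \<omega>)" for n :: nat and \<omega>
  define U where "U \<omega> = (\<integral>x. 1 - exp (- g x) \<partial>\<xi> \<omega>)" for \<omega>
  have z_meas [measurable]: "z n \<in> borel_measurable M" for n
    unfolding z_def by (rule measurable_compose[OF meas measurable_integral_counting_algebra[OF h]])
  have z_nonneg: "0 \<le> z n \<omega>" for n \<omega>
    unfolding z_def by (intro Bochner_Integration.integral_nonneg bounded_test_nonneg[OF h])
  have U_nonneg: "0 \<le> U \<omega>" for \<omega>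
    unfolding U_def by (intro Bochner_Integration.integral_nonneg bounded_test_nonneg[OF u])
  have U_int: "integrable M U" unfolding U_def by (rule integrable_point_process[OF \<xi> \<mu> u])
  have exp_meas: "(\<lambda>\<omega>. exp (- z n \<omega>)) \<in> borel_measurable M" for n
    by measurable
  have exp_int: "integrable M (\<lambda>\<omega>. exp (- z n \<omega>))" for n
    using z_nonneg by (intro integrable_const_bound[where B=1] exp_meas) auto
  \<comment> \<open>Chosen so that the expectation of \<open>exp (- z n)\<close> is
    \<open>1 - a n / n\<close> for \<open>n > 0\<close>, the form of the exponential limit.\<close>
  define a where "a n = real n * (1 - (\<integral>\<omega>. exp (- z n \<omega>) \<partial>M))" for n
  have a_eq: "a n = (\<integral>\<omega>. real n * (1 - exp (- z n \<omega>)) \<partial>M)" for n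
    using exp_int by (simp add: a_def prob_space)
  have a_nonneg: "0 \<le> a n" for n
    unfolding a_eq using z_nonneg by (intro Bochner_Integration.integral_nonneg mult_nonneg_nonneg) auto
  \<comment> \<open>The shift by 2 starts the sequence where the domination by \<open>2 * U\<close>
    holds.\<close>
  have "(\<lambda>n. \<integral>\<omega>. real (n + 2) * (1 - exp (- z (n + 2) \<omega>)) \<partial>M) \<longlonglongrightarrow> (\<integral>\<omega>. U \<omega> \<partial>M)"
  proof (rule integral_dominated_convergence[where w="\<lambda>\<omega>. 2 * U \<omega>"])
    show "integrable M (\<lambda>\<omega>. 2 * U \<omega>)" using U_int by simp
    show "AE \<omega> in M. (\<lambda>n. real (n + 2) * (1 - exp (- z (n + 2) \<omega>))) \<longlonglongrightarrow> U \<omega>"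
    proof (rule AE_I2)
      fix \<omega> assume "\<omega> \<in> space M"
      from tendsto_thinned_laplace(2)[OF bf[OF this] g]
      have "(\<lambda>n. real n * (1 - exp (- z n \<omega>))) \<longlonglongrightarrow> U \<omega>" by (simp only: z_def U_def)
      then show "(\<lambda>n. real (n + 2) * (1 - exp (- z (n + 2) \<omega>))) \<longlonglongrightarrow> U \<omega>" by (rule LIMSEQ_ignore_initial_segment)
    qed
    show "AE \<omega> in M. norm (real (n + 2) * (1 - exp (- z (n + 2) \<omega>))) \<le> 2 * U \<omega>" for n
    proof (rule AE_I2)
      fix \<omega> assume \<omega>: "\<omega> \<in> space M"
      have "real (n + 2) * (1 - exp (- z (n + 2) \<omega>)) \<le> 2 * U \<omega>"
        unfolding z_def U_def by (rule tendsto_thinned_laplace(1)[OF bf[OF \<omega>] g]) simp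
      moreover have "0 \<le> real (n + 2) * (1 - exp (- z (n + 2) \<omega>))"
        using z_nonneg by (intro mult_nonneg_nonneg) auto
      ultimately show "norm (real (n + 2) * (1 - exp (- z (n + 2) \<omega>))) \<le> 2 * U \<omega>" by simp
    qed
    show "U \<in> borel_measurable M" using U_int by simp
    show "(\<lambda>\<omega>. real (n + 2) * (1 - exp (- z (n + 2) \<omega>))) \<in> borel_measurable M" for n
      by measurable
  qed
  then have "(\<lambda>n. a (n + 2)) \<longlonglongrightarrow> (\<integral>\<omega>. U \<omega> \<partial>M)" unfolding a_eq .
  then have "a \<longlonglongrightarrow> (\<integral>\<omega>. U \<omega> \<partial>M)" by (rule LIMSEQ_offset)
  also have "(\<integral>\<omega>. U \<omega> \<partial>M) = (\<integral>x. 1 - exp (- g x) \<partial>intensity_measure M \<xi>)"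
    unfolding U_def by (rule integral_point_process[OF \<xi> \<mu> u])
  finally have "(\<lambda>n. (1 - a n / real n) ^ n) \<longlonglongrightarrow> exp (- (\<integral>x. 1 - exp (- g x) \<partial>intensity_measure M \<xi>))"
    by (rule tendsto_one_minus_over_n_power) (rule a_nonneg)
  moreover have "\<forall>\<^sub>F n in sequentially. (1 - a n / real n) ^ n = (\<integral>\<omega>. exp (- z n \<omega>) \<partial>M) ^ n"
    using eventually_gt_at_top[of 0] by eventually_elim (simp add: a_def)
  ultimately show ?thesis unfolding z_def by (rule Lim_transform_eventually)
qed

section \<open>Thinning laws and superpositions of independent copies\<close>

lemma counting_law_thinning_law:
  fixes \<xi> :: "'w \<Rightarrow> 'a::polish_space measure"
  assumes N: "prob_space N" and \<xi>: "\<xi> \<in> N \<rightarrow>\<^sub>M counting_algebra" and p: "0 \<le> p" "p \<le> 1"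
  shows "counting_law (thinning_law p N \<xi>)"
proof -
  interpret prob_space N by fact
  have K: "(\<lambda>\<omega>. thinning_kernel p (\<xi> \<omega>)) \<in> N \<rightarrow>\<^sub>M subprob_algebra counting_algebra"
    by (rule measurable_compose[OF \<xi> measurable_thinning_kernel[OF p]])
  have "prob_space (thinning_kernel p (\<xi> \<omega>))" if "\<omega> \<in> space N" for \<omega>
    using measurable_space[OF \<xi> that] by (simp add: prob_space_thinning_kernel)
  then have "prob_space (thinning_law p N \<xi>)"
    unfolding thinning_law_def by (intro prob_space_bind[OF _ K] AE_I2)
  moreover have "sets (thinning_law p N \<xi>) = sets counting_algebra"
    unfolding thinning_law_def by (rule sets_bind[OF sets_kernel[OF K] not_empty])
  ultimately show ?thesis by (simp add: counting_law_def counting_law_axioms_def)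
qed

lemma laplace_thinning_law:
  fixes \<xi> :: "'w \<Rightarrow> 'a::polish_space measure"
  assumes N: "prob_space N" and \<xi>: "\<xi> \<in> N \<rightarrow>\<^sub>M counting_algebra" and p: "0 \<le> p" "p \<le> 1"
    and g: "g \<in> bounded_test"
  shows "(\<integral>\<nu>. laplace g \<nu> \<partial>thinning_law p N \<xi>)
    = (\<integral>\<omega>. exp (- (\<integral>x. - ln (1 - p * (1 - exp (- g x))) \<partial>\<xi> \<omega>)) \<partial>N)"
proof -
  interpret prob_space N by fact
  have K: "(\<lambda>\<omega>. thinning_kernel p (\<xi> \<omega>)) \<in> N \<rightarrow>\<^sub>M subprob_algebra counting_algebra"
    by (rule measurable_compose[OF \<xi> measurable_thinning_kernel[OF p]])
  note cm = measurable_space[OF \<xi>, simplified]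
  have "(\<integral>\<nu>. laplace g \<nu> \<partial>thinning_law p N \<xi>)
    = (\<integral>\<omega>. \<integral>\<nu>. laplace g \<nu> \<partial>thinning_kernel p (\<xi> \<omega>) \<partial>N)"
    unfolding thinning_law_def
  proof (rule integral_bind[where B=1 and B'=1, OF laplace_measurable[OF g] _ K])
    show "\<bar>laplace g \<nu>\<bar> \<le> 1" for \<nu> using laplace_integral_bounds[OF g, of \<nu>] by simp
    show "AE \<omega> in N. emeasure (thinning_kernel p (\<xi> \<omega>)) (space (thinning_kernel p (\<xi> \<omega>))) \<le> ennreal 1"
      using cm by (intro AE_I2) (simp add: prob_space.emeasure_space_1 prob_space_thinning_kernel)
  qed (rule finite_measure_axioms)
  also have "\<dots> = (\<integral>\<omega>. exp (- (\<integral>x. - ln (1 - p * (1 - exp (- g x))) \<partial>\<xi> \<omega>)) \<partial>N)"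
    using cm by (intro Bochner_Integration.integral_cong integral_thinning_kernel g p) auto
  finally show ?thesis .
qed

text \<open>The integral against the superposition is a sum, so its negative exponential is a
  product of independent factors. \<open>\<xi>\<close> and its copies may live on different spaces;
  the factors are compared through their image laws.\<close>

lemma laplace_iid_superposition:
  assumes M: "prob_space M" "\<xi> \<in> M \<rightarrow>\<^sub>M counting_algebra"
    and N: "prob_space N" "prob_space.indep_vars N (\<lambda>_. counting_algebra) \<xi>s UNIV"
    and law: "\<And>i. distr N counting_algebra (\<xi>s i) = distr M counting_algebra \<xi>"
    and h: "h \<in> bounded_test"
  shows "(\<integral>\<omega>. exp (- (\<integral>x. h x \<partial>superposition n \<xi>s \<omega>)) \<partial>N) = (\<integral>\<omega>. exp (- (\<integral>x. h x \<partial>\<xi> \<omega>)) \<partial>M) ^ n"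
proof -
  interpret prob_space N by fact
  have meas: "\<xi>s i \<in> N \<rightarrow>\<^sub>M counting_algebra" for i using N(2) by (simp add: indep_vars_def)
  let ?L = "\<lambda>\<nu>. laplace h \<nu>"
  have L: "?L \<in> borel_measurable counting_algebra" by (rule laplace_measurable[OF h])
  have "(\<integral>\<omega>. ?L (superposition n \<xi>s \<omega>) \<partial>N) = (\<integral>\<omega>. (\<Prod>i<n. ?L (\<xi>s i \<omega>)) \<partial>N)"
  proof (rule Bochner_Integration.integral_cong[OF refl])
    fix \<omega> assume "\<omega> \<in> space N"
    then have "\<xi>s i \<omega> \<in> counting_measures" for i using measurable_space[OF meas, of \<omega> i] by simp
    then show "?L (superposition n \<xi>s \<omega>) = (\<Prod>i<n. ?L (\<xi>s i \<omega>))"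
      by (simp add: integral_superposition[OF _ h] exp_sum flip: sum_negf)
  qed
  also have "\<dots> = (\<Prod>i<n. \<integral>\<omega>. ?L (\<xi>s i \<omega>) \<partial>N)"
  proof (rule indep_vars_lebesgue_integral)
    have "indep_vars (\<lambda>_. borel) (\<lambda>i \<omega>. ?L (\<xi>s i \<omega>)) UNIV"
      by (rule indep_vars_compose2[OF N(2) L])
    then show "indep_vars (\<lambda>_. borel) (\<lambda>i \<omega>. ?L (\<xi>s i \<omega>)) {..<n}" by (rule indep_vars_subset) simp
    show "integrable N (\<lambda>\<omega>. ?L (\<xi>s i \<omega>))" for i
      using laplace_integral_bounds[OF h]
      by (intro integrable_const_bound[where B=1] measurable_compose[OF meas L]) auto
  qed simp
  also have "\<dots> = (\<Prod>i<n. \<integral>\<nu>. ?L \<nu> \<partial>distr N counting_algebra (\<xi>s i))"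
    by (intro prod.cong refl integral_distr[symmetric] meas L)
  also have "\<dots> = (\<Prod>i<n. \<integral>\<omega>. ?L (\<xi> \<omega>) \<partial>M)"
    unfolding law by (intro prod.cong refl integral_distr M L)
  finally show ?thesis by simp
qed

section \<open>Poisson distributions, mean zero included\<close>

text \<open>The Poisson distribution extended to mean 0, where it is concentrated at 0; this case
  occurs on shells of measure zero.\<close>

definition poisson_count :: "real \<Rightarrow> nat pmf" where
  "poisson_count m = (if m = 0 then return_pmf 0 else poisson_pmf m)"

lemma pmf_poisson_count: "0 \<le> m \<Longrightarrow> pmf (poisson_count m) j = m ^ j / fact j * exp (- m)"
  by (cases "j = 0") (auto simp: poisson_count_def pmf_return)

text \<open>The probability generating function, summed by the exponential series at
  \<open>m * c\<close>.\<close>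

lemma integral_poisson_count:
  assumes "0 \<le> m" "0 \<le> c" "c \<le> 1"
  shows "(\<integral>k. c ^ k \<partial>measure_pmf (poisson_count m)) = exp (- (m * (1 - c)))"
proof -
  have "(\<lambda>k. (m * c) ^ k /\<^sub>R fact k * exp (- m)) sums (exp (m * c) * exp (- m))"
    by (intro sums_mult2 exp_converges)
  then have s: "(\<lambda>k. pmf (poisson_count m) k * c ^ k) sums (exp (m * c) * exp (- m))"
    by (simp add: pmf_poisson_count assms power_mult_distrib divide_inverse mult_ac)
  have "integrable (count_space UNIV) (\<lambda>k. pmf (poisson_count m) k * c ^ k)"
    unfolding integrable_count_space_nat_iff using sums_summable[OF s] assms
    by (simp add: abs_mult pmf_nonneg)
  then have "(\<integral>k. pmf (poisson_count m) k * c ^ k \<partial>count_space UNIV) = (\<Sum>k. pmf (poisson_count m) k * c ^ k)"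
    by (rule integral_count_space_nat)
  also have "\<dots> = exp (- (m * (1 - c)))"
    unfolding sums_unique[OF s, symmetric] by (simp add: exp_add[symmetric] algebra_simps)
  also have "(\<integral>k. pmf (poisson_count m) k * c ^ k \<partial>count_space UNIV) = (\<integral>k. c ^ k \<partial>measure_pmf (poisson_count m))"
    unfolding measure_pmf_eq_density by (subst integral_density) (auto simp: pmf_nonneg)
  finally show ?thesis .
qed

section \<open>Construction of the Poisson process\<close>

text \<open>Half-open shells about \<open>a\<close>: they partition the space into bounded Borel
  sets, and the first \<open>K\<close> of them make up the ball of radius \<open>K\<close>.\<close>

definition annulus :: "'a::metric_space \<Rightarrow> nat \<Rightarrow> 'a set" where
  "annulus a k = {x. real k \<le> dist a x \<and> dist a x < real k + 1}"

lemma annulus_borel [measurable, simp]: "annulus a k \<in> sets borel"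
proof -
  have "annulus a k = ball a (real k + 1) - ball a (real k)" by (auto simp: annulus_def)
  then show ?thesis by simp
qed

lemma bounded_annulus [simp]: "bounded (annulus a k)"
  by (rule bounded_subset[OF bounded_ball[of a "real k + 1"]]) (auto simp: annulus_def)

lemma sum_indicator_annulus:
  assumes "x \<in> ball a (real K)"
  shows "(\<Sum>k<K. indicator (annulus a k) x) = (1::real)"
proof -
  define k where "k = nat \<lfloor>dist a x\<rfloor>"
  have k: "real k \<le> dist a x" "dist a x < real k + 1" by (simp_all add: k_def of_nat_nat)
  have "k < K" using k(1) assms by simp
  have "indicator (annulus a i) x = (if i = k then 1 else 0 :: real)" for i
    using k by (auto simp: annulus_def indicator_def)
  with \<open>k < K\<close> show ?thesis by simp
qed

text \<open>On a null shell conditioning is impossible, and a point mass stands in; the number of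
  candidates there is almost surely 0.\<close>

definition annulus_law :: "'a::metric_space measure \<Rightarrow> 'a \<Rightarrow> nat \<Rightarrow> 'a measure" where
  "annulus_law \<mu> a k = (if measure \<mu> (annulus a k) = 0 then return borel a
     else density \<mu> (\<lambda>x. ennreal (indicator (annulus a k) x / measure \<mu> (annulus a k))))"

text \<open>The integral formula is stated multiplied by the mass of the shell, so that on a null
  shell it holds with both sides 0.\<close>

lemma
  assumes \<mu>: "boundedly_finite \<mu>"
  shows sets_annulus_law: "sets (annulus_law \<mu> a k) = sets borel"
    and prob_space_annulus_law: "prob_space (annulus_law \<mu> a k)"
    and integral_annulus_law: "f \<in> borel_measurable borel \<Longrightarrow>
      measure \<mu> (annulus a k) * (\<integral>x. f x \<partial>annulus_law \<mu> a k) = (\<integral>x. indicator (annulus a k) x * f x \<partial>\<mu>)"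
proof -
  let ?R = "annulus a k" and ?m = "measure \<mu> (annulus a k)"
  note S = sets_boundedly_finite[OF \<mu>]
  show "sets (annulus_law \<mu> a k) = sets borel" by (simp add: annulus_law_def S)
  have "emeasure \<mu> ?R < \<infinity>"
    using \<mu> annulus_borel bounded_annulus unfolding boundedly_finite_def by blast
  then have fin: "emeasure \<mu> ?R \<noteq> \<infinity>" by simp
  then have em: "emeasure \<mu> ?R = ennreal ?m" by (intro emeasure_eq_ennreal_measure) auto
  have dm: "(\<lambda>x. indicator ?R x / ?m) \<in> borel_measurable \<mu>" by (simp add: S cong: measurable_cong_sets)
  show "prob_space (annulus_law \<mu> a k)"
  proof (cases "?m = 0")
    case True
    then show ?thesis by (simp add: annulus_law_def prob_space_return)
  next
    case False
    then have m: "0 < ?m" by (simp add: zero_less_measure_iff)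
    have "(\<integral>\<^sup>+x. ennreal (indicator ?R x / ?m) \<partial>\<mu>) = (\<integral>\<^sup>+x. ennreal (1 / ?m) * indicator ?R x \<partial>\<mu>)"
      by (intro nn_integral_cong) (auto simp: indicator_def)
    also have "\<dots> = ennreal (1 / ?m) * ennreal ?m"
      using em by (subst nn_integral_cmult_indicator) (simp_all add: S)
    also have "\<dots> = 1" using m by (simp add: ennreal_mult[symmetric])
    finally show ?thesis
      unfolding annulus_law_def using False dm by (auto intro!: prob_spaceI simp: emeasure_density space_boundedly_finite[OF \<mu>] S)
  qed
  assume f: "f \<in> borel_measurable borel"
  show "?m * (\<integral>x. f x \<partial>annulus_law \<mu> a k) = (\<integral>x. indicator ?R x * f x \<partial>\<mu>)"
  proof (cases "?m = 0")
    case True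
    then have "?R \<in> null_sets \<mu>" using em by (simp add: null_sets_def S)
    then have "AE x in \<mu>. indicator ?R x * f x = 0"
      by (rule AE_mp[OF AE_not_in]) (auto simp: indicator_def)
    then have "(\<integral>x. indicator ?R x * f x \<partial>\<mu>) = 0" by (rule integral_eq_zero_AE)
    then show ?thesis by (simp add: True)
  next
    case False
    then have "(\<integral>x. f x \<partial>annulus_law \<mu> a k) = (\<integral>x. (indicator ?R x / ?m) * f x \<partial>\<mu>)"
      unfolding annulus_law_def using f dm by (simp add: integral_density S cong: measurable_cong_sets)
    then have "?m * (\<integral>x. f x \<partial>annulus_law \<mu> a k) = (\<integral>x. ?m * ((indicator ?R x / ?m) * f x) \<partial>\<mu>)" by simp
    also have "\<dots> = (\<integral>x. indicator ?R x * f x \<partial>\<mu>)" using False by simp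
    finally show ?thesis .
  qed
qed

text \<open>The annulus \<open>k\<close> carries a Poisson number of candidate points, each with law \<open>\<mu>\<close> conditioned on the
  annulus; candidate \<open>j\<close> has index \<open>prod_encode (k, j)\<close>. The test \<open>snd (\<omega> k) j \<in> annulus a k\<close> holds almost
  surely, but makes the configuration boundedly finite for every \<open>\<omega>\<close>.\<close>

definition poisson_source :: "'a::metric_space measure \<Rightarrow> 'a \<Rightarrow> nat \<Rightarrow> (nat \<times> (nat \<Rightarrow> 'a)) measure" where
  "poisson_source \<mu> a k = measure_pmf (poisson_count (measure \<mu> (annulus a k))) \<Otimes>\<^sub>M Pi\<^sub>M UNIV (\<lambda>_. annulus_law \<mu> a k)"

definition poisson_index :: "'a::metric_space \<Rightarrow> (nat \<Rightarrow> nat \<times> (nat \<Rightarrow> 'a)) \<Rightarrow> nat set" where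
  "poisson_index a \<omega> = {i. case prod_decode i of (k, j) \<Rightarrow> j < fst (\<omega> k) \<and> snd (\<omega> k) j \<in> annulus a k}"

definition poisson_point :: "(nat \<Rightarrow> nat \<times> (nat \<Rightarrow> 'a::metric_space)) \<Rightarrow> nat \<Rightarrow> 'a" where
  "poisson_point \<omega> i = (case prod_decode i of (k, j) \<Rightarrow> snd (\<omega> k) j)"

text \<open>\<open>undefined\<close> names some fixed point of the space, the common centre of the
  shells.\<close>

definition poisson_law :: "'a::metric_space measure \<Rightarrow> 'a measure measure" where
  "poisson_law \<mu> = (let a = undefined in
     distr (Pi\<^sub>M UNIV (poisson_source \<mu> a)) counting_algebra (\<lambda>\<omega>. dirac_sum (poisson_index a \<omega>) (poisson_point \<omega>)))"

text \<open>A retained candidate of shell \<open>k\<close> has distance at least \<open>k\<close>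
  from \<open>a\<close>, so a ball of radius \<open>K\<close> only meets shells with
  \<open>k < K\<close>, each with finitely many candidates.\<close>

lemma poisson_index_ball_subset:
  "{i \<in> poisson_index a \<omega>. poisson_point \<omega> i \<in> ball a (real K)} \<subseteq> prod_encode ` (SIGMA k:{..<K}. {..<fst (\<omega> k)})"
proof
  fix i assume i: "i \<in> {i \<in> poisson_index a \<omega>. poisson_point \<omega> i \<in> ball a (real K)}"
  obtain k j where kj: "prod_decode i = (k, j)" by force
  then have "i = prod_encode (k, j)" by (metis prod_decode_inverse)
  moreover have "k < K" "j < fst (\<omega> k)"
    using i kj by (auto simp: poisson_index_def poisson_point_def annulus_def)
  ultimately show "i \<in> prod_encode ` (SIGMA k:{..<K}. {..<fst (\<omega> k)})" by blast
qed

lemma bounded_subset_ballE: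
  fixes a :: "'a::metric_space"
  assumes "bounded B"
  obtains K :: nat where "B \<subseteq> ball a (real K)"
proof -
  obtain r where "B \<subseteq> ball a r" using bounded_subset_ballD[OF assms] by blast
  moreover obtain K where "r < real K" using reals_Archimedean2 by blast
  ultimately show ?thesis using that[of K] by fastforce
qed

lemma poisson_configuration_counting_measures:
  "dirac_sum (poisson_index a \<omega>) (poisson_point \<omega>) \<in> counting_measures"
  unfolding dirac_sum_counting_measures_iff
proof (intro ballI impI)
  fix A :: "'a set" assume "bounded A"
  then obtain K where K: "A \<subseteq> ball a (real K)" using bounded_subset_ballE by blast
  have "{i \<in> poisson_index a \<omega>. poisson_point \<omega> i \<in> A} \<subseteq> prod_encode ` (SIGMA k:{..<K}. {..<fst (\<omega> k)})"
    using K poisson_index_ball_subset[of a \<omega> K] by blast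
  then show "finite {i \<in> poisson_index a \<omega>. poisson_point \<omega> i \<in> A}" by (rule finite_subset) auto
qed

lemma integral_poisson_configuration:
  assumes g: "g \<in> bounded_test" and K: "\<And>x. x \<notin> ball a (real K) \<Longrightarrow> g x = 0"
  shows "(\<integral>x. g x \<partial>dirac_sum (poisson_index a \<omega>) (poisson_point \<omega>))
    = (\<Sum>k<K. \<Sum>j<fst (\<omega> k). indicator (annulus a k) (snd (\<omega> k) j) * g (snd (\<omega> k) j))"
proof -
  let ?J = "{i \<in> poisson_index a \<omega>. poisson_point \<omega> i \<in> ball a (real K)}"
  let ?S = "SIGMA k:{..<K}. {..<fst (\<omega> k)}"
  let ?f = "\<lambda>k j. indicator (annulus a k) (snd (\<omega> k) j) * g (snd (\<omega> k) j)"
  have K': "g x \<noteq> 0 \<Longrightarrow> dist a x < real K" for x using K[of x] by auto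
  have "(\<integral>x. g x \<partial>dirac_sum (poisson_index a \<omega>) (poisson_point \<omega>)) = (\<Sum>i\<in>?J. g (poisson_point \<omega> i))"
    using K finite_subset[OF poisson_index_ball_subset]
    by (intro integral_dirac_sum bounded_test_measurable g) auto
  also have "\<dots> = (\<Sum>i\<in>?J. case prod_decode i of (k, j) \<Rightarrow> ?f k j)"
    by (intro sum.cong) (auto simp: poisson_index_def poisson_point_def split: prod.splits)
  \<comment> \<open>The added candidates contribute 0: such a candidate misses its shell, or lies
    outside the ball, where \<open>g\<close> vanishes.\<close>
  also have "\<dots> = (\<Sum>i\<in>prod_encode ` ?S. case prod_decode i of (k, j) \<Rightarrow> ?f k j)"
    using K' by (intro sum.mono_neutral_left poisson_index_ball_subset)
      (auto simp: poisson_index_def poisson_point_def indicator_def split: prod.splits)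
  also have "\<dots> = (\<Sum>(k, j)\<in>?S. ?f k j)"
    by (subst sum.reindex) (auto intro: inj_on_subset[OF inj_prod_encode])
  also have "\<dots> = (\<Sum>k<K. \<Sum>j<fst (\<omega> k). ?f k j)" by (rule sum.Sigma[symmetric]) auto
  finally show ?thesis .
qed

context
  fixes \<mu> :: "'a::metric_space measure" and a :: 'a
  assumes \<mu>: "boundedly_finite \<mu>"
begin

lemma prob_space_annulus_points: "prob_space (Pi\<^sub>M UNIV (\<lambda>_::nat. annulus_law \<mu> a k))"
  by (intro prob_space_PiM prob_space_annulus_law[OF \<mu>])

lemma pair_prob_space_poisson_source:
  "pair_prob_space (measure_pmf (poisson_count m)) (Pi\<^sub>M UNIV (\<lambda>_::nat. annulus_law \<mu> a k))"
  by (intro pair_prob_space.intro pair_sigma_finite.intro prob_space_imp_sigma_finite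
    prob_space_annulus_points measure_pmf.prob_space_axioms)

lemma prob_space_poisson_source: "prob_space (poisson_source \<mu> a k)"
  unfolding poisson_source_def by (rule prob_space_pair[OF measure_pmf.prob_space_axioms prob_space_annulus_points])

lemma poisson_source_measurable:
  "fst \<in> poisson_source \<mu> a k \<rightarrow>\<^sub>M count_space UNIV"
  "(\<lambda>y. snd y j) \<in> poisson_source \<mu> a k \<rightarrow>\<^sub>M borel"
proof -
  have "fst \<in> poisson_source \<mu> a k \<rightarrow>\<^sub>M measure_pmf (poisson_count (measure \<mu> (annulus a k)))"
    unfolding poisson_source_def by (rule measurable_fst)
  then show "fst \<in> poisson_source \<mu> a k \<rightarrow>\<^sub>M count_space UNIV" by (simp cong: measurable_cong_sets)
  have "snd \<in> poisson_source \<mu> a k \<rightarrow>\<^sub>M Pi\<^sub>M UNIV (\<lambda>_::nat. annulus_law \<mu> a k)"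
    unfolding poisson_source_def by (rule measurable_snd)
  moreover have "(\<lambda>f. f j) \<in> Pi\<^sub>M UNIV (\<lambda>_::nat. annulus_law \<mu> a k) \<rightarrow>\<^sub>M annulus_law \<mu> a k"
    by (rule measurable_component_singleton) simp
  ultimately have "(\<lambda>y. snd y j) \<in> poisson_source \<mu> a k \<rightarrow>\<^sub>M annulus_law \<mu> a k"
    by (rule measurable_compose)
  then show "(\<lambda>y. snd y j) \<in> poisson_source \<mu> a k \<rightarrow>\<^sub>M borel"
    by (simp add: sets_annulus_law[OF \<mu>] cong: measurable_cong_sets)
qed

lemma measurable_poisson_configuration:
  "(\<lambda>\<omega>. dirac_sum (poisson_index a \<omega>) (poisson_point \<omega>)) \<in> Pi\<^sub>M UNIV (poisson_source \<mu> a) \<rightarrow>\<^sub>M counting_algebra"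
proof (rule measurable_dirac_sum)
  fix i
  obtain k j where kj: "prod_decode i = (k, j)" by force
  let ?P = "Pi\<^sub>M UNIV (poisson_source \<mu> a)"
  have comp: "(\<lambda>\<omega>. \<omega> k) \<in> ?P \<rightarrow>\<^sub>M poisson_source \<mu> a k" by (rule measurable_component_singleton) simp
  note [measurable] = measurable_compose[OF comp poisson_source_measurable(1)]
    measurable_compose[OF comp poisson_source_measurable(2)[where j=j]]
  show "(\<lambda>\<omega>. poisson_point \<omega> i) \<in> ?P \<rightarrow>\<^sub>M borel" by (simp add: poisson_point_def kj)
  have "{\<omega> \<in> space ?P. j < fst (\<omega> k) \<and> snd (\<omega> k) j \<in> annulus a k} \<in> sets ?P" by measurable
  then show "{\<omega> \<in> space ?P. i \<in> poisson_index a \<omega>} \<in> sets ?P" by (simp add: poisson_index_def kj)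
qed (rule poisson_configuration_counting_measures)

text \<open>Given \<open>n\<close> candidates, independence yields \<open>c ^ n\<close>, where
  \<open>c\<close> is the mean of one factor. The Poisson generating function turns this into
  \<open>exp (- (?m * (1 - c)))\<close>, and \<open>?m\<close> times the conditional law is
  \<open>\<mu>\<close> restricted to the shell.\<close>

lemma integral_poisson_source:
  assumes g: "g \<in> bounded_test"
  shows "(\<integral>y. (\<Prod>j<fst y. exp (- (indicator (annulus a k) (snd y j) * g (snd y j)))) \<partial>poisson_source \<mu> a k)
    = exp (- (\<integral>x. indicator (annulus a k) x * (1 - exp (- g x)) \<partial>\<mu>))"
    and "integrable (poisson_source \<mu> a k) (\<lambda>y. \<Prod>j<fst y. exp (- (indicator (annulus a k) (snd y j) * g (snd y j))))"
proof -
  let ?R = "annulus a k" and ?m = "measure \<mu> (annulus a k)"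
  let ?L = "annulus_law \<mu> a k" and ?W = "poisson_source \<mu> a k"
  let ?e = "\<lambda>x. exp (- (indicator ?R x * g x))"
  let ?F = "\<lambda>y. \<Prod>j<fst y. ?e (snd y j)"
  interpret L: prob_space ?L by (rule prob_space_annulus_law[OF \<mu>])
  interpret W: prob_space ?W by (rule prob_space_poisson_source)
  interpret pair_prob_space "measure_pmf (poisson_count ?m)" "Pi\<^sub>M UNIV (\<lambda>_::nat. annulus_law \<mu> a k)"
    by (rule pair_prob_space_poisson_source)
  have [measurable]: "g \<in> borel_measurable borel" by (rule bounded_test_measurable[OF g])
  have e_meas [measurable]: "?e \<in> borel_measurable borel" by measurable
  have e_bd: "0 \<le> ?e x" "?e x \<le> 1" for x using bounded_test_nonneg[OF g] by auto
  have F_bd: "norm (?F y) \<le> 1" for y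
    using e_bd by (simp add: prod_nonneg abs_of_nonneg prod_le_1)
  have F_meas: "?F \<in> borel_measurable ?W"
  \<comment> \<open>The number of factors is random, so measurability is checked for each of its
    countably many values.\<close>
  proof (rule measurable_compose_countable[OF _ poisson_source_measurable(1)])
    fix n
    show "(\<lambda>y. \<Prod>j<n. ?e (snd y j)) \<in> borel_measurable ?W"
      by (intro borel_measurable_prod measurable_compose[OF poisson_source_measurable(2) e_meas])
  qed
  show int: "integrable ?W ?F"
    by (rule W.integrable_const_bound[OF AE_I2[OF F_bd] F_meas])
  have eL: "?e \<in> borel_measurable ?L" by (simp add: sets_annulus_law[OF \<mu>] cong: measurable_cong_sets)
  have e_int: "integrable ?L ?e" by (rule L.integrable_const_bound[where B=1]) (use e_bd eL in auto)
  define c where "c = (\<integral>x. ?e x \<partial>?L)"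
  have c: "0 \<le> c" "c \<le> 1"
    unfolding c_def using e_bd L.integral_le_const[OF e_int, of 1] by (auto intro!: Bochner_Integration.integral_nonneg)
  have "(\<integral>y. ?F y \<partial>?W) = (\<integral>n. (\<integral>f. (\<Prod>j<n. ?e (f j)) \<partial>Pi\<^sub>M UNIV (\<lambda>_::nat. ?L)) \<partial>measure_pmf (poisson_count ?m))"
    using integral_fst'[of ?F] int by (simp add: poisson_source_def)
  also have "\<dots> = (\<integral>n. c ^ n \<partial>measure_pmf (poisson_count ?m))"
    using integral_PiM_prod[of "\<lambda>_::nat. ?L" "{..<n}" "\<lambda>_. ?e" for n] e_int L.prob_space_axioms by (simp add: c_def)
  also have "\<dots> = exp (- (?m * (1 - c)))" by (rule integral_poisson_count[OF measure_nonneg c])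
  also have "1 - c = (\<integral>x. 1 - ?e x \<partial>?L)" using e_int by (simp add: c_def L.prob_space)
  also have "?m * \<dots> = (\<integral>x. indicator ?R x * (1 - ?e x) \<partial>\<mu>)"
    by (rule integral_annulus_law[OF \<mu>]) measurable
  also have "\<dots> = (\<integral>x. indicator ?R x * (1 - exp (- g x)) \<partial>\<mu>)"
    by (intro Bochner_Integration.integral_cong) (auto simp: indicator_def)
  finally show "(\<integral>y. ?F y \<partial>?W) = exp (- (\<integral>x. indicator ?R x * (1 - exp (- g x)) \<partial>\<mu>))" .
qed

end

lemma counting_law_poisson_law:
  assumes \<mu>: "boundedly_finite \<mu>"
  shows "counting_law (poisson_law \<mu>)"
proof -
  have "prob_space (Pi\<^sub>M UNIV (poisson_source \<mu> undefined))"
    by (intro prob_space_PiM prob_space_poisson_source[OF \<mu>])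
  from prob_space.prob_space_distr[OF this measurable_poisson_configuration[OF \<mu>]]
  show ?thesis by (simp add: counting_law_def counting_law_axioms_def poisson_law_def Let_def)
qed

text \<open>The support of \<open>g\<close> lies in a ball of integer radius \<open>K\<close>, so
  only \<open>K\<close> independent shells contribute. Their exponents add up because the shells
  partition the ball.\<close>

lemma laplace_poisson_law:
  fixes \<mu> :: "'a::metric_space measure"
  assumes \<mu>: "boundedly_finite \<mu>" and g: "g \<in> bounded_test"
  shows "(\<integral>\<nu>. laplace g \<nu> \<partial>poisson_law \<mu>) = exp (- (\<integral>x. 1 - exp (- g x) \<partial>\<mu>))"
proof -
  define a :: 'a where "a = undefined"
  obtain B where "bounded B" and B: "\<And>x. x \<notin> B \<Longrightarrow> g x = 0" using g by (auto simp: bounded_test_def)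
  then obtain K where K: "B \<subseteq> ball a (real K)" using bounded_subset_ballE by blast
  with B have gK: "\<And>x. x \<notin> ball a (real K) \<Longrightarrow> g x = 0" by blast
  have conf: "(\<integral>x. g x \<partial>dirac_sum (poisson_index a \<omega>) (poisson_point \<omega>))
    = (\<Sum>k<K. \<Sum>j<fst (\<omega> k). indicator (annulus a k) (snd (\<omega> k) j) * g (snd (\<omega> k) j))" for \<omega>
    by (rule integral_poisson_configuration[OF g]) (rule gK)
  note u = bounded_test_one_minus_exp[OF g]
  let ?F = "\<lambda>k y. \<Prod>j<fst y. exp (- (indicator (annulus a k) (snd y j) * g (snd y j)))"
  have "(\<integral>\<nu>. laplace g \<nu> \<partial>poisson_law \<mu>)
    = (\<integral>\<omega>. exp (- (\<integral>x. g x \<partial>dirac_sum (poisson_index a \<omega>) (poisson_point \<omega>))) \<partial>Pi\<^sub>M UNIV (poisson_source \<mu> a))"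
    unfolding poisson_law_def Let_def a_def
    by (rule integral_distr[OF measurable_poisson_configuration[OF \<mu>] laplace_measurable[OF g]])
  also have "\<dots> = (\<integral>\<omega>. (\<Prod>k<K. ?F k (\<omega> k)) \<partial>Pi\<^sub>M UNIV (poisson_source \<mu> a))"
    unfolding conf by (simp only: sum_negf[symmetric] exp_sum finite_lessThan)
  also have "\<dots> = (\<Prod>k<K. \<integral>y. ?F k y \<partial>poisson_source \<mu> a k)"
    by (intro integral_PiM_prod prob_space_poisson_source[OF \<mu>] integral_poisson_source(2)[OF \<mu> g]) simp
  also have "\<dots> = (\<Prod>k<K. exp (- (\<integral>x. indicator (annulus a k) x * (1 - exp (- g x)) \<partial>\<mu>)))"
    by (simp add: integral_poisson_source(1)[OF \<mu> g])
  also have "\<dots> = exp (- (\<Sum>k<K. \<integral>x. indicator (annulus a k) x * (1 - exp (- g x)) \<partial>\<mu>))"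
    by (simp add: exp_sum flip: sum_negf)
  also have "(\<Sum>k<K. \<integral>x. indicator (annulus a k) x * (1 - exp (- g x)) \<partial>\<mu>)
    = (\<integral>x. (\<Sum>k<K. indicator (annulus a k) x * (1 - exp (- g x))) \<partial>\<mu>)"
  proof (rule Bochner_Integration.integral_sum[symmetric])
    fix k
    have "integrable \<mu> (\<lambda>x. indicator (annulus a k) x *\<^sub>R (1 - exp (- g x)))"
      by (intro integrable_mult_indicator integrable_bounded_test \<mu> u) (simp add: sets_boundedly_finite[OF \<mu>])
    then show "integrable \<mu> (\<lambda>x. indicator (annulus a k) x * (1 - exp (- g x)))" by simp
  qed
  also have "\<dots> = (\<integral>x. 1 - exp (- g x) \<partial>\<mu>)"
  proof (rule Bochner_Integration.integral_cong[OF refl])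
    fix x
    show "(\<Sum>k<K. indicator (annulus a k) x * (1 - exp (- g x))) = 1 - exp (- g x)"
      using gK[of x] sum_indicator_annulus[of x a K]
      by (cases "x \<in> ball a (real K)") (simp_all flip: sum_distrib_right)
  qed
  finally show ?thesis .
qed

section \<open>Independence and marginals of the Poisson process\<close>

context counting_law
begin

lemma integral_of_bool:
  "(\<integral>\<nu>. of_bool (\<Phi> \<nu>) \<partial>P) = measure P {\<nu> \<in> counting_measures. \<Phi> \<nu>}"
proof -
  have "(\<integral>\<nu>. of_bool (\<Phi> \<nu>) \<partial>P) = (\<integral>\<nu>. indicator {\<nu> \<in> counting_measures. \<Phi> \<nu>} \<nu> \<partial>P)"
    by (intro Bochner_Integration.integral_cong) (auto simp: indicator_def space_P)
  also have "\<dots> = measure P {\<nu> \<in> counting_measures. \<Phi> \<nu>}"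
    by (simp add: space_P Int_absorb2)
  finally show ?thesis .
qed

end

lemma emeasure_eq_of_nat_iff:
  assumes "\<nu> \<in> counting_measures" "A \<in> sets borel" "bounded A"
  shows "emeasure \<nu> A = of_nat j \<longleftrightarrow> measure \<nu> A = real j"
  using counting_measure_natE[OF assms] by (metis of_nat_eq_iff)

lemma count_set_measurable:
  assumes "A \<in> sets borel" "bounded A"
  shows "{\<nu> \<in> counting_measures. measure \<nu> A = real j} \<in> sets counting_algebra"
proof -
  have "laplace_closure bounded_test (\<lambda>\<nu>. of_bool (measure \<nu> A = real j))"
    using assms by (intro laplace_closure_count_eq test_cone_bounded_test indicator_bounded_test)
  then have "laplace_closure bounded_test (indicator {\<nu> \<in> counting_measures. measure \<nu> A = real j})"
    by (rule laplace_closure_cong) (simp add: indicator_def)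
  then show ?thesis
    unfolding sets_counting_algebra_eq_sigma_sets by (intro sigma_sets.Basic) auto
qed

text \<open>The count in \<open>A \<ni> a\<close> has the same Laplace transform as under the law of \<open>K \<delta>\<^sub>a\<close> with \<open>K\<close> Poisson.\<close>

lemma poisson_law_count:
  assumes \<mu>: "boundedly_finite \<mu>" and A: "A \<in> sets borel" "bounded A"
  shows "measure (poisson_law \<mu>) {\<nu> \<in> counting_measures. measure \<nu> A = real j}
    = measure \<mu> A ^ j / fact j * exp (- measure \<mu> A)"
proof (cases "A = {}")
  case True
  interpret Q: counting_law "poisson_law \<mu>" by (rule counting_law_poisson_law[OF \<mu>])
  show ?thesis using True Q.prob_space by (cases "j = 0") (auto simp: Q.space_P)
next
  case False
  \<comment> \<open>The comparison law lives on multiples of a point mass in \<open>A\<close>, which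
    is why the empty set is treated apart.\<close>
  then obtain a where a: "a \<in> A" by blast
  let ?m = "measure \<mu> A" and ?Q = "poisson_law \<mu>"
  let ?d = "\<lambda>k. dirac_sum {..<k::nat} (\<lambda>_. a)"
  \<comment> \<open>The natural multiples of \<open>indicator A\<close> contain 0 and are closed
    under addition, and they test nothing but the count in \<open>A\<close>.\<close>
  define G where "G = {(\<lambda>x. real t * indicator A x) | t. True}"
  have G: "test_cone G"
    unfolding test_cone_def
  proof (intro conjI subsetI ballI)
    fix g assume "g \<in> G"
    then obtain t where "g = (\<lambda>x. real t * indicator A x)" by (auto simp: G_def)
    with A show "g \<in> bounded_test"
      by (auto intro!: bounded_testI[where B=A and C="real t"])
  next
    show "(\<lambda>_. 0) \<in> G" unfolding G_def by (auto intro!: exI[of _ 0])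
  next
    fix f g assume "f \<in> G" "g \<in> G"
    then obtain s t where "f = (\<lambda>x. real s * indicator A x)" "g = (\<lambda>x. real t * indicator A x)"
      by (auto simp: G_def)
    then have "(\<lambda>x. f x + g x) = (\<lambda>x. real (s + t) * indicator A x)" by (auto simp: distrib_right)
    then show "(\<lambda>x. f x + g x) \<in> G" unfolding G_def by blast
  qed
  have d: "?d k \<in> counting_measures" for k
    by (auto simp: dirac_sum_counting_measures_iff)
  have count: "measure (?d k) A = real k" for k
  proof -
    have "emeasure (?d k) A = of_nat k" using a A by (simp add: emeasure_dirac_sum emeasure_count_space lessThan_def)
    then show ?thesis by (simp add: measure_def)
  qed
  define Q' where "Q' = distr (measure_pmf (poisson_count ?m)) counting_algebra ?d"
  have dm: "?d \<in> measure_pmf (poisson_count ?m) \<rightarrow>\<^sub>M counting_algebra"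
    using d by (simp add: measurable_pmf_measure1)
  interpret Q: counting_law ?Q by (rule counting_law_poisson_law[OF \<mu>])
  interpret Q': counting_law Q'
    using measure_pmf.prob_space_distr[OF dm] by (simp add: counting_law_def counting_law_axioms_def Q'_def)
  have "(\<integral>\<nu>. laplace g \<nu> \<partial>?Q) = (\<integral>\<nu>. laplace g \<nu> \<partial>Q')" if g: "g \<in> G" for g
  proof -
    obtain t where t: "g = (\<lambda>x. real t * indicator A x)" using g by (auto simp: G_def)
    have gb: "g \<in> bounded_test" by (rule test_cone_subset[OF G g])
    have "(\<integral>\<nu>. laplace g \<nu> \<partial>?Q) = exp (- (\<integral>x. 1 - exp (- g x) \<partial>\<mu>))"
      by (rule laplace_poisson_law[OF \<mu> gb])
    also have "(\<integral>x. 1 - exp (- g x) \<partial>\<mu>) = (\<integral>x. (1 - exp (- real t)) * indicator A x \<partial>\<mu>)"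
      by (intro Bochner_Integration.integral_cong) (auto simp: t indicator_def)
    also have "\<dots> = ?m * (1 - exp (- real t))"
      using sets_boundedly_finite[OF \<mu>] space_boundedly_finite[OF \<mu>] A by simp
    also have "exp (- (?m * (1 - exp (- real t)))) = (\<integral>k. exp (- real t) ^ k \<partial>measure_pmf (poisson_count ?m))"
      by (rule integral_poisson_count[symmetric]) auto
    also have "\<dots> = (\<integral>k. exp (- (\<integral>x. g x \<partial>?d k)) \<partial>measure_pmf (poisson_count ?m))"
    proof (rule Bochner_Integration.integral_cong[OF refl])
      fix k
      have "(\<integral>x. g x \<partial>?d k) = real k * real t"
        using a by (subst integral_dirac_sum[where J="{..<k}"]) (auto simp: bounded_test_measurable[OF gb], simp add: t)
      then show "exp (- real t) ^ k = exp (- (\<integral>x. g x \<partial>?d k))"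
        by (simp add: exp_of_nat_mult[symmetric])
    qed
    also have "\<dots> = (\<integral>\<nu>. laplace g \<nu> \<partial>Q')"
      unfolding Q'_def by (rule integral_distr[OF dm laplace_measurable[OF gb], symmetric])
    finally show ?thesis .
  qed
  moreover have "laplace_closure G (\<lambda>\<nu>. of_bool (measure \<nu> A = real j))"
    using A by (intro laplace_closure_count_eq G) (auto simp: G_def intro!: exI[of _ 1])
  ultimately have "(\<integral>\<nu>. of_bool (measure \<nu> A = real j) \<partial>?Q) = (\<integral>\<nu>. of_bool (measure \<nu> A = real j) \<partial>Q' :: real)"
    by (rule laplace_closure_unique[OF Q.counting_law_axioms Q'.counting_law_axioms G])
  then have "measure ?Q {\<nu> \<in> counting_measures. measure \<nu> A = real j} = measure Q' {\<nu> \<in> counting_measures. measure \<nu> A = real j}"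
    by (simp only: Q.integral_of_bool Q'.integral_of_bool)
  also have "\<dots> = measure (measure_pmf (poisson_count ?m)) (?d -` {\<nu> \<in> counting_measures. measure \<nu> A = real j} \<inter> UNIV)"
    unfolding Q'_def using measure_distr[OF dm count_set_measurable[OF A]] by simp
  also have "?d -` {\<nu> \<in> counting_measures. measure \<nu> A = real j} \<inter> UNIV = {j}"
    using d count by auto
  also have "measure (measure_pmf (poisson_count ?m)) {j} = ?m ^ j / fact j * exp (- ?m)"
    by (simp add: measure_pmf_single pmf_poisson_count)
  finally show ?thesis .
qed

section \<open>Independence of the counts over disjoint sets\<close>

definition tests_on :: "'a::metric_space set \<Rightarrow> ('a \<Rightarrow> real) set" where
  "tests_on A = {g \<in> bounded_test. \<forall>x. x \<notin> A \<longrightarrow> g x = 0}"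

lemma test_cone_tests_on: "test_cone (tests_on A)"
  by (auto simp: test_cone_def tests_on_def zero_bounded_test bounded_test_add)

lemma laplace_closure_mono:
  assumes "laplace_closure G \<Phi>" "G \<subseteq> H"
  shows "laplace_closure H \<Phi>"
proof -
  have "laplace_span H S" if "laplace_span G S" for S
    using that assms(2) by induction (auto intro: laplace_span.intros)
  with assms(1) show ?thesis unfolding laplace_closure_def by blast
qed

text \<open>At each point one of \<open>g\<close>, \<open>h\<close> vanishes, so
  \<open>1 - exp (- (g + h))\<close> is the sum of \<open>1 - exp (- g)\<close> and
  \<open>1 - exp (- h)\<close>. The exponent of the Poisson functional splits accordingly.\<close>

lemma poisson_law_independent:
  assumes \<mu>: "boundedly_finite \<mu>" and AB: "A \<inter> B = {}"
    and \<Phi>: "laplace_closure (tests_on A) \<Phi>" and \<Psi>: "laplace_closure (tests_on B) \<Psi>"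
  shows "(\<integral>\<nu>. \<Phi> \<nu> * \<Psi> \<nu> \<partial>poisson_law \<mu>) = (\<integral>\<nu>. \<Phi> \<nu> \<partial>poisson_law \<mu>) * (\<integral>\<nu>. \<Psi> \<nu> \<partial>poisson_law \<mu>)"
proof (rule laplace_closure_independent[OF counting_law_poisson_law[OF \<mu>] test_cone_tests_on test_cone_tests_on _ \<Phi> \<Psi>])
  interpret Q: counting_law "poisson_law \<mu>" by (rule counting_law_poisson_law[OF \<mu>])
  fix g h assume gh: "g \<in> tests_on A" "h \<in> tests_on B"
  then have b: "g \<in> bounded_test" "h \<in> bounded_test" by (auto simp: tests_on_def)
  have "(\<integral>\<nu>. laplace g \<nu> * laplace h \<nu> \<partial>poisson_law \<mu>)
    = (\<integral>\<nu>. exp (- (\<integral>x. g x + h x \<partial>\<nu>)) \<partial>poisson_law \<mu>)"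
    by (intro Bochner_Integration.integral_cong refl) (simp add: Q.space_P exp_integral_add b)
  also have "\<dots> = exp (- (\<integral>x. 1 - exp (- (g x + h x)) \<partial>\<mu>))"
    by (rule laplace_poisson_law[OF \<mu> bounded_test_add[OF b]])
  also have "(\<integral>x. 1 - exp (- (g x + h x)) \<partial>\<mu>) = (\<integral>x. (1 - exp (- g x)) + (1 - exp (- h x)) \<partial>\<mu>)"
  proof (rule Bochner_Integration.integral_cong[OF refl])
    fix x
    have "g x = 0 \<or> h x = 0" using gh AB by (auto simp: tests_on_def)
    then show "1 - exp (- (g x + h x)) = (1 - exp (- g x)) + (1 - exp (- h x))" by auto
  qed
  also have "\<dots> = (\<integral>x. 1 - exp (- g x) \<partial>\<mu>) + (\<integral>x. 1 - exp (- h x) \<partial>\<mu>)"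
    by (intro Bochner_Integration.integral_add integrable_bounded_test bounded_test_one_minus_exp b \<mu>)
  finally show "(\<integral>\<nu>. laplace g \<nu> * laplace h \<nu> \<partial>poisson_law \<mu>)
      = (\<integral>\<nu>. laplace g \<nu> \<partial>poisson_law \<mu>) * (\<integral>\<nu>. laplace h \<nu> \<partial>poisson_law \<mu>)"
    by (simp only: laplace_poisson_law[OF \<mu> b(1)] laplace_poisson_law[OF \<mu> b(2)] minus_add_distrib exp_add)
qed

lemma laplace_closure_count_prod:
  assumes "finite J" "\<And>i. i \<in> J \<Longrightarrow> A i \<in> sets borel \<and> bounded (A i)"
  shows "laplace_closure (tests_on (\<Union>i\<in>J. A i)) (\<lambda>\<nu>. \<Prod>i\<in>J. of_bool (measure \<nu> (A i) = real (c i)))"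
  using assms
proof (induction J)
  case empty
  show ?case using laplace_closure_const[OF test_cone_tests_on] by simp
next
  case (insert i J)
  have "laplace_closure (tests_on (A i)) (\<lambda>\<nu>. of_bool (measure \<nu> (A i) = real (c i)))"
    using insert.prems by (intro laplace_closure_count_eq test_cone_tests_on)
      (auto simp: tests_on_def indicator_bounded_test)
  then have 1: "laplace_closure (tests_on (\<Union>i\<in>insert i J. A i)) (\<lambda>\<nu>. of_bool (measure \<nu> (A i) = real (c i)))"
    by (rule laplace_closure_mono) (auto simp: tests_on_def)
  have "laplace_closure (tests_on (\<Union>i\<in>J. A i)) (\<lambda>\<nu>. \<Prod>i\<in>J. of_bool (measure \<nu> (A i) = real (c i)))"
    using insert by auto
  then have 2: "laplace_closure (tests_on (\<Union>i\<in>insert i J. A i)) (\<lambda>\<nu>. \<Prod>i\<in>J. of_bool (measure \<nu> (A i) = real (c i)))"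
    by (rule laplace_closure_mono) (auto simp: tests_on_def)
  show ?case using laplace_closure_mult[OF test_cone_tests_on 1 2] insert.hyps by simp
qed

text \<open>Induction on \<open>J\<close>: the product over the earlier sets lies in the closure of
  tests supported in their union, which is disjoint from the new set.\<close>

lemma poisson_law_count_prod:
  assumes \<mu>: "boundedly_finite \<mu>"
    and J: "finite J" "\<And>i. i \<in> J \<Longrightarrow> A i \<in> sets borel \<and> bounded (A i)" "disjoint_family_on A J"
  shows "(\<integral>\<nu>. (\<Prod>i\<in>J. of_bool (measure \<nu> (A i) = real (c i))) \<partial>poisson_law \<mu>)
    = (\<Prod>i\<in>J. measure (poisson_law \<mu>) {\<nu> \<in> counting_measures. measure \<nu> (A i) = real (c i)})"
  using J
proof (induction J)
  case empty
  interpret Q: counting_law "poisson_law \<mu>" by (rule counting_law_poisson_law[OF \<mu>])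
  show ?case by (simp add: Q.prob_space)
next
  case (insert i J)
  interpret Q: counting_law "poisson_law \<mu>" by (rule counting_law_poisson_law[OF \<mu>])
  let ?f = "\<lambda>i \<nu>. of_bool (measure \<nu> (A i) = real (c i)) :: real"
  have disj: "A i \<inter> (\<Union>i\<in>J. A i) = {}"
  proof -
    have "A i \<inter> A j = {}" if "j \<in> J" for j
      using that insert.hyps by (intro disjoint_family_onD[OF insert.prems(2)]) auto
    then show ?thesis by auto
  qed
  have J: "disjoint_family_on A J"
    using insert.prems(2) by (rule disjoint_family_on_mono[rotated]) auto
  have 1: "laplace_closure (tests_on (A i)) (?f i)"
    using insert.prems by (intro laplace_closure_count_eq test_cone_tests_on)
      (auto simp: tests_on_def indicator_bounded_test)
  have 2: "laplace_closure (tests_on (\<Union>i\<in>J. A i)) (\<lambda>\<nu>. \<Prod>i\<in>J. ?f i \<nu>)"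
    using insert.hyps(1) insert.prems(1) by (intro laplace_closure_count_prod) auto
  have "(\<integral>\<nu>. (\<Prod>i\<in>insert i J. ?f i \<nu>) \<partial>poisson_law \<mu>) = (\<integral>\<nu>. ?f i \<nu> * (\<Prod>i\<in>J. ?f i \<nu>) \<partial>poisson_law \<mu>)"
    using insert.hyps by simp
  also have "\<dots> = (\<integral>\<nu>. ?f i \<nu> \<partial>poisson_law \<mu>) * (\<integral>\<nu>. (\<Prod>i\<in>J. ?f i \<nu>) \<partial>poisson_law \<mu>)"
    by (rule poisson_law_independent[OF \<mu> disj 1 2])
  also have "\<dots> = measure (poisson_law \<mu>) {\<nu> \<in> counting_measures. measure \<nu> (A i) = real (c i)} *
      (\<Prod>i\<in>J. measure (poisson_law \<mu>) {\<nu> \<in> counting_measures. measure \<nu> (A i) = real (c i)})"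
    using insert.IH[OF _ J] insert.prems(1) by (simp only: Q.integral_of_bool) simp
  finally show ?case using insert.hyps by simp
qed

lemma poisson_law_indep_vars:
  assumes \<mu>: "boundedly_finite \<mu>" and I: "finite I"
    and A: "\<And>i. i \<in> I \<Longrightarrow> A i \<in> sets borel \<and> bounded (A i)" "disjoint_family_on A I"
  shows "prob_space.indep_vars (poisson_law \<mu>) (\<lambda>_. borel) (\<lambda>i \<nu>. emeasure \<nu> (A i)) I"
proof -
  interpret Q: counting_law "poisson_law \<mu>" by (rule counting_law_poisson_law[OF \<mu>])
  let ?E = "\<lambda>i j. {\<nu> \<in> counting_measures. measure \<nu> (A i) = real j}"
  \<comment> \<open>Distinct counts of one set exclude each other; adding the empty set makes the
    family stable under intersection.\<close>
  let ?G = "\<lambda>i. insert {} (range (?E i))"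
  have "Q.indep_sets ?G I"
  proof (rule Q.indep_setsI)
    fix i assume "i \<in> I"
    then show "?G i \<subseteq> Q.events" using A count_set_measurable[of "A i"] by (auto simp: Q.sets_P)
  next
    fix S J assume J: "J \<noteq> {}" "J \<subseteq> I" "finite J" and S: "\<forall>j\<in>J. S j \<in> ?G j"
    show "Q.prob (\<Inter>j\<in>J. S j) = (\<Prod>j\<in>J. Q.prob (S j))"
    proof (cases "\<exists>j\<in>J. S j = {}")
      case True
      then have "(\<Inter>j\<in>J. S j) = {}" "(\<Prod>j\<in>J. Q.prob (S j)) = 0" using J by force+
      then show ?thesis by simp
    next
      case False
      with S have "\<forall>j\<in>J. \<exists>c. S j = ?E j c" by blast
      then obtain c where c: "\<And>j. j \<in> J \<Longrightarrow> S j = ?E j (c j)" by metis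
      have "(\<Inter>j\<in>J. S j) = {\<nu> \<in> counting_measures. \<forall>j\<in>J. measure \<nu> (A j) = real (c j)}"
        using c J(1) by auto
      then have "Q.prob (\<Inter>j\<in>J. S j) = (\<integral>\<nu>. of_bool (\<forall>j\<in>J. measure \<nu> (A j) = real (c j)) \<partial>poisson_law \<mu>)"
        by (simp only: Q.integral_of_bool)
      also have "\<dots> = (\<integral>\<nu>. (\<Prod>j\<in>J. of_bool (measure \<nu> (A j) = real (c j))) \<partial>poisson_law \<mu>)"
        using J(3) by (intro Bochner_Integration.integral_cong refl) auto
      also have "\<dots> = (\<Prod>j\<in>J. Q.prob (?E j (c j)))"
        using A J disjoint_family_on_mono[OF J(2) A(2)] by (intro poisson_law_count_prod[OF \<mu>]) auto
      finally show ?thesis using c by simp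
    qed
  qed
  then have "Q.indep_sets (\<lambda>i. sigma_sets (space (poisson_law \<mu>)) (?G i)) I"
    by (rule Q.indep_sets_sigma) (auto simp: Int_stable_def)
  then have "Q.indep_sets (\<lambda>i. {(\<lambda>\<nu>. emeasure \<nu> (A i)) -` B \<inter> space (poisson_law \<mu>) | B. B \<in> sets borel}) I"
  proof (rule Q.indep_sets_mono_sets)
    fix i assume i: "i \<in> I"
    show "{(\<lambda>\<nu>. emeasure \<nu> (A i)) -` B \<inter> space (poisson_law \<mu>) | B. B \<in> sets borel} \<subseteq> sigma_sets (space (poisson_law \<mu>)) (?G i)"
    proof safe
      fix B :: "ennreal set"
      \<comment> \<open>The count of a bounded set is finite, so any preimage is a countable union
        of events with a given natural count.\<close>
      have "(\<lambda>\<nu>. emeasure \<nu> (A i)) -` B \<inter> space (poisson_law \<mu>) = (\<Union>j. if of_nat j \<in> B then ?E i j else {})"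
      proof (intro set_eqI iffI)
        fix \<nu> assume "\<nu> \<in> (\<lambda>\<nu>. emeasure \<nu> (A i)) -` B \<inter> space (poisson_law \<mu>)"
        then have \<nu>: "\<nu> \<in> counting_measures" "emeasure \<nu> (A i) \<in> B" by (auto simp: Q.space_P)
        obtain j :: nat where "emeasure \<nu> (A i) = of_nat j" "measure \<nu> (A i) = real j"
          using counting_measure_natE[OF \<nu>(1)] A(1)[OF i] by blast
        with \<nu> show "\<nu> \<in> (\<Union>j. if of_nat j \<in> B then ?E i j else {})" by auto
      next
        fix \<nu> assume "\<nu> \<in> (\<Union>j. if of_nat j \<in> B then ?E i j else {})"
        then obtain j where "of_nat j \<in> B" "\<nu> \<in> ?E i j" by (auto split: if_splits)
        then show "\<nu> \<in> (\<lambda>\<nu>. emeasure \<nu> (A i)) -` B \<inter> space (poisson_law \<mu>)"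
          using emeasure_eq_of_nat_iff[of \<nu> "A i" j] A(1)[OF i] by (simp add: Q.space_P)
      qed
      also have "\<dots> \<in> sigma_sets (space (poisson_law \<mu>)) (?G i)"
        by (rule sigma_sets.Union) (auto intro: sigma_sets.Basic)
      finally show "(\<lambda>\<nu>. emeasure \<nu> (A i)) -` B \<inter> space (poisson_law \<mu>) \<in> sigma_sets (space (poisson_law \<mu>)) (?G i)" .
    qed
  qed
  moreover have "(\<lambda>\<nu>. emeasure \<nu> (A i)) \<in> borel_measurable (poisson_law \<mu>)" if "i \<in> I" for i
    using measurable_emeasure_counting_algebra[of "A i"] A(1)[OF that]
    unfolding measurable_cong_sets[OF Q.sets_P refl] by blast
  ultimately show ?thesis unfolding Q.indep_vars_def2 by blast
qed

lemma poisson_process_poisson_law: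
  assumes \<mu>: "boundedly_finite \<mu>"
  shows "poisson_process (poisson_law \<mu>) (\<lambda>\<nu>. \<nu>) \<mu>"
proof -
  interpret Q: counting_law "poisson_law \<mu>" by (rule counting_law_poisson_law[OF \<mu>])
  have "point_process (poisson_law \<mu>) (\<lambda>\<nu>. \<nu>)"
    unfolding point_process_def using Q.prob_space_axioms
    by (simp add: measurable_ident_sets[OF Q.sets_P])
  moreover have "measure (poisson_law \<mu>) {\<nu> \<in> space (poisson_law \<mu>). emeasure \<nu> A = of_nat j}
      = measure \<mu> A ^ j / fact j * exp (- measure \<mu> A)" if "A \<in> sets borel" "bounded A" for A j
  proof -
    have "{\<nu> \<in> space (poisson_law \<mu>). emeasure \<nu> A = of_nat j} = {\<nu> \<in> counting_measures. measure \<nu> A = real j}"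
      using emeasure_eq_of_nat_iff[OF _ that] by (auto simp: Q.space_P)
    then show ?thesis using poisson_law_count[OF \<mu> that] by simp
  qed
  ultimately show ?thesis
    unfolding poisson_process_def using poisson_law_indep_vars[OF \<mu> finite_lessThan] by auto
qed

section \<open>Weak convergence from Laplace functionals\<close>

text \<open>The sets that arise when a sequence of basic open sets is made disjoint inside a ball.
  \<open>D = UNIV\<close> gives the remainder after finitely many steps and, with
  \<open>F = {}\<close>, the ball itself; finiteness of \<open>F\<close> keeps the family
  countable.\<close>

definition basis_pieces :: "'a::metric_space \<Rightarrow> 'a set set \<Rightarrow> 'a set set" where
  "basis_pieces a \<D> = (\<lambda>(k, D, F). cball a (real (k::nat)) \<inter> (D - \<Union>F)) `
     (UNIV \<times> insert UNIV \<D> \<times> {F. finite F \<and> F \<subseteq> \<D>})"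

definition count_cylinder :: "('a::metric_space set \<times> nat) set \<Rightarrow> 'a measure set" where
  "count_cylinder T = {\<nu> \<in> counting_measures. \<forall>(A, j)\<in>T. measure \<nu> A = real j}"

definition count_cylinders :: "'a::metric_space set set \<Rightarrow> 'a measure set set" where
  "count_cylinders \<A> = count_cylinder ` {T. finite T \<and> T \<subseteq> \<A> \<times> UNIV}"

lemma countable_basis_pieces:
  assumes "countable \<D>"
  shows "countable (basis_pieces a \<D>)"
  unfolding basis_pieces_def
  by (intro countable_image countable_SIGMA countable_Collect_finite_subset assms) (use assms in auto)

lemma basis_pieces_borel:
  assumes "\<And>D. D \<in> \<D> \<Longrightarrow> open D" "A \<in> basis_pieces a \<D>"
  shows "A \<in> sets borel" "bounded A"
proof -
  obtain k D F where A: "A = cball a (real k) \<inter> (D - \<Union>F)" "D \<in> insert UNIV \<D>" "finite F" "F \<subseteq> \<D>"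
    using assms(2) by (auto simp: basis_pieces_def)
  have "open D" "open (\<Union>F)" using A assms(1) by auto
  then show "A \<in> sets borel" by (simp add: A(1))
  show "bounded A" unfolding A(1) by (rule bounded_subset[OF bounded_cball]) auto
qed

lemma countable_count_cylinders: "countable \<A> \<Longrightarrow> countable (count_cylinders \<A>)"
  unfolding count_cylinders_def
  by (intro countable_image countable_Collect_finite_subset countable_SIGMA) auto

lemma count_cylinders_Int:
  assumes "b \<in> count_cylinders \<A>" "c \<in> count_cylinders \<A>"
  shows "b \<inter> c \<in> count_cylinders \<A>"
proof -
  obtain S T where "b = count_cylinder S" "finite S" "S \<subseteq> \<A> \<times> UNIV" "c = count_cylinder T" "finite T" "T \<subseteq> \<A> \<times> UNIV"
    using assms by (auto simp: count_cylinders_def)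
  then have "b \<inter> c = count_cylinder (S \<union> T)" "finite (S \<union> T)" "S \<union> T \<subseteq> \<A> \<times> UNIV"
    by (auto simp: count_cylinder_def)
  then show ?thesis unfolding count_cylinders_def by blast
qed

lemma counting_measures_count_cylinders: "counting_measures \<in> count_cylinders \<A>"
  unfolding count_cylinders_def by (rule image_eqI[of _ _ "{}"]) (auto simp: count_cylinder_def)

lemma laplace_closure_count_cylinder:
  assumes \<A>: "\<And>A. A \<in> \<A> \<Longrightarrow> A \<in> sets borel \<and> bounded A" and b: "b \<in> count_cylinders \<A>"
  shows "laplace_closure bounded_test (indicator b)"
proof -
  obtain T where T: "b = count_cylinder T" "finite T" "T \<subseteq> \<A> \<times> UNIV"
    using b by (auto simp: count_cylinders_def)
  have "laplace_closure bounded_test (indicator (count_cylinder T))"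
    using T(2,3)
  proof (induction T)
    case empty
    show ?case
      by (rule laplace_closure_cong[OF laplace_closure_const[OF test_cone_bounded_test, of 1]])
        (simp add: count_cylinder_def)
  next
    case (insert t T)
    obtain A j where t: "t = (A, j)" by force
    with insert.prems \<A> have A: "A \<in> sets borel" "bounded A" by auto
    have "laplace_closure bounded_test (indicator (count_cylinder T))" using insert by auto
    from laplace_closure_mult[OF test_cone_bounded_test laplace_closure_count_eq[OF test_cone_bounded_test A indicator_bounded_test[OF A], of j] this]
    show ?case by (rule laplace_closure_cong) (auto simp: t count_cylinder_def indicator_def)
  qed
  then show ?thesis by (simp add: T(1))
qed

lemma test_function_integrable:
  fixes f :: "'a::metric_space \<Rightarrow> real"
  assumes "boundedly_finite \<nu>" "f \<in> test_functions"
  shows "integrable \<nu> f"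
proof -
  have f: "continuous_on UNIV f" "bounded (range f)" "\<exists>B. bounded B \<and> (\<forall>x. x \<notin> B \<longrightarrow> f x = 0)"
    using assms(2) by (auto simp: test_functions_def)
  have m: "f \<in> borel_measurable borel" by (rule borel_measurable_continuous_onI[OF f(1)])
  obtain K where "\<And>x. \<bar>f x\<bar> \<le> K" using f(2) by (force simp: bounded_iff)
  then have "bounded (range (\<lambda>x. \<bar>f x\<bar>))" by (auto simp: bounded_iff)
  then have "(\<lambda>x. \<bar>f x\<bar>) \<in> bounded_test" using f(3) m by (auto simp: bounded_test_def)
  then have "integrable \<nu> (\<lambda>x. \<bar>f x\<bar>)" by (rule integrable_bounded_test[OF assms(1)])
  then show ?thesis
    by (rule Bochner_Integration.integrable_bound)
      (use m in \<open>auto simp: sets_boundedly_finite[OF assms(1)] cong: measurable_cong_sets\<close>)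
qed

text \<open>If \<open>s\<close> is a step function on a partition into pieces on which \<open>f\<close> oscillates little, then
  prescribing the counts of the pieces prescribes \<open>\<integral> s d\<nu>\<close>. Since \<open>\<nu>\<^sub>0\<close> has finitely many points in
  a ball, finitely many pieces suffice.\<close>

lemma count_cylinder_controls_integral:
  fixes f :: "'a::metric_space \<Rightarrow> real"
  assumes \<D>: "countable \<D>" "topological_basis \<D>"
    and f: "f \<in> test_functions" and \<nu>0: "\<nu>0 \<in> counting_measures" and e: "0 < e"
  shows "\<exists>b\<in>count_cylinders (basis_pieces a \<D>). \<nu>0 \<in> b \<and> (\<forall>\<nu>\<in>b. \<bar>(\<integral>x. f x \<partial>\<nu>) - (\<integral>x. f x \<partial>\<nu>0)\<bar> < e)"
proof -
  have op: "D \<in> \<D> \<Longrightarrow> open D" for D using \<D>(2) topological_basis_open by blast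
  have fc: "continuous_on UNIV f" using f by (simp add: test_functions_def)
  obtain B where B: "bounded B" "\<And>x. x \<notin> B \<Longrightarrow> f x = 0" using f by (auto simp: test_functions_def)
  obtain k where "B \<subseteq> ball a (real k)" using bounded_subset_ballE[OF B(1)] by blast
  define R where "R = cball a (real k)"
  have R: "R \<in> sets borel" "bounded R" by (auto simp: R_def)
  have "ball a (real k) \<subseteq> R" by (auto simp: R_def)
  then have fR: "f x = 0" if "x \<notin> R" for x
    using B(2)[of x] that \<open>B \<subseteq> ball a (real k)\<close> by blast
  \<comment> \<open>Both measures have the same count in \<open>R\<close>, so the total error is at
    most twice \<open>d * measure \<nu>0 R\<close>, which is less than \<open>e\<close>. The added 1
    covers the case of no points in \<open>R\<close>.\<close>
  define d where "d = e / (2 * (measure \<nu>0 R + 1))"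
  have d: "0 < d" using e by (simp add: d_def add_nonneg_pos)
  define \<D>' where "\<D>' = {D \<in> \<D>. \<forall>x\<in>D. \<forall>y\<in>D. \<bar>f x - f y\<bar> \<le> d}"
  have cov: "\<exists>D\<in>\<D>'. x \<in> D" for x
  proof -
    let ?V = "f -` ball (f x) (d / 2)"
    have "open ?V" using fc by (intro open_vimage) auto
    moreover have "x \<in> ?V" using d by simp
    ultimately obtain D where D: "D \<in> \<D>" "x \<in> D" "D \<subseteq> ?V" using topological_basisE[OF \<D>(2)] by metis
    have "\<bar>f y - f z\<bar> \<le> d" if "y \<in> D" "z \<in> D" for y z
    proof -
      have "\<bar>f x - f y\<bar> < d / 2" "\<bar>f x - f z\<bar> < d / 2" using that D(3) by (auto simp: dist_real_def)
      then show ?thesis by linarith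
    qed
    with D show ?thesis by (auto simp: \<D>'_def)
  qed
  have ne: "\<D>' \<noteq> {}" using cov[of a] by auto
  have "countable \<D>'" using \<D>(1) by (simp add: \<D>'_def)
  define D where "D = from_nat_into \<D>'"
  have D: "D i \<in> \<D>'" for i unfolding D_def by (rule from_nat_into[OF ne])
  then have DD: "D i \<in> \<D>" for i by (simp add: \<D>'_def)
  have osc: "\<bar>f x - f y\<bar> \<le> d" if "x \<in> D i" "y \<in> D i" for i x y using D[of i] that by (auto simp: \<D>'_def)
  have covD: "\<exists>i. x \<in> D i" for x
    using cov[of x] range_from_nat_into[OF ne \<open>countable \<D>'\<close>] by (metis D_def imageE)
  define E where "E m = R - (\<Union>i<m. D i)" for m
  define C where "C i = R \<inter> (D i - (\<Union>l<i. D l))" for i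
  have piece: "R \<inter> (X - \<Union>F) \<in> basis_pieces a \<D>" if "X \<in> insert UNIV \<D>" "finite F" "F \<subseteq> \<D>" for X F
    unfolding basis_pieces_def R_def using that by (intro image_eqI[of _ _ "(k, X, F)"]) auto
  have E_piece: "E m \<in> basis_pieces a \<D>" for m
  proof -
    have "E m = R \<inter> (UNIV - \<Union>(D ` {..<m}))" by (auto simp: E_def)
    also have "\<dots> \<in> basis_pieces a \<D>" using DD by (intro piece) auto
    finally show ?thesis .
  qed
  have R_piece: "R \<in> basis_pieces a \<D>" using piece[of UNIV "{}"] by simp
  have C_piece: "C i \<in> basis_pieces a \<D>" for i unfolding C_def using DD by (intro piece) auto
  note pb = basis_pieces_borel[OF op]
  have Eb: "E m \<in> sets borel" "bounded (E m)" for m using pb[OF _ E_piece] by auto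
  have Cb: "C i \<in> sets borel" "bounded (C i)" for i using pb[OF _ C_piece] by auto
  have fin: "emeasure \<nu>0 (E m) \<noteq> \<infinity>" for m
    using \<nu>0 Eb[of m] by (auto simp: counting_measures_def boundedly_finite_def)
  have "(\<lambda>m. measure \<nu>0 (E m)) \<longlonglongrightarrow> measure \<nu>0 (\<Inter>m. E m)"
    using Eb fin by (intro Lim_measure_decseq) (auto simp: sets_counting_measures[OF \<nu>0] decseq_def E_def)
  moreover have "(\<Inter>m. E m) = {}" using covD unfolding E_def by blast
  ultimately have "(\<lambda>m. measure \<nu>0 (E m)) \<longlonglongrightarrow> 0" by simp
  then have "\<forall>\<^sub>F m in sequentially. measure \<nu>0 (E m) < 1" by (rule order_tendstoD) simp
  then obtain m where "measure \<nu>0 (E m) < 1" by (auto simp: eventually_sequentially)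
  \<comment> \<open>A natural number below 1 is 0: from some stage on, the remainder contains no
    point of \<open>\<nu>0\<close>.\<close>
  then have E0: "measure \<nu>0 (E m) = 0"
    using counting_measure_natE[OF \<nu>0, of "E m"] Eb[of m] by (metis less_one of_nat_0 of_nat_1 of_nat_less_iff)
  define cnt where "cnt A = nat \<lfloor>measure \<nu>0 A\<rfloor>" for A
  have cnt: "measure \<nu>0 A = real (cnt A)" if A: "A \<in> basis_pieces a \<D>" for A
  proof -
    obtain n :: nat where "measure \<nu>0 A = real n"
      using counting_measure_natE[OF \<nu>0 pb(1)[OF _ A] pb(2)[OF _ A]] by blast
    then show ?thesis by (simp add: cnt_def)
  qed
  \<comment> \<open>The counts of the \<open>C i\<close> determine the integral of the step
    function, the count 0 of \<open>E m\<close> makes the remainder null for every measure in the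
    cylinder, and the count of \<open>R\<close> bounds the error.\<close>
  define T where "T = (\<lambda>A. (A, cnt A)) ` ({R, E m} \<union> C ` {..<m})"
  have bT: "count_cylinder T \<in> count_cylinders (basis_pieces a \<D>)"
    unfolding count_cylinders_def T_def using R_piece E_piece C_piece by (intro imageI) auto
  have \<nu>0T: "\<nu>0 \<in> count_cylinder T"
    using \<nu>0 cnt R_piece E_piece C_piece by (auto simp: count_cylinder_def T_def)
  \<comment> \<open>If \<open>D i\<close> is empty then so is \<open>C i\<close>, and the arbitrary
    value \<open>f (c i)\<close> has weight 0.\<close>
  define c where "c i = (SOME x. x \<in> D i)" for i
  define s where "s x = (\<Sum>i<m. f (c i) * indicator (C i) x)" for x
  have approx: "\<bar>f x - s x\<bar> \<le> d * indicator R x" if x: "x \<notin> E m" for x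
  proof (cases "x \<in> R")
    case False
    then have "s x = 0" by (auto simp: s_def C_def)
    with False fR show ?thesis by simp
  next
    case True
    with x have ex: "\<exists>i. x \<in> D i" and "\<exists>i<m. x \<in> D i" by (auto simp: E_def)
    define i where "i = (LEAST i. x \<in> D i)"
    have i: "x \<in> D i" unfolding i_def by (rule LeastI_ex[OF ex])
    have least: "x \<notin> D l" if "l < i" for l using that not_less_Least unfolding i_def by blast
    have "i < m" using \<open>\<exists>i<m. x \<in> D i\<close> least by (metis linorder_neqE_nat order.strict_trans)
    have "indicator (C l) x = (if l = i then 1 else 0 :: real)" for l
      using True i least by (cases "l < i"; cases "l = i") (auto simp: C_def indicator_def)
    with \<open>i < m\<close> have "s x = f (c i)" by (simp add: s_def mult_delta_right)
    moreover have "c i \<in> D i" unfolding c_def using i by (rule someI)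
    ultimately show ?thesis using osc[OF i] True by simp
  qed
  have int_s: "(\<integral>x. s x \<partial>\<nu>) = (\<Sum>i<m. f (c i) * measure \<nu> (C i))"
    and close: "\<bar>(\<integral>x. f x \<partial>\<nu>) - (\<integral>x. s x \<partial>\<nu>)\<bar> \<le> d * measure \<nu> R"
    if \<nu>T: "\<nu> \<in> count_cylinder T" for \<nu>
  proof -
    have \<nu>: "\<nu> \<in> counting_measures" using \<nu>T by (simp add: count_cylinder_def)
    note bf = counting_measures_boundedly_finite[OF \<nu>] and sets = sets_counting_measures[OF \<nu>]
    have ind: "integrable \<nu> (indicator A :: _ \<Rightarrow> real)" if "A \<in> sets borel" "bounded A" for A
      by (rule integrable_bounded_test[OF bf indicator_bounded_test[OF that]])
    have int: "integrable \<nu> (\<lambda>x. f (c i) * indicator (C i) x)" for i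
      by (intro integrable_mult_right ind Cb)
    show "(\<integral>x. s x \<partial>\<nu>) = (\<Sum>i<m. f (c i) * measure \<nu> (C i))"
      unfolding s_def using int space_counting_measures[OF \<nu>] by (subst Bochner_Integration.integral_sum) auto
    have i_s: "integrable \<nu> s" unfolding s_def using int by (intro Bochner_Integration.integrable_sum) auto
    have i_f: "integrable \<nu> f" by (rule test_function_integrable[OF bf f])
    have i_R: "integrable \<nu> (\<lambda>x. d * indicator R x)" by (intro integrable_mult_right ind R)
    have "measure \<nu> (E m) = 0" using \<nu>T E0 by (auto simp: count_cylinder_def T_def cnt_def)
    then have "emeasure \<nu> (E m) = of_nat 0"
      using emeasure_eq_of_nat_iff[OF \<nu>, of "E m" 0] Eb[of m] op by auto
    then have "E m \<in> null_sets \<nu>" using Eb[of m] op by (auto intro!: null_setsI simp: sets)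
    then have "AE x in \<nu>. \<bar>f x - s x\<bar> \<le> d * indicator R x"
      by (rule AE_mp[OF AE_not_in]) (use approx in auto)
    then have "(\<integral>x. \<bar>f x - s x\<bar> \<partial>\<nu>) \<le> (\<integral>x. d * indicator R x \<partial>\<nu>)"
      using i_f i_s i_R by (intro integral_mono_AE) auto
    also have "\<dots> = d * measure \<nu> R" using space_counting_measures[OF \<nu>] by simp
    finally have "(\<integral>x. \<bar>f x - s x\<bar> \<partial>\<nu>) \<le> d * measure \<nu> R" .
    moreover have "\<bar>(\<integral>x. f x \<partial>\<nu>) - (\<integral>x. s x \<partial>\<nu>)\<bar> \<le> (\<integral>x. \<bar>f x - s x\<bar> \<partial>\<nu>)"
      using integral_abs_bound[of \<nu> "\<lambda>x. f x - s x"] i_f i_s by simp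
    ultimately show "\<bar>(\<integral>x. f x \<partial>\<nu>) - (\<integral>x. s x \<partial>\<nu>)\<bar> \<le> d * measure \<nu> R" by linarith
  qed
  have "\<bar>(\<integral>x. f x \<partial>\<nu>) - (\<integral>x. f x \<partial>\<nu>0)\<bar> < e" if \<nu>T: "\<nu> \<in> count_cylinder T" for \<nu>
  proof -
    have eqT: "measure \<nu> A = measure \<nu>0 A" if "A \<in> {R, E m} \<union> C ` {..<m}" for A
      using \<nu>T \<nu>0T that unfolding count_cylinder_def T_def by force
    have "(\<integral>x. s x \<partial>\<nu>) = (\<integral>x. s x \<partial>\<nu>0)"
      unfolding int_s[OF \<nu>T] int_s[OF \<nu>0T] using eqT by (intro sum.cong) auto
    then have "\<bar>(\<integral>x. f x \<partial>\<nu>) - (\<integral>x. f x \<partial>\<nu>0)\<bar> \<le> 2 * (d * measure \<nu>0 R)"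
      using close[OF \<nu>T] close[OF \<nu>0T] eqT[of R] by simp
    also have "\<dots> < 2 * (d * (measure \<nu>0 R + 1))" using d by simp
    also have "\<dots> = e"
      unfolding d_def using measure_nonneg[of \<nu>0 R] by (simp add: field_simps add_nonneg_eq_0_iff)
    finally show ?thesis .
  qed
  with bT \<nu>0T show ?thesis by blast
qed

section \<open>Cylinders and the vague topology\<close>

lemma topspace_vague_topology: "topspace vague_topology = (counting_measures :: 'a::metric_space measure set)"
proof -
  have "(\<lambda>_. 0) \<in> (test_functions :: ('a \<Rightarrow> real) set)"
    by (auto simp: test_functions_def intro!: exI[of _ "{}"])
  then have "\<exists>f U. (counting_measures :: 'a measure set) = {\<nu> \<in> counting_measures. (\<integral>x. f x \<partial>\<nu>) \<in> U} \<and> f \<in> test_functions \<and> open U"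
    by (intro exI[of _ "\<lambda>_. 0"] exI[of _ UNIV]) auto
  then have "(counting_measures :: 'a measure set) \<in> {{\<nu> \<in> counting_measures. (\<integral>x. f x \<partial>\<nu>) \<in> U} | f U. f \<in> test_functions \<and> open U}"
    by blast
  then show ?thesis unfolding vague_topology_def topology_generated_by_topspace by blast
qed

text \<open>The cylinders form a countable network rather than a base, since they need not be
  vaguely open. For subbasic sets this is \<open>count_cylinder_controls_integral\<close>; stability
  under intersection handles the finite intersections.\<close>

lemma count_cylinder_basis:
  fixes U :: "'a::metric_space measure set"
  assumes \<D>: "countable \<D>" "topological_basis \<D>"
    and U: "openin vague_topology U" and \<nu>: "\<nu> \<in> U"
  shows "\<exists>b\<in>count_cylinders (basis_pieces a \<D>). \<nu> \<in> b \<and> b \<subseteq> U"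
proof -
  have "generate_topology_on {{\<nu> \<in> counting_measures. (\<integral>x. f x \<partial>\<nu>) \<in> V} | f V. f \<in> test_functions \<and> open V} U"
    using U by (simp add: vague_topology_def openin_topology_generated_by_iff)
  then show ?thesis using \<nu>
  proof (induction arbitrary: \<nu> rule: generate_topology_on.induct)
    case (Int U V)
    then obtain b c where "b \<in> count_cylinders (basis_pieces a \<D>)" "\<nu> \<in> b" "b \<subseteq> U"
      "c \<in> count_cylinders (basis_pieces a \<D>)" "\<nu> \<in> c" "c \<subseteq> V" by blast
    then show ?case by (intro bexI[of _ "b \<inter> c"] count_cylinders_Int) auto
  next
    case (UN K)
    then show ?case by (meson Union_iff Union_upper order_trans)
  next
    case (Basis S)
    then obtain f V where S: "S = {\<nu> \<in> counting_measures. (\<integral>x. f x \<partial>\<nu>) \<in> V}" "f \<in> test_functions" "open V" by auto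
    with Basis.prems have \<nu>: "\<nu> \<in> counting_measures" "(\<integral>x. f x \<partial>\<nu>) \<in> V" by auto
    obtain e where e: "0 < e" "ball (\<integral>x. f x \<partial>\<nu>) e \<subseteq> V" using S(3) \<nu>(2) openE by blast
    obtain b where b: "b \<in> count_cylinders (basis_pieces a \<D>)" "\<nu> \<in> b"
      "\<forall>\<nu>'\<in>b. \<bar>(\<integral>x. f x \<partial>\<nu>') - (\<integral>x. f x \<partial>\<nu>)\<bar> < e"
      using count_cylinder_controls_integral[OF \<D> S(2) \<nu>(1) e(1)] by blast
    have "b \<subseteq> S"
    proof
      fix \<nu>' assume \<nu>': "\<nu>' \<in> b"
      with b(1) have "\<nu>' \<in> counting_measures" by (auto simp: count_cylinders_def count_cylinder_def)
      moreover have "(\<integral>x. f x \<partial>\<nu>') \<in> V"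
        using e(2) b(3) \<nu>' by (auto simp: dist_real_def abs_minus_commute)
      ultimately show "\<nu>' \<in> S" by (simp add: S(1))
    qed
    with b show ?case by blast
  qed auto
qed

text \<open>A nonnegative vaguely continuous function is the supremum of its minorants \<open>q \<cdot> 1\<^sub>b\<close> with \<open>q\<close> rational
  and \<open>b\<close> in the countable family of cylinders.\<close>

lemma vague_continuous_increasing_limit:
  fixes F :: "'a::{metric_space, second_countable_topology} measure \<Rightarrow> real"
  assumes F: "continuous_map vague_topology euclideanreal F"
    and nonneg: "\<And>\<nu>. \<nu> \<in> counting_measures \<Longrightarrow> 0 \<le> F \<nu>"
  obtains h where "\<And>k::nat. laplace_closure bounded_test (h k)"
    "\<And>k \<nu>. \<nu> \<in> counting_measures \<Longrightarrow> 0 \<le> h k \<nu> \<and> h k \<nu> \<le> F \<nu>"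
    "\<And>\<nu>. \<nu> \<in> counting_measures \<Longrightarrow> (\<lambda>k. h k \<nu>) \<longlonglongrightarrow> F \<nu>"
proof -
  obtain \<D> :: "'a set set" where \<D>: "countable \<D>" "topological_basis \<D>" using ex_countable_basis by blast
  define \<B> where "\<B> = count_cylinders (basis_pieces undefined \<D>)"
  have op: "D \<in> \<D> \<Longrightarrow> open D" for D using \<D>(2) topological_basis_open by blast
  have \<B>_closure: "laplace_closure bounded_test (indicator b)" if "b \<in> \<B>" for b
    using that basis_pieces_borel[OF op] unfolding \<B>_def by (intro laplace_closure_count_cylinder) auto
  have "countable \<B>" unfolding \<B>_def by (intro countable_count_cylinders countable_basis_pieces \<D>)
  define Q where "Q = {(b, q). b \<in> \<B> \<and> q \<in> \<rat> \<and> 0 \<le> q \<and> (\<forall>\<nu>\<in>b. q \<le> F \<nu>)}"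
  have "Q \<subseteq> \<B> \<times> \<rat>" by (auto simp: Q_def)
  then have cQ: "countable Q" using \<open>countable \<B>\<close> countable_rat by (meson countable_SIGMA countable_subset)
  have zero: "(counting_measures, 0) \<in> Q"
    using nonneg by (auto simp: Q_def \<B>_def counting_measures_count_cylinders)
  then have ne: "Q \<noteq> {}" by blast
  define p where "p = from_nat_into Q"
  have p: "p i \<in> Q" for i unfolding p_def by (rule from_nat_into[OF ne])
  have p_onto: "\<exists>i. p i = t" if "t \<in> Q" for t
    using that range_from_nat_into[OF ne cQ] by (metis p_def imageE)
  define h where "h = rec_nat (\<lambda>_. 0) (\<lambda>i g \<nu>. max (g \<nu>) (snd (p i) * indicator (fst (p i)) \<nu>))"
  have h_0: "h 0 = (\<lambda>_. 0)" and h_Suc: "h (Suc i) = (\<lambda>\<nu>. max (h i \<nu>) (snd (p i) * indicator (fst (p i)) \<nu>))" for i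
    by (simp_all add: h_def)
  have closure: "laplace_closure bounded_test (h k)" for k
  proof (induction k)
    case 0
    show ?case unfolding h_0 by (rule laplace_closure_const[OF test_cone_bounded_test])
  next
    case (Suc k)
    have "fst (p k) \<in> \<B>" using p[of k] by (auto simp: Q_def split: prod.splits)
    with Suc show ?case unfolding h_Suc
      by (intro laplace_closure_max laplace_closure_scale test_cone_bounded_test \<B>_closure)
  qed
  have bounds: "0 \<le> h k \<nu> \<and> h k \<nu> \<le> F \<nu>" if \<nu>: "\<nu> \<in> counting_measures" for k \<nu>
  proof (induction k)
    case 0
    show ?case using nonneg[OF \<nu>] by (simp add: h_0)
  next
    case (Suc k)
    have "snd (p k) * indicator (fst (p k)) \<nu> \<le> F \<nu>"
      using p[of k] nonneg[OF \<nu>] by (auto simp: Q_def indicator_def)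
    with Suc show ?case by (auto simp: h_Suc)
  qed
  have limit: "(\<lambda>k. h k \<nu>) \<longlonglongrightarrow> F \<nu>" if \<nu>: "\<nu> \<in> counting_measures" for \<nu>
  proof (rule increasing_LIMSEQ)
    show "h k \<nu> \<le> h (Suc k) \<nu>" for k by (simp add: h_Suc)
    show "h k \<nu> \<le> F \<nu>" for k using bounds[OF \<nu>] by blast
    fix e :: real assume e: "0 < e"
    show "\<exists>k. F \<nu> \<le> h k \<nu> + e"
    proof (cases "F \<nu> \<le> e")
      case True
      then show ?thesis by (intro exI[of _ 0]) (simp add: h_0)
    next
      case False
      \<comment> \<open>In this case \<open>F \<nu> - e\<close> is nonnegative, so \<open>q\<close>
        is too, as membership in \<open>Q\<close> requires.\<close>
      obtain q where q: "q \<in> \<rat>" "F \<nu> - e < q" "q < F \<nu>" using Rats_dense_in_real[of "F \<nu> - e" "F \<nu>"] e by auto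
      let ?U = "{\<nu> \<in> topspace vague_topology. F \<nu> \<in> {q<..}}"
      have "openin vague_topology ?U" by (rule openin_continuous_map_preimage[OF F]) simp
      moreover have "\<nu> \<in> ?U" using \<nu> q by (simp add: topspace_vague_topology)
      ultimately obtain b where b: "b \<in> \<B>" "\<nu> \<in> b" "b \<subseteq> ?U"
        using count_cylinder_basis[OF \<D>] unfolding \<B>_def by blast
      have "(b, q) \<in> Q" using b q False by (auto simp: Q_def less_imp_le)
      then obtain i where "p i = (b, q)" using p_onto by blast
      then have "q \<le> h (Suc i) \<nu>" using b(2) by (simp add: h_Suc)
      then show ?thesis using q by (intro exI[of _ "Suc i"]) linarith
    qed
  qed
  show ?thesis using that[of h] closure bounds limit by blast
qed

text \<open>Links the topology to the sigma-algebra: a nonnegative vaguely continuous function is a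
  pointwise limit of functions in the closure, all of which are measurable.\<close>

lemma vague_continuous_measurable:
  fixes F :: "'a::{metric_space, second_countable_topology} measure \<Rightarrow> real"
  assumes F: "continuous_map vague_topology euclideanreal F"
    and nonneg: "\<And>\<nu>. \<nu> \<in> counting_measures \<Longrightarrow> 0 \<le> F \<nu>"
  shows "F \<in> borel_measurable counting_algebra"
proof -
  obtain h where h: "\<And>k::nat. laplace_closure bounded_test (h k)"
    "\<And>k \<nu>. \<nu> \<in> counting_measures \<Longrightarrow> 0 \<le> h k \<nu> \<and> h k \<nu> \<le> F \<nu>"
    "\<And>\<nu>. \<nu> \<in> counting_measures \<Longrightarrow> (\<lambda>k. h k \<nu>) \<longlonglongrightarrow> F \<nu>"
    by (rule vague_continuous_increasing_limit[OF F nonneg]) (assumption, rule that)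
  show ?thesis
    by (rule borel_measurable_LIMSEQ_metric[where f=h, OF laplace_closure_measurable[OF test_cone_bounded_test h(1)]])
      (simp add: h(3))
qed

text \<open>A single minorant \<open>h k\<close>, within \<open>e / 2\<close> of \<open>F\<close> in
  mean under \<open>Q\<close>, suffices: its integrals converge, and under each \<open>P n\<close>
  the inequality \<open>h k \<le> F\<close> is enough.\<close>

lemma liminf_integral_vague_continuous:
  fixes F :: "'a::{metric_space, second_countable_topology} measure \<Rightarrow> real"
  assumes P: "\<And>n. counting_law (P n)" and Q: "counting_law Q"
    and conv: "\<And>\<Phi>. laplace_closure bounded_test \<Phi> \<Longrightarrow> (\<lambda>n. \<integral>\<nu>. \<Phi> \<nu> \<partial>P n) \<longlonglongrightarrow> (\<integral>\<nu>. \<Phi> \<nu> \<partial>Q)"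
    and F: "continuous_map vague_topology euclideanreal F"
    and bounds: "\<And>\<nu>. \<nu> \<in> counting_measures \<Longrightarrow> 0 \<le> F \<nu> \<and> F \<nu> \<le> K"
    and e: "0 < e"
  shows "\<forall>\<^sub>F n in sequentially. (\<integral>\<nu>. F \<nu> \<partial>Q) - e < (\<integral>\<nu>. F \<nu> \<partial>P n)"
proof -
  interpret Q: counting_law Q by fact
  have nonneg: "\<And>\<nu>. \<nu> \<in> counting_measures \<Longrightarrow> 0 \<le> F \<nu>" using bounds by blast
  obtain h where h: "\<And>k::nat. laplace_closure bounded_test (h k)"
    "\<And>k \<nu>. \<nu> \<in> counting_measures \<Longrightarrow> 0 \<le> h k \<nu> \<and> h k \<nu> \<le> F \<nu>"
    "\<And>\<nu>. \<nu> \<in> counting_measures \<Longrightarrow> (\<lambda>k. h k \<nu>) \<longlonglongrightarrow> F \<nu>"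
    by (rule vague_continuous_increasing_limit[OF F nonneg]) (assumption, rule that)
  have Fm: "F \<in> borel_measurable counting_algebra" by (rule vague_continuous_measurable[OF F nonneg])
  note hm = laplace_closure_measurable[OF test_cone_bounded_test h(1)]
  have "(\<lambda>k. \<integral>\<nu>. h k \<nu> \<partial>Q) \<longlonglongrightarrow> (\<integral>\<nu>. F \<nu> \<partial>Q)"
  proof (rule Q.integral_tendsto_bounded[OF hm Fm])
    show "\<bar>h k \<nu>\<bar> \<le> K" if "\<nu> \<in> counting_measures" for k \<nu> using h(2)[OF that, of k] bounds[OF that] by linarith
  qed (rule h(3))
  moreover have "(\<integral>\<nu>. F \<nu> \<partial>Q) - e / 2 < (\<integral>\<nu>. F \<nu> \<partial>Q)" using e by simp
  ultimately have "\<forall>\<^sub>F k in sequentially. (\<integral>\<nu>. F \<nu> \<partial>Q) - e / 2 < (\<integral>\<nu>. h k \<nu> \<partial>Q)" by (rule order_tendstoD(1))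
  then obtain k where k: "(\<integral>\<nu>. F \<nu> \<partial>Q) - e / 2 < (\<integral>\<nu>. h k \<nu> \<partial>Q)" by (auto simp: eventually_sequentially)
  have "(\<integral>\<nu>. h k \<nu> \<partial>Q) - e / 2 < (\<integral>\<nu>. h k \<nu> \<partial>Q)" using e by simp
  with conv[OF h(1)] have "\<forall>\<^sub>F n in sequentially. (\<integral>\<nu>. h k \<nu> \<partial>Q) - e / 2 < (\<integral>\<nu>. h k \<nu> \<partial>P n)"
    by (rule order_tendstoD(1))
  then show ?thesis
  proof eventually_elim
    case (elim n)
    interpret P: counting_law "P n" by (rule P)
    have "(\<integral>\<nu>. h k \<nu> \<partial>P n) \<le> (\<integral>\<nu>. F \<nu> \<partial>P n)"
    proof (rule integral_mono)
      show "integrable (P n) (h k)" by (rule P.integrable_laplace_closure[OF test_cone_bounded_test h(1)])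
      show "integrable (P n) F"
        by (rule P.integrable_bounded[OF Fm, of K]) (use bounds in \<open>auto simp: abs_of_nonneg\<close>)
      show "h k \<nu> \<le> F \<nu>" if "\<nu> \<in> space (P n)" for \<nu> using h(2)[of \<nu> k] that by (simp add: P.space_P)
    qed
    with elim k show ?case by linarith
  qed
qed

lemma weakly_converges_laplace:
  fixes P :: "nat \<Rightarrow> 'a::{metric_space, second_countable_topology} measure measure"
  assumes P: "\<And>n. counting_law (P n)" and Q: "counting_law Q"
    and conv: "\<And>g. g \<in> bounded_test \<Longrightarrow>
      (\<lambda>n. \<integral>\<nu>. laplace g \<nu> \<partial>P n) \<longlonglongrightarrow> (\<integral>\<nu>. laplace g \<nu> \<partial>Q)"
  shows "weakly_converges P Q"
  unfolding weakly_converges_def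
proof (intro allI impI, elim conjE)
  fix F :: "'a measure \<Rightarrow> real"
  assume F: "continuous_map vague_topology euclideanreal F" and "bounded (F ` counting_measures)"
  then obtain K where K: "\<And>\<nu>. \<nu> \<in> counting_measures \<Longrightarrow> \<bar>F \<nu>\<bar> \<le> K" by (force simp: bounded_iff)
  note lim = laplace_closure_convergence[OF P Q test_cone_bounded_test conv]
  have up: "continuous_map vague_topology euclideanreal (\<lambda>\<nu>. F \<nu> + K)"
    and down: "continuous_map vague_topology euclideanreal (\<lambda>\<nu>. K - F \<nu>)"
    using F by (auto intro!: continuous_intros)
  have bu: "0 \<le> F \<nu> + K \<and> F \<nu> + K \<le> 2 * K" and bd: "0 \<le> K - F \<nu> \<and> K - F \<nu> \<le> 2 * K"
    if "\<nu> \<in> counting_measures" for \<nu>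
    using K[OF that] by (auto simp: abs_le_iff)
  have "(\<lambda>\<nu>. F \<nu> + K) \<in> borel_measurable counting_algebra"
    using bu by (intro vague_continuous_measurable[OF up]) auto
  then have "(\<lambda>\<nu>. (F \<nu> + K) - K) \<in> borel_measurable counting_algebra"
    by (intro borel_measurable_diff borel_measurable_const)
  then have Fm: "F \<in> borel_measurable counting_algebra" by simp
  have int: "(\<integral>\<nu>. F \<nu> + K \<partial>R) = (\<integral>\<nu>. F \<nu> \<partial>R) + K" "(\<integral>\<nu>. K - F \<nu> \<partial>R) = K - (\<integral>\<nu>. F \<nu> \<partial>R)"
    if R: "counting_law R" for R
  proof -
    interpret R: counting_law R by fact
    have "integrable R F" by (rule R.integrable_bounded[OF Fm]) (rule K)
    then show "(\<integral>\<nu>. F \<nu> + K \<partial>R) = (\<integral>\<nu>. F \<nu> \<partial>R) + K" "(\<integral>\<nu>. K - F \<nu> \<partial>R) = K - (\<integral>\<nu>. F \<nu> \<partial>R)"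
      by (simp_all add: R.prob_space)
  qed
  show "(\<lambda>n. \<integral>\<nu>. F \<nu> \<partial>P n) \<longlonglongrightarrow> (\<integral>\<nu>. F \<nu> \<partial>Q)"
  proof (rule tendstoI)
    fix e :: real assume e: "0 < e"
    have "\<forall>\<^sub>F n in sequentially. (\<integral>\<nu>. F \<nu> + K \<partial>Q) - e < (\<integral>\<nu>. F \<nu> + K \<partial>P n)"
      by (rule liminf_integral_vague_continuous[OF P Q lim up bu e])
    moreover have "\<forall>\<^sub>F n in sequentially. (\<integral>\<nu>. K - F \<nu> \<partial>Q) - e < (\<integral>\<nu>. K - F \<nu> \<partial>P n)"
      by (rule liminf_integral_vague_continuous[OF P Q lim down bd e])
    ultimately show "\<forall>\<^sub>F n in sequentially. dist (\<integral>\<nu>. F \<nu> \<partial>P n) (\<integral>\<nu>. F \<nu> \<partial>Q) < e"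
      by eventually_elim (simp add: int[OF P] int[OF Q] dist_real_def abs_less_iff)
  qed
qed

theorem theorem3:
  fixes M :: "'w measure" and \<xi> :: "'w \<Rightarrow> 'a::polish_space measure"
    and N :: "'v measure" and \<xi>s :: "nat \<Rightarrow> 'v \<Rightarrow> 'a measure"
    and \<mu> :: "'a measure"
  assumes "point_process M \<xi>"
    and "\<mu> = intensity_measure M \<xi>"
    and "boundedly_finite \<mu>"
    and "prob_space N"
    and "prob_space.indep_vars N (\<lambda>_. counting_algebra) \<xi>s UNIV"
    and "\<And>i. distr N counting_algebra (\<xi>s i) = distr M counting_algebra \<xi>"
  shows "\<exists>(\<Omega> :: 'a measure measure) (\<eta> :: 'a measure \<Rightarrow> 'a measure).
      poisson_process \<Omega> \<eta> \<mu> \<and>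
      weakly_converges (\<lambda>n. thinning_law (1 / real n) N (superposition n \<xi>s))
        (distr \<Omega> counting_algebra \<eta>)"
proof (intro exI conjI)
  \<comment> \<open>Canonical realization: the probability space is the law itself and the process
    is the identity, so the image law is again \<open>poisson_law \<mu>\<close>.\<close>
  show "poisson_process (poisson_law \<mu>) (\<lambda>\<nu>. \<nu>) \<mu>"
    by (rule poisson_process_poisson_law[OF assms(3)])
  interpret Q: counting_law "poisson_law \<mu>" by (rule counting_law_poisson_law[OF assms(3)])
  have M: "prob_space M" "\<xi> \<in> M \<rightarrow>\<^sub>M counting_algebra"
    using assms(1) by (simp_all add: point_process_def)
  have "\<xi>s i \<in> N \<rightarrow>\<^sub>M counting_algebra" for i
    using assms(5) by (simp add: prob_space.indep_vars_def[OF assms(4)])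
  then have sup: "superposition n \<xi>s \<in> N \<rightarrow>\<^sub>M counting_algebra" for n by (rule measurable_superposition)
  have p: "0 \<le> 1 / real n" "1 / real n \<le> 1" for n :: nat by (cases n; simp add: field_simps)+
  have "weakly_converges (\<lambda>n. thinning_law (1 / real n) N (superposition n \<xi>s)) (poisson_law \<mu>)"
  proof (rule weakly_converges_laplace)
    show "counting_law (thinning_law (1 / real n) N (superposition n \<xi>s))" for n
      by (rule counting_law_thinning_law[OF assms(4) sup p])
    show "counting_law (poisson_law \<mu>)" by (rule Q.counting_law_axioms)
    fix g :: "'a \<Rightarrow> real" assume g: "g \<in> bounded_test"
    have "(\<integral>\<nu>. laplace g \<nu> \<partial>thinning_law (1 / real n) N (superposition n \<xi>s))
      = (\<integral>\<omega>. exp (- (\<integral>x. - ln (1 - 1 / real n * (1 - exp (- g x))) \<partial>\<xi> \<omega>)) \<partial>M) ^ n" for n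
      by (simp only: laplace_thinning_law[OF assms(4) sup p g]
        laplace_iid_superposition[OF M assms(4-6) bounded_test_thinned(1)[OF g p]])
    with thinned_laplace_limit[OF assms(1) assms(3)[unfolded assms(2)] g]
    show "(\<lambda>n. \<integral>\<nu>. laplace g \<nu> \<partial>thinning_law (1 / real n) N (superposition n \<xi>s))
      \<longlonglongrightarrow> (\<integral>\<nu>. laplace g \<nu> \<partial>poisson_law \<mu>)"
      unfolding assms(2) by (simp only: laplace_poisson_law[OF assms(3)[unfolded assms(2)] g])
  qed
  then show "weakly_converges (\<lambda>n. thinning_law (1 / real n) N (superposition n \<xi>s))
      (distr (poisson_law \<mu>) counting_algebra (\<lambda>\<nu>. \<nu>))"
    by (simp add: distr_id2[OF Q.sets_P[symmetric]])
qed

end
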